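(* For every integer $N\geq 1$, $$\varepsilon_0(N,3)=\frac{(8N+5)(N-1)N(N+1)}{210}\binom{2N+1}{N}.$$
   Context: Let $N\ge 1$. A gluing datum with $N$ edges and $3$ faces consists of a composition $(m_1,m_2,m_3)$ of $2N$ into positive integers and a fixed-point-free involution $\iota$ of $\{1,\dots,2N\}$. With $s_0=0$, $s_i=m_1+\dots+m_i$, let $\tau$ have cycles $(s_{i-1}+1,\dots,s_i)$, $i=1,2,3$. The datum is connected if $\langle\iota,\tau\rangle$ acts transitively and has genus $0$ if $\tau\iota$ has exactly $N-1$ cycles. (Geometrically: gluings of three numbered polygons with distinguished edges, $2N$ edges in total, into a sphere.) $\varepsilon_0(N,3)$ is the number of connected genus-$0$ such data. *)

theory Defs
  imports "HOL-Algebra.Sym_Groups" "HOL-Combinatorics.Orbits" Complex_Main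
begin

definition fixfree_involution :: "nat \<Rightarrow> (nat \<Rightarrow> nat) \<Rightarrow> bool" where
  "fixfree_involution n \<iota> \<longleftrightarrow>
     \<iota> permutes {1..n} \<and> (\<forall>x\<in>{1..n}. \<iota> (\<iota> x) = x \<and> \<iota> x \<noteq> x)"

definition gluing_datum3 :: "nat \<Rightarrow> (nat \<times> nat \<times> nat) \<times> (nat \<Rightarrow> nat) \<Rightarrow> bool" where
  "gluing_datum3 N = (\<lambda>((m1, m2, m3), \<iota>).
     m1 > 0 \<and> m2 > 0 \<and> m3 > 0 \<and> m1 + m2 + m3 = 2 * N \<and> fixfree_involution (2 * N) \<iota>)"

(* cycle_of_list [a, b, ..., z] maps a to b, ..., and z to a. *)
definition face_perm :: "nat \<times> nat \<times> nat \<Rightarrow> nat \<Rightarrow> nat" where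
  "face_perm = (\<lambda>(m1, m2, m3).
     cycle_of_list [1..<m1 + 1] \<circ>
     cycle_of_list [m1 + 1..<m1 + m2 + 1] \<circ>
     cycle_of_list [m1 + m2 + 1..<m1 + m2 + m3 + 1])"

definition transitive_on :: "(nat \<Rightarrow> nat) set \<Rightarrow> nat set \<Rightarrow> bool" where
  "transitive_on G S \<longleftrightarrow> (\<forall>x\<in>S. \<forall>y\<in>S. \<exists>g\<in>G. g x = y)"

definition connected_datum3 :: "nat \<Rightarrow> (nat \<times> nat \<times> nat) \<times> (nat \<Rightarrow> nat) \<Rightarrow> bool" where
  "connected_datum3 N = (\<lambda>(m, \<iota>).
     transitive_on (generate (sym_group (2 * N)) {\<iota>, face_perm m}) {1..2 * N})"

(* For a permutation of a finite set S, the orbits of the points of S are its cycles,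
   fixed points included as cycles of length one. *)
definition num_cycles :: "nat set \<Rightarrow> (nat \<Rightarrow> nat) \<Rightarrow> nat" where
  "num_cycles S p = card (orbit p ` S)"

definition genus0_datum3 :: "nat \<Rightarrow> (nat \<times> nat \<times> nat) \<times> (nat \<Rightarrow> nat) \<Rightarrow> bool" where
  "genus0_datum3 N = (\<lambda>(m, \<iota>). num_cycles {1..2 * N} (face_perm m \<circ> \<iota>) = N - 1)"

definition epsilon0_3 :: "nat \<Rightarrow> nat" where
  "epsilon0_3 N =
     card {d. gluing_datum3 N d \<and> connected_datum3 N d \<and> genus0_datum3 N d}"

lemma finite_gluing_data3: "finite {d. gluing_datum3 N d}"
proof (rule finite_subset)
  show "{d. gluing_datum3 N d} \<subseteq>
      ({..2 * N} \<times> {..2 * N} \<times> {..2 * N}) \<times> {p. p permutes {1..2 * N}}"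
    by (auto simp: gluing_datum3_def fixfree_involution_def)
  show "finite (({..2 * N} \<times> {..2 * N} \<times> {..2 * N}) \<times> {p. p permutes {1..2 * N}})"
    by (intro finite_cartesian_product finite_permutations) auto
qed

lemma face_perm_permutes:
  assumes "m1 + m2 + m3 = n"
  shows "face_perm (m1, m2, m3) permutes {1..n}"
proof -
  have "cycle_of_list [a..<b] permutes {1..n}" if "1 \<le> a" "b \<le> n + 1" for a b
    by (rule permutes_subset[OF cycle_permutes]) (use that in auto)
  from this[of 1 "m1 + 1"] this[of "m1 + 1" "m1 + m2 + 1"]
    this[of "m1 + m2 + 1" "m1 + m2 + m3 + 1"] assms
  show ?thesis
    unfolding face_perm_def prod.case
    by (intro permutes_compose) (simp_all del: upt_Suc)
qed

end

(*
  A face may carry dead corners: besides the permutation tau and its closed set S we keep a set D of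
  live points, and only D is matched by the involution. Deleting the edge {x, y} with iota x = y
  leaves S untouched; it replaces tau by tau' = tau o (x y) and D by D - {x, y}, while the vertex
  permutation tau o iota does not change. If x and y lie on different faces, these faces merge;
  otherwise their face splits into two, and Euler's inequality forces a connected genus 0 gluing to
  fall apart into two such gluings. Hence the numbers of planar gluings with one, two and three
  faces satisfy the recursions of Tutte's root edge deletion, whose solutions are
    one face of degree 2k:            the Catalan number,
    two faces of degrees a, b:        2 w(a) w(b) / (a + b),
    three faces of degrees a, b, c:   w(a) w(b) w(c),
  with w(2k) = k binom(2k, k) and w(2k+1) = (2k+1) binom(2k, k), for degrees of even sum (Tutte's
  slicings formula). All convolutions occurring here reduce by partial fractions to
    sum_p c_p c_(n-p) / (p + k) = c_(n+k) / (k c_k),   c_p = binom(2p, p).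
  Finally the generating function of w is t (1 + 2t) (1 - 4t^2)^(-3/2), and the coefficients of its
  cube are read off by differentiating (1 - 4t^2)^(-1/2).
*)
theory Submission
  imports Defs "HOL-Computational_Algebra.Formal_Power_Series"
begin

section \<open>Convolutions of central binomial coefficients\<close>

text \<open>Removing \<open>x\<close> and \<open>y\<close> from \<open>S\<close> would force a
  relabelling of the faces after each deletion, and a face that loses its last edge would leave no
  point behind. Dead corners avoid both: the domain of the permutations never changes, and faces of
  degree zero are legitimate. The induction therefore runs over arbitrary permutations and live
  sets, and it carries the claim that a count depends only on the numbers of live points on the
  faces. Degree zero also supplies the boundary values: a lone face without live points counts once
  (a sphere with one vertex), whereas beside other faces it rules out connectedness, in accordance
  with w(0) = 0.

  The closed forms are known in advance and only have to be checked against the recursions. The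
  obstacle is the case of three faces, where the convolutions produce powers of 2 that are absent
  from w(a) w(b) w(c). They cancel between the terms with a disk and those with annuli, and the
  parity of a + b + c enters this cancellation.\<close>

definition central_binom :: "nat \<Rightarrow> real" where
  "central_binom k = real ((2 * k) choose k)"

lemma central_binom_pos: "central_binom k > 0"
  by (simp add: central_binom_def)

lemma central_binom_0 [simp]: "central_binom 0 = 1"
  by (simp add: central_binom_def)

lemma central_binom_Suc: "(real k + 1) * central_binom (Suc k) = (4 * real k + 2) * central_binom k"
proof -
  have "Suc k * (2 * Suc k choose Suc k) = 2 * Suc k * (Suc (2 * k) choose k)"
    using Suc_times_binomial[of k "Suc (2 * k)"] by simp
  also have "(Suc (2 * k) choose k) = (Suc (2 * k) choose Suc k)"
    using binomial_symmetric[of k "Suc (2*k)"] by simp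
  also have "2 * Suc k * (Suc (2 * k) choose Suc k) = 2 * (Suc (2 * k) * (2 * k choose k))"
    using Suc_times_binomial[of k "2 * k"] by simp
  finally have "real (Suc k * (2 * Suc k choose Suc k))
      = real (2 * (Suc (2 * k) * (2 * k choose k)))"
    by (rule arg_cong)
  thus ?thesis unfolding central_binom_def by (simp add: algebra_simps)
qed

text \<open>The recurrence q c_q = (4 (q - 1) + 2) c_(q-1) is applied with q =
  \<open>Suc n - p\<close>, and the term \<open>p = Suc n\<close> vanishes. The factor
  \<open>f\<close> stays open because it is used both with and without a denominator
  \<open>p + k\<close>.\<close>

lemma sum_central_binom_Suc_right:
  "(\<Sum>p\<le>Suc n. f p * (real (Suc n - p) * central_binom (Suc n - p))) =
   (\<Sum>p\<le>n. f p * ((4 * real (n - p) + 2) * central_binom (n - p)))"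
proof -
  have "(\<Sum>p\<le>Suc n. f p * (real (Suc n - p) * central_binom (Suc n - p))) =
    (\<Sum>p\<le>n. f p * (real (Suc n - p) * central_binom (Suc n - p)))" by simp
  also have "\<dots> = (\<Sum>p\<le>n. f p * ((4 * real (n - p) + 2) * central_binom (n - p)))"
  proof (intro sum.cong refl)
    fix p assume "p \<in> {..n}"
    hence "Suc n - p = Suc (n - p)" by (simp add: Suc_diff_le)
    thus "f p * (real (Suc n - p) * central_binom (Suc n - p)) = f p * ((4 * real (n - p)
        + 2) * central_binom (n - p))"
      using central_binom_Suc[of "n - p"] by (simp only: of_nat_Suc add.commute[of 1])
  qed
  finally show ?thesis .
qed

text \<open>The reflection of \<open>p\<close> to \<open>n - p\<close> preserves the product, so the
  index may be replaced by its mean \<open>n / 2\<close>.\<close>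

lemma sum_central_binom_mult_index:
  "(\<Sum>p\<le>n. central_binom p * (real (n - p) * central_binom (n - p)))
      = real n / 2 * (\<Sum>p\<le>n. central_binom p * central_binom (n - p))"
proof -
  have "(\<Sum>p\<le>n. central_binom p * (real (n - p) * central_binom (n - p)))
      = (\<Sum>p\<le>n. real p * (central_binom p * central_binom (n - p)))"
    by (subst sum.nat_diff_reindex[symmetric, where n = "Suc n", simplified lessThan_Suc_atMost])
       (auto intro!: sum.cong)
  moreover have "(\<Sum>p\<le>n. central_binom p * (real (n - p) * central_binom (n - p)))
      + (\<Sum>p\<le>n. real p * (central_binom p * central_binom (n - p))) =
    real n * (\<Sum>p\<le>n. central_binom p * central_binom (n - p))"
    unfolding sum.distrib[symmetric] sum_distrib_left
    by (intro sum.cong refl) (auto simp: of_nat_diff algebra_simps)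
  ultimately show ?thesis by simp
qed

text \<open>Weighting with the index makes the recurrence applicable and so reduces the sum for
  \<open>Suc n\<close> to sums for \<open>n\<close>. In terms of generating functions, the square of
  1 / sqrt (1 - 4t) is 1 / (1 - 4t).\<close>

lemma sum_central_binom: "(\<Sum>p\<le>n. central_binom p * central_binom (n - p)) = 4 ^ n"
proof (induction n)
  case (Suc n)
  have "(real n + 1) / 2 * (\<Sum>p\<le>Suc n. central_binom p * central_binom (Suc n - p)) =
     (\<Sum>p\<le>n. central_binom p * ((4 * real (n - p) + 2) * central_binom (n - p)))"
    using sum_central_binom_mult_index[of "Suc n"] sum_central_binom_Suc_right[of central_binom n]
        by simp
  also have "\<dots> = 4 * (\<Sum>p\<le>n. central_binom p * (real (n - p) * central_binom (n - p)))
      + 2 * (\<Sum>p\<le>n. central_binom p * central_binom (n - p))"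
    unfolding sum_distrib_left sum.distrib[symmetric]
    by (intro sum.cong refl) (auto simp: algebra_simps)
  also have "\<dots> = (real n + 1) / 2 * 4 ^ Suc n"
    unfolding sum_central_binom_mult_index Suc.IH by (simp add: algebra_simps)
  finally show ?case by (simp del: sum.atMost_Suc)
qed simp

lemma sum_central_binom_index: "(\<Sum>p\<le>n. central_binom p * (real (n - p) * central_binom (n - p)))
    = real n / 2 * 4 ^ n"
  unfolding sum_central_binom_mult_index sum_central_binom ..

text \<open>Multiplication by n + 1 + k = (p + k) + (n + 1 - p) cancels the pole in one part and
  makes the recurrence applicable in the other. The resulting powers of 4 cancel, so the sum obeys
  the same first-order recurrence in \<open>n\<close> as
  \<open>central_binom (n + k)\<close>.\<close>

lemma sum_central_binom_divide:
  assumes "k > 0"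
  shows "(\<Sum>p\<le>n. central_binom p * central_binom (n - p) / (real p + real k)) = central_binom (n
      + k) / (real k * central_binom k)"
proof (induction n)
  case 0
  then show ?case using assms central_binom_pos[of k] by simp
next
  case (Suc n)
  have pos: "real p + real k > 0" for p using assms by simp
  have "(real n + 1 + real k) * (\<Sum>p\<le>Suc n. central_binom p * central_binom (Suc n - p) / (real p
      + real k)) =
    (\<Sum>p\<le>Suc n. central_binom p * central_binom (Suc n - p)) +
    (\<Sum>p\<le>Suc n. central_binom p / (real p + real k) * (real (Suc n - p) * central_binom (Suc n
        - p)))"
    unfolding sum_distrib_left sum.distrib[symmetric]
  proof (intro sum.cong refl)
    fix p assume "p \<in> {..Suc n}"
    hence "real n + 1 + real k = (real p + real k) + real (Suc n - p)" by (simp add: of_nat_diff)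
    moreover have "A * (u * v / d) = u * v + u / d * (q * v)" if "A = d + q" "d > 0"
        for A u v d q :: real
      using that by (simp add: field_simps)
    ultimately show "(real n + 1 + real k) * (central_binom p * central_binom (Suc n
        - p) / (real p + real k)) =
      central_binom p * central_binom (Suc n - p) + central_binom p / (real p
          + real k) * (real (Suc n - p) * central_binom (Suc n - p))"
      using pos[of p] by blast
  qed
  also have "(\<Sum>p\<le>Suc n. central_binom p / (real p + real k) * (real (Suc n
      - p) * central_binom (Suc n - p))) =
    (\<Sum>p\<le>n. central_binom p / (real p + real k) * ((4 * real (n - p) + 2) * central_binom (n - p)))"
    by (rule sum_central_binom_Suc_right)
  also have "\<dots> = (4 * (real n + real k) + 2) * (\<Sum>p\<le>n. central_binom p * central_binom (n
      - p) / (real p + real k))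
      - 4 * (\<Sum>p\<le>n. central_binom p * central_binom (n - p))"
    unfolding sum_distrib_left sum_subtractf[symmetric]
  proof (intro sum.cong refl)
    fix p assume "p \<in> {..n}"
    hence "4 * real (n - p) + 2 = 4 * (real n + real k) + 2 - 4 * (real p + real k)"
      by (simp add: of_nat_diff)
    moreover have "u / d * (q * v) = A * (u * v / d) - 4 * (u * v)" if "q = A - 4 * d" "d > 0"
      for A u v d q :: real
      unfolding that(1) using that(2) by (simp add: field_simps)
    ultimately show "central_binom p / (real p + real k) * ((4 * real (n - p)
        + 2) * central_binom (n - p)) =
      (4 * (real n + real k) + 2) * (central_binom p * central_binom (n - p) / (real p + real k))
          - 4 * (central_binom p * central_binom (n - p))"
      using pos[of p] by blast
  qed
  finally have "(real n + 1 + real k) * (\<Sum>p\<le>Suc n. central_binom p * central_binom (Suc n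
      - p) / (real p + real k)) =
     (4 * (real n + real k) + 2) * (central_binom (n + k) / (real k * central_binom k))"
    unfolding sum_central_binom Suc.IH by simp
  also have "\<dots> = (real n + 1 + real k) * (central_binom (Suc n + k) / (real k * central_binom k))"
  proof -
    have "(real n + 1 + real k) * central_binom (Suc n + k) = (4 * (real n + real k)
        + 2) * central_binom (n + k)"
      using central_binom_Suc[of "n + k"] by (simp add: add_ac)
    thus ?thesis unfolding times_divide_eq_right by simp
  qed
  finally show ?case
    by (rule mult_left_cancel[THEN iffD1, rotated]) (use assms in linarith)
qed

section \<open>Closed forms for one, two and three faces, and their convolutions\<close>

definition face_weight :: "nat \<Rightarrow> real" where
  "face_weight m = (if even m then real (m div 2) else real m) * central_binom (m div 2)"

definition disk_count :: "nat \<Rightarrow> real" where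
  "disk_count m = (if even m then central_binom (m div 2) / (real (m div 2) + 1) else 0)"

text \<open>For \<open>a = b = 0\<close> the quotient is 0 / 0, which has the value 0. This agrees
  with the count, since two faces without live points cannot be connected.\<close>

definition annulus_count :: "nat \<Rightarrow> nat \<Rightarrow> real" where
  "annulus_count a b = (if even (a + b) then 2 * face_weight a * face_weight b / (real a
      + real b) else 0)"

definition pants_count :: "nat \<Rightarrow> nat \<Rightarrow> nat \<Rightarrow> real" where
  "pants_count a b c = (if even (a + b + c) then face_weight a * face_weight b * face_weight c
      else 0)"

lemma face_weight_even [simp]: "face_weight (2 * k) = real k * central_binom k"
  by (simp add: face_weight_def)

lemma face_weight_odd [simp]: "face_weight (Suc (2 * k)) = (2 * real k + 1) * central_binom k"
  by (simp add: face_weight_def)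

lemma face_weight_0 [simp]: "face_weight 0 = 0"
  by (simp add: face_weight_def)

lemma disk_count_even [simp]: "disk_count (2 * k) = central_binom k / (real k + 1)"
  by (simp add: disk_count_def)

lemma disk_count_odd [simp]: "disk_count (Suc (2 * k)) = 0"
  by (simp add: disk_count_def)

lemma sum_lessThan_even:
  fixes g :: "nat \<Rightarrow> 'a::comm_monoid_add"
  assumes "\<And>i. i \<le> 2 * n \<Longrightarrow> odd i \<Longrightarrow> g i = 0"
  shows "(\<Sum>i<Suc (2 * n). g i) = (\<Sum>p\<le>n. g (2 * p))"
  using assms by (induction n) auto

lemma sum_lessThan_even':
  fixes g :: "nat \<Rightarrow> 'a::comm_monoid_add"
  assumes "\<And>i. i < 2 * n \<Longrightarrow> odd i \<Longrightarrow> g i = 0"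
  shows "(\<Sum>i<2 * n. g i) = (\<Sum>p<n. g (2 * p))"
  using assms by (induction n) auto

lemma sum_lessThan_odd:
  fixes g :: "nat \<Rightarrow> 'a::comm_monoid_add"
  assumes "\<And>i. i \<le> 2 * n \<Longrightarrow> even i \<Longrightarrow> g i = 0"
  shows "(\<Sum>i<Suc (2 * n). g i) = (\<Sum>p<n. g (Suc (2 * p)))"
  using assms by (induction n) auto

lemma sum_lessThan_odd':
  fixes g :: "nat \<Rightarrow> 'a::comm_monoid_add"
  assumes "\<And>i. i < 2 * n \<Longrightarrow> even i \<Longrightarrow> g i = 0"
  shows "(\<Sum>i<2 * n. g i) = (\<Sum>p<n. g (Suc (2 * p)))"
  using assms by (induction n) auto

text \<open>Polynomial division in \<open>p\<close> turns the summands of the later convolutions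
  into a linear quotient plus one simple pole, so this formula evaluates all four parity cases of
  \<open>annulus_sum\<close>.\<close>

lemma sum_central_binom_lincomb:
  assumes "k > 0"
  shows "(\<Sum>p\<le>n. (u + v * real p + w / (real p + real k)) * (central_binom p * central_binom (n
      - p))) =
    u * 4 ^ n + v * real n / 2 * 4 ^ n + w * central_binom (n + k) / (real k * central_binom k)"
proof -
  have "(\<Sum>p\<le>n. (u + v * real p + w / (real p + real k)) * (central_binom p * central_binom (n
      - p))) =
    u * (\<Sum>p\<le>n. central_binom p * central_binom (n - p)) +
    v * (real n * (\<Sum>p\<le>n. central_binom p * central_binom (n - p))
        - (\<Sum>p\<le>n. central_binom p * (real (n - p) * central_binom (n - p)))) +
    w * (\<Sum>p\<le>n. central_binom p * central_binom (n - p) / (real p + real k))"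
    unfolding sum_distrib_left sum.distrib[symmetric] sum_subtractf[symmetric]
    by (intro sum.cong refl) (auto simp: of_nat_diff algebra_simps)
  also have "\<dots> = u * 4 ^ n + v * real n / 2 * 4 ^ n + w * central_binom (n
      + k) / (real k * central_binom k)"
    unfolding sum_central_binom sum_central_binom_index sum_central_binom_divide[OF assms]
        by (simp add: algebra_simps)
  finally show ?thesis .
qed

text \<open>Segner's recursion for the Catalan numbers. The two poles separate by 1 / (x y) = (1 / x
  + 1 / y) / (x + y) with x + y = n + 2, and by reflection both halves equal
  \<open>central_binom (Suc n) / 2\<close>.\<close>

lemma disk_count_rec:
  assumes "a > 0"
  shows "disk_count a = (\<Sum>i<a - 1. disk_count i * disk_count (a - 2 - i))"
proof (cases "even a")
  case True
  then obtain n where a: "a = 2 * Suc n" using assms by (metis evenE gr0_conv_Suc mult_0_right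
      not_gr_zero)
  have "(\<Sum>i<a - 1. disk_count i * disk_count (a - 2 - i))
      = (\<Sum>i<Suc (2 * n). disk_count i * disk_count (2 * n - i))"
    by (simp add: a)
  also have "\<dots> = (\<Sum>p\<le>n. disk_count (2 * p) * disk_count (2 * n - 2 * p))"
    by (rule sum_lessThan_even) (auto simp: disk_count_def)
  also have "\<dots> = (\<Sum>p\<le>n. central_binom p / (real p + 1) * (central_binom (n - p) / (real (n - p)
      + 1)))"
    by (intro sum.cong refl) (simp flip: right_diff_distrib')
  also have "\<dots> = ((\<Sum>p\<le>n. central_binom p * central_binom (n - p) / (real p + real 1)) +
       (\<Sum>p\<le>n. central_binom (n - p) * central_binom p / (real (n - p) + real 1))) / (real n + 2)"
    unfolding sum.distrib[symmetric] sum_divide_distrib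
  proof (intro sum.cong refl)
    fix p assume "p \<in> {..n}"
    hence s: "real n + 2 = (real p + 1) + (real (n - p) + 1)" by simp
    have "u / x * (v / y) = (u * v / x + v * u / y) / s" if "s = x + y" "x > 0" "y > 0"
      for u v x y s :: real
      unfolding that(1) using that(2,3) by (simp add: divide_simps add_pos_pos) (simp add:
          algebra_simps)
    from this[OF s, of "central_binom p" "central_binom (n - p)"]
    show "central_binom p / (real p + 1) * (central_binom (n - p) / (real (n - p) + 1)) =
      (central_binom p * central_binom (n - p) / (real p + real 1) + central_binom (n
          - p) * central_binom p / (real (n - p) + real 1)) / (real n + 2)"
      unfolding of_nat_1 by linarith
  qed
  also have "(\<Sum>p\<le>n. central_binom (n - p) * central_binom p / (real (n - p) + real 1)) =
     (\<Sum>p\<le>n. central_binom p * central_binom (n - p) / (real p + real 1))"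
    by (subst sum.nat_diff_reindex[symmetric, where n = "Suc n", simplified lessThan_Suc_atMost])
       (auto intro!: sum.cong)
  also have "(\<Sum>p\<le>n. central_binom p * central_binom (n - p) / (real p + real 1))
      = central_binom (Suc n) / 2"
    using sum_central_binom_divide[of 1 n] central_binom_Suc[of 0] by simp
  finally show ?thesis by (simp only: a disk_count_even) simp
next
  case False
  then obtain n where a: "a = Suc (2 * n)" by (auto elim: oddE)
  have "(\<Sum>i<a - 1. disk_count i * disk_count (a - 2 - i)) = 0"
    by (rule sum.neutral) (use False in \<open>auto simp: disk_count_def\<close>)
  thus ?thesis by (simp only: a disk_count_odd)
qed

text \<open>For even \<open>a\<close> the factor is (n - p) / (p + 1) = -1 + (n + 1) / (p + 1): the
  pole yields the weight and the constant yields the power of 2. Odd \<open>a\<close> is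
  alike.\<close>

lemma sum_disk_count_face_weight:
  assumes "a > 0"
  shows "2 * (\<Sum>i<a - 1. disk_count i * face_weight (a - 2 - i)) = face_weight a - 2 ^ a / 2"
proof -
  consider n where "a = 2 * Suc n" | "a = 1" | n where "a = Suc (2 * Suc n)"
  proof -
    have "(\<exists>n. a = 2 * Suc n) \<or> a = 1 \<or> (\<exists>n. a = Suc (2 * Suc n))" using assms by presburger
    thus ?thesis using that by blast
  qed
  thus ?thesis
  proof cases
    case (1 n)
    have p4: "(2::real) ^ (2 * Suc n) = 4 * 4 ^ n" by (simp add: power_mult)
    have "(\<Sum>i<a - 1. disk_count i * face_weight (a - 2 - i))
        = (\<Sum>i<Suc (2 * n). disk_count i * face_weight (2 * n - i))"
      by (simp add: 1)
    also have "\<dots> = (\<Sum>p\<le>n. disk_count (2 * p) * face_weight (2 * n - 2 * p))"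
      by (rule sum_lessThan_even) (auto simp: disk_count_def)
    also have "\<dots> = (\<Sum>p\<le>n. (- 1 + 0 * real p + (real n + 1) / (real p
        + real 1)) * (central_binom p * central_binom (n - p)))"
    proof (intro sum.cong refl)
      fix p assume "p \<in> {..n}"
      thus "disk_count (2 * p) * face_weight (2 * n - 2 * p) =
         (- 1 + 0 * real p + (real n + 1) / (real p + real 1)) * (central_binom p * central_binom
             (n - p))"
        by (simp flip: right_diff_distrib' add: of_nat_diff) (simp add: field_simps)
    qed
    also have "\<dots> = - (4 ^ n) + (real n + 1) * central_binom (Suc n) / 2"
      using sum_central_binom_lincomb[of 1 "- 1" 0 "real n + 1" n] central_binom_Suc[of 0] by simp
    finally show ?thesis unfolding 1 face_weight_even p4
        by (simp add: algebra_simps del: sum.lessThan_Suc)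
  next
    case 2
    then show ?thesis using face_weight_odd[of 0] by simp
  next
    case (3 n)
    have p4: "(2::real) ^ Suc (2 * Suc n) = 8 * 4 ^ n" by (simp add: power_mult)
    have "(\<Sum>i<a - 1. disk_count i * face_weight (a - 2 - i))
        = (\<Sum>i<2 * Suc n. disk_count i * face_weight (Suc (2 * n) - i))"
      by (simp add: 3)
    also have "\<dots> = (\<Sum>p<Suc n. disk_count (2 * p) * face_weight (Suc (2 * n) - 2 * p))"
      by (rule sum_lessThan_even') (auto simp: disk_count_def)
    also have "\<dots> = (\<Sum>p\<le>n. (- 2 + 0 * real p + (2 * real n + 3) / (real p
        + real 1)) * (central_binom p * central_binom (n - p)))"
      unfolding lessThan_Suc_atMost
    proof (intro sum.cong refl)
      fix p assume "p \<in> {..n}"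
      hence "Suc (2 * n) - 2 * p = Suc (2 * (n - p))" by auto
      thus "disk_count (2 * p) * face_weight (Suc (2 * n) - 2 * p) =
         (- 2 + 0 * real p + (2 * real n + 3) / (real p
             + real 1)) * (central_binom p * central_binom (n - p))"
        using \<open>p \<in> {..n}\<close> by (simp only: disk_count_even face_weight_odd) (simp add: of_nat_diff
            field_simps)
    qed
    also have "\<dots> = - 2 * (4 ^ n) + (2 * real n + 3) * central_binom (Suc n) / 2"
      using sum_central_binom_lincomb[of 1 "- 2" 0 "2 * real n + 3" n] central_binom_Suc[of 0]
          by simp
    finally show ?thesis unfolding 3 face_weight_odd p4
        by (simp add: algebra_simps del: sum.lessThan_Suc)
  qed
qed

text \<open>
  In the recursion for three faces of degrees \<open>a, b, c\<close> the product of two annulus counts has the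
  denominator \<open>(i + b) (j + c)\<close> with \<open>i + j = a - 2\<close>. As \<open>(i + b) + (j + c)\<close> does not depend on \<open>i\<close>,
  partial fractions split the sum into one that involves only \<open>a, b\<close> and one that involves only
  \<open>a, c\<close>.
\<close>

definition annulus_sum :: "nat \<Rightarrow> nat \<Rightarrow> real" where
  "annulus_sum a b = (\<Sum>i<a - 1. if even (i + b) then face_weight i * face_weight (a - 2
      - i) * 2 / (real i + real b) else 0)"

lemma annulus_sum_Suc_Suc:
  "annulus_sum (Suc (Suc m)) b =
    (\<Sum>i<Suc m. if even (i + b) then face_weight i * face_weight (m - i) * 2 / (real i
        + real b) else 0)"
  by (simp add: annulus_sum_def cong: if_cong)

text \<open>The cases are chosen so that
  \<open>annulus_shift a b + annulus_shift a c = a - 2\<close> whenever \<open>a + b + c\<close> is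
  even. For odd \<open>a\<close> exactly one of \<open>b\<close>, \<open>c\<close> is even, hence
  the two unequal values.\<close>

definition annulus_shift :: "nat \<Rightarrow> nat \<Rightarrow> real" where
  "annulus_shift a b = (if even a then (real a - 2) / 2 else if even b then (real a
      - 1) / 2 else (real a - 3) / 2)"

text \<open>With i = 2p and b = 2k the division reads p (n - p) = (n + k - p) (p + k) - k (n + k).
  The other parities differ in the coefficients and in the place of the pole.\<close>

lemma annulus_sum_even_even:
  assumes "k > 0"
  shows "annulus_sum (2 * Suc n) (2 * k) =
    (real n / 2 + real k) * 4 ^ n - (real n + real k) * central_binom (n + k) / central_binom k"
proof -
  have "annulus_sum (2 * Suc n) (2 * k) = (\<Sum>i<Suc (2 * n). if even (i
      + 2 * k) then face_weight i * face_weight (2 * n - i) * 2 / (real i + real (2 * k)) else 0)"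
    using annulus_sum_Suc_Suc[of "2 * n" "2 * k"] by simp
  also have "\<dots> = (\<Sum>p\<le>n. face_weight (2 * p) * face_weight (2 * n - 2 * p) * 2 / (real (2 * p)
      + real (2 * k)))"
    by (subst sum_lessThan_even) auto
  also have "\<dots> = (\<Sum>p\<le>n. (real n + real k + (- 1) * real p + (- (real k * (real n
      + real k))) / (real p + real k)) * (central_binom p * central_binom (n - p)))"
  proof (intro sum.cong refl)
    fix p assume p: "p \<in> {..n}"
    hence e: "2 * n - 2 * p = 2 * (n - p)" "real (n - p) = real n - real p" by auto
    have "x * u * ((n' - x) * v) * 2 / (2 * x + 2 * k') =
      (n' + k' + (- 1) * x + (- (k' * (n' + k'))) / (x + k')) * (u * v)"
      if "x + k' > 0" for x u v n' k' :: real
    proof -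
      have "2 * x + 2 * k' \<noteq> 0" using that by linarith
      thus ?thesis using that by (simp add: divide_simps) (simp add: algebra_simps)
    qed
    thus "face_weight (2 * p) * face_weight (2 * n - 2 * p) * 2 / (real (2 * p) + real (2 * k))
        = (real n + real k + (- 1) * real p + (- (real k * (real n + real k))) / (real p
        + real k)) * (central_binom p * central_binom (n - p))"
      unfolding e(1) face_weight_even e(2) using assms by simp
  qed
  also have "\<dots> = (real n / 2 + real k) * 4 ^ n - (real n + real k) * central_binom (n
      + k) / central_binom k"
    unfolding sum_central_binom_lincomb[OF assms] using assms central_binom_pos[of k]
        by (simp add: field_simps)
  finally show ?thesis .
qed

text \<open>For i = 2p + 1 and b = 2k + 1 the pole lies at p = -(k + 1), so
  \<open>central_binom (Suc k)\<close> appears and is reduced to \<open>central_binom k\<close>. For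
  a = 2 there is no odd index at all, hence the start at degree 4.\<close>

lemma annulus_sum_even_odd:
  "annulus_sum (2 * Suc (Suc n)) (Suc (2 * k)) =
    (2 * real n + 4 * real k + 4) * 4 ^ n - (2 * real n + 2 * real k + 3) * central_binom (Suc (n
        + k)) / (2 * central_binom k)"
proof -
  have "annulus_sum (2 * Suc (Suc n)) (Suc (2 * k)) = (\<Sum>i<Suc (2 * Suc n). if even (i
      + Suc (2 * k)) then face_weight i * face_weight (2 * Suc n - i) * 2 / (real i
      + real (Suc (2 * k))) else 0)"
    using annulus_sum_Suc_Suc[of "2 * Suc n" "Suc (2 * k)"] by simp
  also have "\<dots> = (\<Sum>p<Suc n. face_weight (Suc (2 * p)) * face_weight (2 * Suc n
      - Suc (2 * p)) * 2 / (real (Suc (2 * p)) + real (Suc (2 * k))))"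
    by (subst sum_lessThan_odd) auto
  also have "\<dots> = (\<Sum>p\<le>n. (4 * real n + 2 + 2 * (2 * real k + 1) + (- 4) * real p + (- ((2 * real k
      + 1) * (2 * real n + 2 * real k + 3))) / (real p + real (Suc k))) * (central_binom p *
      central_binom (n - p)))"
    unfolding lessThan_Suc_atMost
  proof (intro sum.cong refl)
    fix p assume p: "p \<in> {..n}"
    hence e: "2 * Suc n - Suc (2 * p) = Suc (2 * (n - p))" "real (n - p) = real n - real p" by auto
    have "(2 * x + 1) * u * ((2 * (n' - x) + 1) * v) * 2 / (2 * x + 1 + (2 * k' + 1)) =
      (4 * n' + 2 + 2 * (2 * k' + 1) + (- 4) * x + (- ((2 * k' + 1) * (2 * n' + 2 * k' + 3))) / (x
          + (k' + 1))) * (u * v)"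
      if "x + k' \<ge> 0" for x u v n' k' :: real
    proof -
      have "2 * x + 1 + (2 * k' + 1) \<noteq> 0" "x + (k' + 1) \<noteq> 0" using that by linarith+
      thus ?thesis by (simp add: divide_simps) (simp add: algebra_simps)
    qed
    from this[of "real p" "real k" "central_binom p" "real n" "central_binom (n
        - p)"] show "face_weight (Suc (2 * p)) * face_weight (2 * Suc n
        - Suc (2 * p)) * 2 / (real (Suc (2 * p)) + real (Suc (2 * k))) = (4 * real n + 2
        + 2 * (2 * real k + 1) + (- 4) * real p + (- ((2 * real k + 1) * (2 * real n + 2 * real k
        + 3))) / (real p + real (Suc k))) * (central_binom p * central_binom (n - p))"
      unfolding e(1) face_weight_odd e(2) by (simp add: add_ac)
  qed
  also have "\<dots> = (2 * real n + 4 * real k + 4) * 4 ^ n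
     - (2 * real k + 1) * (2 * real n + 2 * real k + 3) * central_binom (Suc (n
         + k)) / ((4 * real k + 2) * central_binom k)"
  proof -
    have c: "real (Suc k) * central_binom (Suc k) = (4 * real k + 2) * central_binom k"
      using central_binom_Suc[of k] by (simp add: add.commute)
    have sub: "u + v + - x * y / d = w - x * y / d" if "u + v = w" for u v w x y d :: real
      using that by simp
    show ?thesis unfolding sum_central_binom_lincomb[OF zero_less_Suc] c
      by (simp only: add_Suc_right, rule sub) (simp add: algebra_simps)
  qed
  also have "(2 * real k + 1) * (2 * real n + 2 * real k + 3) * central_binom (Suc (n
      + k)) / ((4 * real k + 2) * central_binom k)
     = (2 * real n + 2 * real k + 3) * central_binom (Suc (n + k)) / (2 * central_binom k)"
  proof -
    have "(2 * real k + 1) * (2 * real n + 2 * real k + 3) * central_binom (Suc (n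
        + k)) / ((4 * real k + 2) * central_binom k) =
      ((2 * real k + 1) * ((2 * real n + 2 * real k + 3) * central_binom (Suc (n
          + k)))) / ((2 * real k + 1) * (2 * central_binom k))"
      by (simp add: algebra_simps)
    also have "\<dots> = (2 * real n + 2 * real k + 3) * central_binom (Suc (n
        + k)) / (2 * central_binom k)"
      by (rule mult_divide_mult_cancel_left) linarith
    finally show ?thesis .
  qed
  finally show ?thesis .
qed

lemma annulus_sum_odd_even:
  assumes "k > 0"
  shows "annulus_sum (Suc (2 * Suc n)) (2 * k) =
    (real n + 2 * real k + 1) * 4 ^ n - (2 * real n + 2 * real k + 1) * central_binom (n
        + k) / central_binom k"
proof -
  have "annulus_sum (Suc (2 * Suc n)) (2 * k) = (\<Sum>i<2 * Suc n. if even (i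
      + 2 * k) then face_weight i * face_weight (Suc (2 * n) - i) * 2 / (real i
      + real (2 * k)) else 0)"
    using annulus_sum_Suc_Suc[of "Suc (2 * n)" "2 * k"] by simp
  also have "\<dots> = (\<Sum>p<Suc n. face_weight (2 * p) * face_weight (Suc (2 * n)
      - 2 * p) * 2 / (real (2 * p) + real (2 * k)))"
    by (subst sum_lessThan_even') auto
  also have "\<dots> = (\<Sum>p\<le>n. (2 * real n + 2 * real k + 1 + (- 2) * real p + (- (real k * (2 * real n
      + 2 * real k + 1))) / (real p + real k)) * (central_binom p * central_binom (n - p)))"
    unfolding lessThan_Suc_atMost
  proof (intro sum.cong refl)
    fix p assume p: "p \<in> {..n}"
    hence e: "Suc (2 * n) - 2 * p = Suc (2 * (n - p))" "real (n - p) = real n - real p" by auto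
    have "x * u * ((2 * (n' - x) + 1) * v) * 2 / (2 * x + 2 * k') =
      (2 * n' + 2 * k' + 1 + (- 2) * x + (- (k' * (2 * n' + 2 * k' + 1))) / (x + k')) * (u * v)"
      if "x + k' > 0" for x u v n' k' :: real
    proof -
      have "2 * x + 2 * k' \<noteq> 0" using that by linarith
      thus ?thesis using that by (simp add: divide_simps) (simp add: algebra_simps)
    qed
    thus "face_weight (2 * p) * face_weight (Suc (2 * n) - 2 * p) * 2 / (real (2 * p)
        + real (2 * k)) = (2 * real n + 2 * real k + 1 + (- 2) * real p + (- (real k * (2 * real n
        + 2 * real k + 1))) / (real p + real k)) * (central_binom p * central_binom (n - p))"
      unfolding e(1) face_weight_even face_weight_odd e(2) using assms by simp
  qed
  also have "\<dots> = (real n + 2 * real k + 1) * 4 ^ n - (2 * real n + 2 * real k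
      + 1) * central_binom (n + k) / central_binom k"
    unfolding sum_central_binom_lincomb[OF assms] using assms central_binom_pos[of k]
        by (simp add: field_simps)
  finally show ?thesis .
qed

lemma annulus_sum_odd_odd:
  "annulus_sum (Suc (2 * Suc n)) (Suc (2 * k)) =
    (real n + 2 * real k + 1) * 4 ^ n - (real n + real k + 1) * central_binom (Suc (n
        + k)) / (2 * central_binom k)"
proof -
  have "annulus_sum (Suc (2 * Suc n)) (Suc (2 * k)) = (\<Sum>i<2 * Suc n. if even (i
      + Suc (2 * k)) then face_weight i * face_weight (Suc (2 * n) - i) * 2 / (real i
      + real (Suc (2 * k))) else 0)"
    using annulus_sum_Suc_Suc[of "Suc (2 * n)" "Suc (2 * k)"] by simp
  also have "\<dots> = (\<Sum>p<Suc n. face_weight (Suc (2 * p)) * face_weight (Suc (2 * n)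
      - Suc (2 * p)) * 2 / (real (Suc (2 * p)) + real (Suc (2 * k))))"
    by (subst sum_lessThan_odd') auto
  also have "\<dots> = (\<Sum>p\<le>n. (2 * real n + (2 * real k + 1) + (- 2) * real p + (- ((2 * real k
      + 1) * (real n + real k + 1))) / (real p + real (Suc k))) * (central_binom p * central_binom
      (n - p)))"
    unfolding lessThan_Suc_atMost
  proof (intro sum.cong refl)
    fix p assume p: "p \<in> {..n}"
    hence e: "Suc (2 * n) - Suc (2 * p) = 2 * (n - p)" "real (n - p) = real n - real p" by auto
    have "(2 * x + 1) * u * ((n' - x) * v) * 2 / (2 * x + 1 + (2 * k' + 1)) =
      (2 * n' + (2 * k' + 1) + (- 2) * x + (- ((2 * k' + 1) * (n' + k' + 1))) / (x + (k'
          + 1))) * (u * v)"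
      if "x + k' \<ge> 0" for x u v n' k' :: real
    proof -
      have "2 * x + 1 + (2 * k' + 1) \<noteq> 0" "x + (k' + 1) \<noteq> 0" using that by linarith+
      thus ?thesis by (simp add: divide_simps) (simp add: algebra_simps)
    qed
    from this[of "real p" "real k" "central_binom p" "real n" "central_binom (n
        - p)"] show "face_weight (Suc (2 * p)) * face_weight (Suc (2 * n)
        - Suc (2 * p)) * 2 / (real (Suc (2 * p)) + real (Suc (2 * k))) = (2 * real n + (2 * real k
        + 1) + (- 2) * real p + (- ((2 * real k + 1) * (real n + real k + 1))) / (real p
        + real (Suc k))) * (central_binom p * central_binom (n - p))"
      unfolding e(1) face_weight_odd face_weight_even e(2) by (simp add: add_ac)
  qed
  also have "\<dots> = (real n + 2 * real k + 1) * 4 ^ n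
     - (2 * real k + 1) * (real n + real k + 1) * central_binom (Suc (n + k)) / ((4 * real k
         + 2) * central_binom k)"
  proof -
    have c: "real (Suc k) * central_binom (Suc k) = (4 * real k + 2) * central_binom k"
      using central_binom_Suc[of k] by (simp add: add.commute)
    have sub: "u + v + - x * y / d = w - x * y / d" if "u + v = w" for u v w x y d :: real
      using that by simp
    show ?thesis unfolding sum_central_binom_lincomb[OF zero_less_Suc] c
      by (simp only: add_Suc_right, rule sub) (simp add: algebra_simps)
  qed
  also have "(2 * real k + 1) * (real n + real k + 1) * central_binom (Suc (n + k)) / ((4 * real k
      + 2) * central_binom k)
     = (real n + real k + 1) * central_binom (Suc (n + k)) / (2 * central_binom k)"
  proof -
    have "(2 * real k + 1) * (real n + real k + 1) * central_binom (Suc (n + k)) / ((4 * real k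
        + 2) * central_binom k) =
      ((2 * real k + 1) * ((real n + real k + 1) * central_binom (Suc (n + k)))) / ((2 * real k
          + 1) * (2 * central_binom k))"
      by (simp add: algebra_simps)
    also have "\<dots> = (real n + real k + 1) * central_binom (Suc (n + k)) / (2 * central_binom k)"
      by (rule mult_divide_mult_cancel_left) linarith
    finally show ?thesis .
  qed
  finally show ?thesis .
qed

section \<open>Recursions for the numbers of planar gluings\<close>

text \<open>The merge term \<open>real b * face_weight (a + b - 2)\<close> cancels the contribution
  of the pole of \<open>annulus_sum\<close>, which leaves a power of 2 times a linear factor. The
  cases a = 1, and a = 2 with odd \<open>b\<close>, stand apart because \<open>annulus_sum\<close>
  vanishes there.\<close>

lemma annulus_sum_identity:
  assumes "a > 0" "b > 0"
  shows "2 * face_weight b * annulus_sum a b + real b * face_weight (a + b - 2)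
      = face_weight b * 2 ^ a / 4 * (real b + annulus_shift a b)"
proof -
  have pos: "central_binom k > 0" "central_binom k \<noteq> 0" for k using central_binom_pos[of k] by auto
  have "(\<exists>n. a = 2 * Suc n) \<and> (a = 2 \<or> (\<exists>n. a = 2 * Suc (Suc n))) \<or> a = 1 \<or> (\<exists>n. a
      = Suc (2 * Suc n))"
    using assms(1) by presburger
  moreover have "(\<exists>k>0. b = 2 * k) \<and> (\<exists>k. b = 2 * Suc k) \<or> (\<exists>k. b = Suc (2 * k))"
    using assms(2) by presburger
  ultimately consider
      n k where "a = 2 * Suc n" "b = 2 * k" "k > 0"
    | k where "a = 2" "b = Suc (2 * k)"
    | n k where "a = 2 * Suc (Suc n)" "b = Suc (2 * k)"
    | k where "a = 1" "b = 2 * Suc k"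
    | k where "a = 1" "b = Suc (2 * k)"
    | n k where "a = Suc (2 * Suc n)" "b = 2 * k" "k > 0"
    | n k where "a = Suc (2 * Suc n)" "b = Suc (2 * k)"
    by blast
  thus ?thesis
  proof cases
    case (1 n k)
    have e: "a + b - 2 = 2 * (n + k)" and p: "(2::real) ^ a = 4 * 4 ^ n" and E: "annulus_shift a b
        = real n"
      by (auto simp: 1 power_mult annulus_shift_def)
    show ?thesis unfolding e p E unfolding 1(1,2) annulus_sum_even_even[OF 1(3)] face_weight_even
      using pos[of k] by (simp add: field_simps)
  next
    case (2 k)
    have e: "a + b - 2 = Suc (2 * k)" and p: "(2::real) ^ a = 4" and E: "annulus_shift a b
        = 0" and T: "annulus_sum a b = 0"
      by (auto simp: 2 annulus_shift_def annulus_sum_def)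
    show ?thesis unfolding e p E T unfolding 2 by simp
  next
    case (3 n k)
    have e: "a + b - 2 = Suc (2 * Suc (n + k))" and p: "(2::real) ^ a
        = 16 * 4 ^ n" and E: "annulus_shift a b = real n + 1"
      by (auto simp: 3 power_mult annulus_shift_def)
    show ?thesis unfolding e p E unfolding 3 annulus_sum_even_odd face_weight_odd
      using pos[of k] by (simp add: field_simps)
  next
    case (4 k)
    have e: "a + b - 2 = Suc (2 * k)" and p: "(2::real) ^ a = 2" and E: "annulus_shift a b
        = 0" and T: "annulus_sum a b = 0"
      by (auto simp: 4 annulus_shift_def annulus_sum_def)
    show ?thesis unfolding e p E T unfolding 4 face_weight_even face_weight_odd
      using central_binom_Suc[of k] by (simp add: algebra_simps)
  next
    case (5 k)
    have e: "a + b - 2 = 2 * k" and p: "(2::real) ^ a = 2" and E: "annulus_shift a b =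
        - 1" and T: "annulus_sum a b = 0"
      by (auto simp: 5 annulus_shift_def annulus_sum_def)
    show ?thesis unfolding e p E T unfolding 5 face_weight_even face_weight_odd
      by (simp add: algebra_simps)
  next
    case (6 n k)
    have e: "a + b - 2 = Suc (2 * (n + k))" and p: "(2::real) ^ a
        = 8 * 4 ^ n" and E: "annulus_shift a b = real n + 1"
      by (auto simp: 6 power_mult annulus_shift_def)
    show ?thesis unfolding e p E unfolding 6(1,2) annulus_sum_odd_even[OF 6(3)] face_weight_even
        face_weight_odd
      using pos[of k] by (simp add: field_simps)
  next
    case (7 n k)
    have e: "a + b - 2 = 2 * Suc (n + k)" and p: "(2::real) ^ a
        = 8 * 4 ^ n" and E: "annulus_shift a b = real n"
      by (auto simp: 7 power_mult annulus_shift_def)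
    show ?thesis unfolding e p E unfolding 7 annulus_sum_odd_odd face_weight_even face_weight_odd
      using pos[of k] by (simp add: field_simps)
  qed
qed

text \<open>The products of annuli and the two merge terms regroup into
  \<open>annulus_sum_identity\<close> for \<open>b\<close> and for \<open>c\<close>. Together they
  give w(b) w(c) 2^a / 2, which is what the sum with the disks lacks.\<close>

lemma pants_count_rec:
  assumes "a > 0"
  shows "pants_count a b c = 2 * (\<Sum>i<a - 1. disk_count i * pants_count (a - 2 - i) b c)
    + 2 * (\<Sum>i<a - 1. annulus_count i b * annulus_count (a - 2 - i) c)
    + real b * annulus_count (a + b - 2) c + real c * annulus_count (a + c - 2) b"
proof (cases "b > 0 \<and> c > 0 \<and> even (a + b + c)")
  \<comment> \<open>Here every product vanishes, by parity or because an empty face has weight 0.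
    The truncation of \<open>a + b - 2\<close> at a = 1, b = 0 does no harm, as the factor
    \<open>b\<close> is 0.\<close>
  case False
  have *: "pants_count (a - 2 - i) b c = 0 \<or> disk_count i
      = 0" "annulus_count i b * annulus_count (a - 2 - i) c = 0" if "i < a - 1" for i
    using that False by (auto simp: pants_count_def disk_count_def annulus_count_def)
  have "(\<Sum>i<a - 1. disk_count i * pants_count (a - 2 - i) b c) = 0" "(\<Sum>i<a
      - 1. annulus_count i b * annulus_count (a - 2 - i) c) = 0"
    by (rule sum.neutral, use *(1) in fastforce) (rule sum.neutral, use *(2) in fastforce)
  moreover have "real b * annulus_count (a + b - 2) c = 0" "real c * annulus_count (a + c - 2) b
      = 0" "pants_count a b c = 0"
    using False assms by (auto simp: pants_count_def annulus_count_def)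
  ultimately show ?thesis by linarith
next
  case True
  \<comment> \<open>Half the number of live points left after the deletion of one edge;
    \<open>2 * M\<close> is the common denominator of all terms with annuli.\<close>
  define M where "M = (real a + real b + real c - 2) / 2"
  have "a + b + c \<ge> 3" using assms True by linarith
  moreover have "a + b + c \<noteq> 3" using True by (metis even_numeral odd_numeral)
  ultimately have "a + b + c > 3" by linarith
  hence M: "M > 0" by (simp add: M_def)
  have 1: "2 * (\<Sum>i<a - 1. disk_count i * pants_count (a - 2 - i) b c)
      = face_weight b * face_weight c * (face_weight a - 2 ^ a / 2)"
  proof -
    have "(\<Sum>i<a - 1. disk_count i * pants_count (a - 2 - i) b c) = (\<Sum>i<a
        - 1. face_weight b * face_weight c * (disk_count i * face_weight (a - 2 - i)))"
      using True by (intro sum.cong refl) (auto simp: disk_count_def pants_count_def)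
    also have "\<dots> = face_weight b * face_weight c * (\<Sum>i<a - 1. disk_count i * face_weight (a - 2
        - i))"
      by (rule sum_distrib_left[symmetric])
    finally have "2 * (\<Sum>i<a - 1. disk_count i * pants_count (a - 2 - i) b c) =
        face_weight b * face_weight c * (2 * (\<Sum>i<a - 1. disk_count i * face_weight (a - 2 - i)))"
      by (metis mult.left_commute)
    thus ?thesis unfolding sum_disk_count_face_weight[OF assms] .
  qed
  \<comment> \<open>Reversing the sum moves the pole from the second annulus to the first. The
    parity condition passes from \<open>b\<close> to \<open>c\<close> because
    \<open>a + b + c\<close> is even.\<close>
  have T: "(\<Sum>i<a - 1. if even (i + b) then face_weight i * face_weight (a - 2 - i) * 2 / (real (a
      - 2 - i) + real c) else 0) = annulus_sum a c"
    unfolding annulus_sum_def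
  proof (subst sum.nat_diff_reindex[symmetric], intro sum.cong refl)
    fix i assume "i \<in> {..<a - 1}"
    then obtain j where j: "a - 1 - Suc i = j" "a - 2 - i = j" "a - 2 - j = i" "j + i + 2 = a"
      by (intro that[of "a - 1 - Suc i"]) auto
    have "even (j + b) \<longleftrightarrow> even (i + c)" using True unfolding j(4)[symmetric] by presburger
    thus "(if even (a - 1 - Suc i + b) then face_weight (a - 1 - Suc i) * face_weight (a - 2 - (a
        - 1 - Suc i)) * 2 /
        (real (a - 2 - (a - 1 - Suc i)) + real c) else 0) =
      (if even (i + c) then face_weight i * face_weight (a - 2 - i) * 2 / (real i + real c) else 0)"
      unfolding j(1-3) by simp
  qed
  have 2: "2 * (\<Sum>i<a - 1. annulus_count i b * annulus_count (a - 2 - i) c)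
      = 2 * face_weight b * face_weight c / M * (annulus_sum a b + annulus_sum a c)"
    unfolding T[symmetric] unfolding annulus_sum_def sum_distrib_left sum.distrib[symmetric]
  proof (intro sum.cong refl)
    fix i assume i: "i \<in> {..<a - 1}"
    \<comment> \<open>Partial fractions with u = i + b and v = j + c, where j = a - 2 - i and u + v
      = 2 M.\<close>
    have alg: "2 * ((2 * x * y / u) * (2 * z * w / v)) = 2 * y * w / m * (x * z * 2 / u
        + x * z * 2 / v)"
      if "m = (u + v) / 2" "u > 0" "v > 0" for x y z w u v m :: real
      unfolding that(1) using that(2,3) by (simp add: divide_simps) (simp add: algebra_simps)
    show "2 * (annulus_count i b * annulus_count (a - 2 - i) c)
        = 2 * face_weight b * face_weight c / M *
       ((if even (i + b) then face_weight i * face_weight (a - 2 - i) * 2 / (real i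
           + real b) else 0) +
        (if even (i + b) then face_weight i * face_weight (a - 2 - i) * 2 / (real (a - 2 - i)
            + real c) else 0))"
    proof (cases "even (i + b)")
      case e: True
      obtain j where j: "a - 2 - i = j" "a = j + i + 2"
        by (rule that[of "a - 2 - i"]) (use i in auto)
      have "even (j + c)" using e True unfolding j(2) by presburger
      hence f: "annulus_count (a - 2 - i) c = 2 * face_weight (a - 2
          - i) * face_weight c / (real (a - 2 - i) + real c)"
        by (simp only: annulus_count_def if_True j(1))
      have M': "M = ((real i + real b) + (real (a - 2 - i) + real c)) / 2"
        unfolding M_def j(1) unfolding j(2) by simp
      have f': "annulus_count i b = 2 * face_weight i * face_weight b / (real i + real b)"
        using e by (simp only: annulus_count_def if_True)
      have "real i + real b > 0" "real (a - 2 - i) + real c > 0" using True by linarith+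
      from alg[OF M' this] show ?thesis unfolding f f' using e by (simp only: if_True)
    qed (simp add: annulus_count_def)
  qed
  have 3: "real b * annulus_count (a + b - 2) c = face_weight c / M * (real b * face_weight (a + b
      - 2))"
  proof -
    have "even (a + b - 2 + c)" "real (a + b - 2) + real c = 2 * M"
      using True assms by (auto simp: M_def of_nat_diff)
    thus ?thesis by (simp add: annulus_count_def)
  qed
  have 4: "real c * annulus_count (a + c - 2) b = face_weight b / M * (real c * face_weight (a + c
      - 2))"
  proof -
    have "even (a + c - 2 + b)" "real (a + c - 2) + real b = 2 * M"
      using True assms by (auto simp: M_def of_nat_diff)
    thus ?thesis by (simp add: annulus_count_def)
  qed
  have E: "real b + annulus_shift a b + (real c + annulus_shift a c) = 2 * M"
    using True by (auto simp: annulus_shift_def M_def field_simps)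
  have "2 * face_weight b * face_weight c / M * (annulus_sum a b + annulus_sum a c)
      + face_weight c / M * (real b * face_weight (a + b - 2))
      + face_weight b / M * (real c * face_weight (a + c - 2))
    = face_weight c / M * (2 * face_weight b * annulus_sum a b + real b * face_weight (a + b - 2))
        + face_weight b / M * (2 * face_weight c * annulus_sum a c + real c * face_weight (a + c
        - 2))"
    by (simp add: algebra_simps add_divide_distrib)
  also have "\<dots> = face_weight b * face_weight c * 2 ^ a / 4 / M * (real b + annulus_shift a b
      + (real c + annulus_shift a c))"
    using assms True by (simp add: annulus_sum_identity) (simp add: algebra_simps
        add_divide_distrib)
  also have "\<dots> = face_weight b * face_weight c * 2 ^ a / 2"
    unfolding E using M by simp
  finally show ?thesis unfolding 1 2 3 4 using True by (simp add: pants_count_def algebra_simps)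
qed

text \<open>Made for products of a disk, with the Catalan pole in \<open>p\<close>, and an annulus,
  with its pole in \<open>n - p\<close>. Reflection moves the second pole into
  \<open>p\<close>.\<close>

lemma sum_central_binom_two_poles:
  assumes "k > 0"
  shows "(\<Sum>p\<le>n. (u / (real p + 1) - w / (real (n - p) + real k)) * (central_binom p *
      central_binom (n - p))) =
    u * central_binom (Suc n) / 2 - w * central_binom (n + k) / (real k * central_binom k)"
proof -
  have "(\<Sum>p\<le>n. (u / (real p + 1) - w / (real (n - p) + real k)) * (central_binom p * central_binom
      (n - p))) =
    u * (\<Sum>p\<le>n. central_binom p * central_binom (n - p) / (real p + real 1))
        - w * (\<Sum>p\<le>n. central_binom (n - p) * central_binom p / (real (n - p) + real k))"
    unfolding sum_distrib_left sum_subtractf[symmetric]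
    by (intro sum.cong refl) (simp add: algebra_simps)
  also have "(\<Sum>p\<le>n. central_binom (n - p) * central_binom p / (real (n - p) + real k)) =
     (\<Sum>p\<le>n. central_binom p * central_binom (n - p) / (real p + real k))"
    by (subst sum.nat_diff_reindex[symmetric, where n = "Suc n", simplified lessThan_Suc_atMost])
       (auto intro!: sum.cong)
  finally show ?thesis
    using sum_central_binom_divide[of 1 n] sum_central_binom_divide[OF assms, of n]
        central_binom_Suc[of 0] by simp
qed

text \<open>Of the two poles in the convolution, that of the disk yields the annulus count. That of
  the annulus yields a multiple of a Catalan number, which the merge term with
  \<open>a + b - 2\<close> live points cancels.\<close>

lemma annulus_count_rec:
  assumes "a > 0"
  shows "annulus_count a b = 2 * (\<Sum>i<a - 1. disk_count i * annulus_count (a - 2 - i) b)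
      + real b * disk_count (a + b - 2)"
proof (cases "b > 0 \<and> even (a + b)")
  case False
  have "(\<Sum>i<a - 1. disk_count i * annulus_count (a - 2 - i) b) = 0"
    by (rule sum.neutral) (use False in \<open>auto simp: disk_count_def annulus_count_def\<close>)
  moreover have "real b * disk_count (a + b - 2) = 0" "annulus_count a b = 0"
    using False assms by (auto simp: disk_count_def annulus_count_def)
  ultimately show ?thesis by simp
next
  case True
  have "(\<exists>n. a = 2 * Suc n) \<or> a = 1 \<or> (\<exists>n. a = Suc (2 * Suc n))" using assms(1) by presburger
  moreover have "even a \<Longrightarrow> \<exists>k>0. b = 2 * k" "odd a \<Longrightarrow> \<exists>k. b = Suc (2 * k)" using True by presburger+
  ultimately consider
      n k where "a = 2 * Suc n" "b = 2 * k" "k > 0"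
    | k where "a = 1" "b = Suc (2 * k)"
    | n k where "a = Suc (2 * Suc n)" "b = Suc (2 * k)"
    by (metis even_Suc odd_one dvd_triv_left)
  thus ?thesis
  proof cases
    case (1 n k)
    have "(\<Sum>i<a - 1. disk_count i * annulus_count (a - 2 - i) b)
        = (\<Sum>i<Suc (2 * n). disk_count i * annulus_count (2 * n - i) b)"
      by (simp add: 1)
    also have "\<dots> = (\<Sum>p\<le>n. disk_count (2 * p) * annulus_count (2 * n - 2 * p) b)"
      by (rule sum_lessThan_even) (auto simp: disk_count_def)
    also have "\<dots> = real k * central_binom k / (real n + 1 + real k) *
      (\<Sum>p\<le>n. ((real n + 1) / (real p + 1) - real k / (real (n - p)
          + real k)) * (central_binom p * central_binom (n - p)))"
      unfolding sum_distrib_left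
    proof (intro sum.cong refl)
      fix p assume p: "p \<in> {..n}"
      have alg: "c / (x + 1) * (2 * (y * d) * K / (2 * y + 2 * k')) =
         K / L * (((m + 1) / (x + 1) - k' / (y + k')) * (c * d))"
        if "L = m + 1 + k'" "m = x + y" "x \<ge> 0" "y + k' > 0" for x y c d K k' L m :: real
      proof -
        have nz: "2 * y + 2 * k' \<noteq> 0" "x + 1 \<noteq> 0" "y + k' \<noteq> 0" "x + y + 1 + k' \<noteq> 0" using that
            by auto
        show ?thesis unfolding that(1,2) using nz by (simp add: divide_simps) (simp add:
            algebra_simps)
      qed
      have e: "2 * n - 2 * p = 2 * (n - p)" by auto
      have "annulus_count (2 * n - 2 * p) b = 2 * (real (n - p) * central_binom (n
          - p)) * (real k * central_binom k) / (2 * real (n - p) + 2 * real k)"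
        unfolding e 1 annulus_count_def face_weight_even by simp
      thus "disk_count (2 * p) * annulus_count (2 * n - 2 * p) b
          = real k * central_binom k / (real n + 1 + real k) *
          (((real n + 1) / (real p + 1) - real k / (real (n - p)
              + real k)) * (central_binom p * central_binom (n - p)))"
        unfolding disk_count_even using p 1(3)
        by (simp only:, intro alg) (auto simp: of_nat_diff)
    qed
    finally have s0: "(\<Sum>i<a - 1. disk_count i * annulus_count (a - 2 - i) b)
        = real k * central_binom k / (real n + 1 + real k) *
      (\<Sum>p\<le>n. ((real n + 1) / (real p + 1) - real k / (real (n - p)
          + real k)) * (central_binom p * central_binom (n - p)))" .
    have k0: "real k \<noteq> 0" using 1(3) by simp
    from s0 have S: "(\<Sum>i<a - 1. disk_count i * annulus_count (a - 2 - i) b)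
        = real k * central_binom k / (real n + 1 + real k) *
      ((real n + 1) * central_binom (Suc n) / 2 - central_binom (n + k) / central_binom k)"
      unfolding sum_central_binom_two_poles[OF 1(3)] mult_divide_mult_cancel_left[OF k0] .
    have e: "a + b - 2 = 2 * (n + k)" using 1 by auto
    have A: "annulus_count a b = (real n + 1) * central_binom (Suc n) * (real k * central_binom k)
        / (real n + 1 + real k)"
      unfolding 1 annulus_count_def face_weight_even by (simp add: divide_simps) (simp add:
          algebra_simps)
    have alg: "x * (K * c) / L = 2 * (K * c / L * (x / 2 - y / c)) + 2 * K * (y / L)"
      if "L > 0" "c > 0" for x K c y L :: real
      using that by (simp add: field_simps)
    show ?thesis unfolding S e A disk_count_even using alg[OF _ central_binom_pos, of "real n + 1
        + real k"]
      by (simp add: 1 add_ac)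
  next
    case (2 k)
    have e: "a + b - 2 = 2 * k" using 2 by auto
    have "annulus_count a b = (2 * real k + 1) * (central_binom k / (real k + 1))"
      unfolding 2 annulus_count_def face_weight_odd by (simp add: face_weight_def divide_simps)
    then show ?thesis unfolding e disk_count_even by (simp add: 2)
  next
    case (3 n k)
    have "(\<Sum>i<a - 1. disk_count i * annulus_count (a - 2 - i) b)
        = (\<Sum>i<2 * Suc n. disk_count i * annulus_count (Suc (2 * n) - i) b)"
      by (simp add: 3)
    also have "\<dots> = (\<Sum>p<Suc n. disk_count (2 * p) * annulus_count (Suc (2 * n) - 2 * p) b)"
      by (rule sum_lessThan_even') (auto simp: disk_count_def)
    also have "\<dots> = face_weight b / (real n + 2 + real k) *
      (\<Sum>p\<le>n. ((2 * real n + 3) / (real p + 1) - (2 * real k + 1) / (real (n - p)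
          + real (Suc k))) * (central_binom p * central_binom (n - p)))"
      unfolding sum_distrib_left lessThan_Suc_atMost
    proof (intro sum.cong refl)
      fix p assume p: "p \<in> {..n}"
      have alg: "c / (x + 1) * (2 * ((2 * y + 1) * d) * K / (2 * y + 1 + (2 * k' + 1))) =
         K / L * (((2 * m + 3) / (x + 1) - (2 * k' + 1) / (y + (1 + k'))) * (c * d))"
        if "L = m + 2 + k'" "m = x + y" "x \<ge> 0" "y \<ge> 0" "k' \<ge> 0" for x y c d K k' L m :: real
      proof -
        have nz: "2 * y + 1 + (2 * k' + 1) \<noteq> 0" "x + 1 \<noteq> 0" "y + (1 + k') \<noteq> 0" "x + y + 2 + k' \<noteq> 0"
          using that by auto
        show ?thesis unfolding that(1,2) using nz by (simp add: divide_simps) (simp add: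
            algebra_simps)
      qed
      have e: "Suc (2 * n) - 2 * p = Suc (2 * (n - p))" using p by auto
      have "annulus_count (Suc (2 * n) - 2 * p) b = 2 * ((2 * real (n - p) + 1) * central_binom (n
          - p)) * face_weight b / (2 * real (n - p) + 1 + (2 * real k + 1))"
        unfolding e 3 annulus_count_def face_weight_odd by (simp add: add_ac)
      thus "disk_count (2 * p) * annulus_count (Suc (2 * n) - 2 * p) b = face_weight b / (real n
          + 2 + real k) *
          (((2 * real n + 3) / (real p + 1) - (2 * real k + 1) / (real (n - p)
              + real (Suc k))) * (central_binom p * central_binom (n - p)))"
        unfolding disk_count_even of_nat_Suc[of k] using p
        by (simp only:, intro alg) (auto simp: of_nat_diff)
    qed
    finally have S: "(\<Sum>i<a - 1. disk_count i * annulus_count (a - 2 - i) b)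
        = face_weight b / (real n + 2 + real k) *
      ((2 * real n + 3) * central_binom (Suc n) / 2 - (2 * real k + 1) * central_binom (n
          + Suc k) / (real (Suc k) * central_binom (Suc k)))"
      unfolding sum_central_binom_two_poles[OF zero_less_Suc] .
    have e: "a + b - 2 = 2 * Suc (n + k)" using 3 by auto
    have A: "annulus_count a b = (2 * real n + 3) * central_binom (Suc n) * face_weight b / (real
        n + 2 + real k)"
      unfolding 3 annulus_count_def face_weight_odd by (simp add: divide_simps) (simp add:
          algebra_simps)
    have c: "(2 * real k + 1) * central_binom (n + Suc k) / (real (Suc k) * central_binom (Suc k))
        = central_binom (Suc (n + k)) / (2 * central_binom k)"
      using central_binom_Suc[of k] central_binom_pos[of k] central_binom_pos[of "Suc k"]
          by (simp add: divide_simps) (simp add: algebra_simps)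
    have b: "face_weight b = real b * central_binom k" by (simp add: 3)
    have alg: "x * (K * c) / L = 2 * (K * c / L * (x / 2 - y / (2 * c))) + K * (y / L)"
      if "L > 0" "c > 0" for x K c y L :: real
      using that by (simp add: field_simps)
    show ?thesis unfolding S e A c disk_count_even b using alg[OF _ central_binom_pos, of "real n
        + 2 + real k"]
      by (simp add: add_ac)
  qed
qed

section \<open>Summation over all face degrees\<close>

lemma fps_numeral_mult_nth: "fps_nth (numeral k * f) n = numeral k * fps_nth f n"
  by (simp add: numeral_fps_const)

lemma sum_face_weight_triple:
  includes fps_syntax
  assumes "N \<ge> 1"
  shows "(\<Sum>i\<le>2 * N. \<Sum>j\<le>2 * N - i. face_weight i * face_weight j * face_weight (2 * N - i - j)) =
    (8 * real N + 5) * (real N - 1) * real N * (real N + 1) / 210 * real ((2 * N + 1) choose N)"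
proof -
  define D :: "real fps" where "D = Abs_fps (\<lambda>m. if even m then central_binom (m div 2) else 0)"
  define A :: "real fps" where "A = Abs_fps face_weight"
  have D2: "D ^ 2 * (1 - 4 * fps_X ^ 2) = 1"
  proof -
    define G :: "real fps" where "G = Abs_fps (\<lambda>n. if even n then 4 ^ (n div 2) else 0)"
    have G: "D ^ 2 = G"
    proof (rule fps_ext)
      fix n
      have "D ^ 2 $ n = (\<Sum>i<Suc n. D $ i * D $ (n - i))"
        by (simp add: power2_eq_square fps_mult_nth atLeast0AtMost lessThan_Suc_atMost)
      also have "\<dots> = G $ n"
      proof (cases "even n")
        case True
        then obtain m where n: "n = 2 * m" by blast
        have "(\<Sum>i<Suc n. D $ i * D $ (n - i)) = (\<Sum>p\<le>m. D $ (2 * p) * D $ (2 * m - 2 * p))"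
          unfolding n by (rule sum_lessThan_even) (simp add: D_def)
        also have "\<dots> = (\<Sum>p\<le>m. central_binom p * central_binom (m - p))"
          by (intro sum.cong refl) (simp add: D_def flip: right_diff_distrib')
        finally show ?thesis by (simp add: sum_central_binom G_def n)
      next
        case False
        have "(\<Sum>i<Suc n. D $ i * D $ (n - i)) = 0"
          by (rule sum.neutral) (use False in \<open>auto simp: D_def\<close>)
        thus ?thesis using False by (simp add: G_def)
      qed
      finally show "D ^ 2 $ n = G $ n" .
    qed
    show ?thesis unfolding G
    proof (rule fps_ext)
      fix n
      have "(G * (1 - 4 * fps_X ^ 2)) $ n = G $ n - 4 * ((fps_X ^ 2 * G) $ n)"
      proof -
        have "G * (1 - 4 * fps_X ^ 2) = G - 4 * (fps_X ^ 2 * G)" by (simp add: algebra_simps)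
        thus ?thesis by (simp only: fps_sub_nth fps_numeral_mult_nth)
      qed
      also have "\<dots> = (1 :: real fps) $ n"
      proof (cases "n < 2")
        case True
        hence "n = 0 \<or> n = 1" by linarith
        thus ?thesis by (auto simp: G_def fps_X_power_mult_nth)
      next
        case False
        then obtain m where "n = Suc (Suc m)" by (metis One_nat_def Suc_1 less_Suc_eq_0_disj
            not0_implies_Suc)
        thus ?thesis by (simp add: G_def fps_X_power_mult_nth)
      qed
      finally show "(G * (1 - 4 * fps_X ^ 2)) $ n = (1 :: real fps) $ n" .
    qed
  qed
  \<comment> \<open>Coefficientwise this is the recurrence of \<open>central_binom\<close>.\<close>
  have dD: "(1 - 4 * fps_X ^ 2) * fps_deriv D = 4 * fps_X * D"
  proof (rule fps_ext)
    fix n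
    have "((1 - 4 * fps_X ^ 2) * fps_deriv D) $ n = fps_deriv D $ n
        - 4 * ((fps_X ^ 2 * fps_deriv D) $ n)"
    proof -
      have "(1 - 4 * fps_X ^ 2) * fps_deriv D = fps_deriv D - 4 * (fps_X ^ 2 * fps_deriv D)"
        by (simp add: algebra_simps)
      thus ?thesis by (simp only: fps_sub_nth fps_numeral_mult_nth)
    qed
    also have "\<dots> = 4 * ((fps_X * D) $ n)"
    proof (cases "odd n")
      case True
      then obtain k where "n = Suc (2 * k)" by (metis oddE Suc_eq_plus1)
      thus ?thesis using central_binom_Suc[of k] by (cases k) (auto simp: D_def
          fps_X_power_mult_nth algebra_simps)
    next
      case False
      thus ?thesis by (auto simp: D_def fps_X_power_mult_nth)
    qed
    also have "\<dots> = (4 * fps_X * D) $ n"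
      by (simp only: mult.assoc fps_numeral_mult_nth)
    finally show "((1 - 4 * fps_X ^ 2) * fps_deriv D) $ n = (4 * fps_X * D) $ n" .
  qed
  have D': "fps_deriv D = 4 * fps_X * D ^ 3"
  proof -
    have "fps_deriv D = D ^ 2 * ((1 - 4 * fps_X ^ 2) * fps_deriv D)" using D2 by (simp add: mult_ac)
    thus ?thesis unfolding dD by (simp add: power2_eq_square power3_eq_cube mult_ac)
  qed
  have A: "A = fps_X * (1 + 2 * fps_X) * D ^ 3"
  proof -
    \<comment> \<open>The first summand carries the even weights k c_k, the second one the odd
      weights (2k + 1) c_k.\<close>
    have "A = fps_const (1 / 2) * (fps_X * fps_deriv D) + fps_X * fps_deriv (fps_X * D)"
    proof (rule fps_ext)
      fix n show "A $ n = (fps_const (1 / 2) * (fps_X * fps_deriv D)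
          + fps_X * fps_deriv (fps_X * D)) $ n"
      proof -
        have "n = 0 \<or> (\<exists>k. n = 2 * Suc k) \<or> (\<exists>k. n = Suc (2 * k))" by presburger
        thus ?thesis by (elim disjE exE) (simp_all add: A_def D_def face_weight_def algebra_simps)
      qed
    qed
    also have "\<dots> = 2 * fps_X ^ 2 * D ^ 3 + fps_X * (D * (D ^ 2 * (1 - 4 * fps_X ^ 2))
        + 4 * fps_X ^ 2 * D ^ 3)"
    proof -
      have h: "fps_const (1 / 2) * (4 * x) = 2 * x" for x :: "real fps"
        by (rule fps_ext) (simp add: fps_numeral_mult_nth)
      have "fps_const (1 / 2) * (fps_X * fps_deriv D) = fps_const (1 / 2) * (4 * (fps_X ^ 2 * D ^
          3))"
        unfolding D' by (simp add: power2_eq_square mult_ac)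
      thus ?thesis unfolding h D2 by (simp add: D' power2_eq_square algebra_simps)
    qed
    also have "\<dots> = fps_X * (1 + 2 * fps_X) * D ^ 3"
      by (simp add: algebra_simps power2_eq_square power3_eq_cube)
    finally show ?thesis .
  qed
  \<comment> \<open>Coefficient form of the derivative of \<open>D ^ (2 * r + 1)\<close>, which is 4
    (2r + 1) X D^(2r+3): lowering the exponent by two raises the index by two.\<close>
  have rec: "(real m + 2) * (D ^ (2 * r + 1) $ (m + 2)) = 4 * real (2 * r + 1) * (D ^ (2 * r
      + 3) $ m)" for m r
  proof -
    have "fps_deriv (D ^ (2 * r + 1)) = of_nat (2 * r + 1) * fps_deriv D * D ^ (2 * r)"
      unfolding fps_deriv_power' by simp
    also have "\<dots> = 4 * (of_nat (2 * r + 1) * (fps_X * D ^ (2 * r + 3)))"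
      unfolding D' by (simp add: power_add mult_ac)
    finally have "fps_deriv (D ^ (2 * r + 1)) $ (m + 1) = (4 * (of_nat (2 * r
        + 1) * (fps_X * D ^ (2 * r + 3)))) $ (m + 1)"
      by (rule arg_cong)
    also have "\<dots> = 4 * real (2 * r + 1) * (D ^ (2 * r + 3) $ m)"
      unfolding fps_of_nat[symmetric] by (simp add: fps_numeral_mult_nth del: of_nat_add
          of_nat_mult)
    finally show ?thesis unfolding fps_deriv_nth by (simp add: add_ac)
  qed
  \<comment> \<open>Four steps lead from D^9 down to D. As the factors m + 2, ..., m + 8 are halved,
    the constant is 1680 = 4^4 (7 * 5 * 3 * 1) / 2^4.\<close>
  have D9: "1680 * D ^ 9 $ m = (real m + 2) / 2 * ((real m + 4) / 2) * ((real m
      + 6) / 2) * ((real m + 8) / 2) * D $ (m + 8)" for m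
  proof -
    have step: "D ^ s' $ m = real m' * (D ^ s $ m') / (4 * real s)"
      if "m' = m + 2" "s = 2 * r + 1" "s' = 2 * r + 3" for m m' r s s'
      using rec[of m r] unfolding that by (simp add: field_simps)
    have d: "D ^ 9 $ m = real (m + 2) * (D ^ 7 $ (m + 2)) / (4 * real 7)"
      "D ^ 7 $ (m + 2) = real (m + 4) * (D ^ 5 $ (m + 4)) / (4 * real 5)"
      "D ^ 5 $ (m + 4) = real (m + 6) * (D ^ 3 $ (m + 6)) / (4 * real 3)"
      "D ^ 3 $ (m + 6) = real (m + 8) * (D ^ 1 $ (m + 8)) / (4 * real 1)"
      by (rule step[where r = 3] step[where r = 2] step[where r = 1] step[where r = 0]; simp)+
    show ?thesis unfolding d by simp
  qed
  have odd: "D ^ 9 $ m = 0" if "odd m" for m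
    using D9[of m] that by (simp add: D_def)
  have even: "1680 * D ^ 9 $ (2 * n) = (real n + 1) * (real n + 2) * (real n + 3) * (real n
      + 4) * central_binom (n + 4)" for n
    using D9[of "2 * n"] by (simp add: D_def add_divide_distrib)
  have "(\<Sum>i\<le>2 * N. \<Sum>j\<le>2 * N - i. face_weight i * face_weight j * face_weight (2 * N - i - j))
      = (A * (A * A)) $ (2 * N)"
    by (simp add: fps_mult_nth A_def atLeast0AtMost sum_distrib_left mult_ac)
  \<comment> \<open>The cube of X (1 + 2X) D^3. Since D^9 is an even series, only the terms with X^4
    and X^6 reach the exponent 2N.\<close>
  also have "A * (A * A) = fps_X ^ 3 * D ^ 9 + 6 * (fps_X ^ 4 * D ^ 9) + 12 * (fps_X ^ 5 * D ^ 9)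
      + 8 * (fps_X ^ 6 * D ^ 9)"
  proof -
    have "D ^ 9 = D ^ 3 * (D ^ 3 * D ^ 3)" by (simp flip: power_add)
    thus ?thesis unfolding A by (simp only: power3_eq_cube power_numeral_even power_numeral_odd)
        (simp add: algebra_simps power_numeral_even power_numeral_odd)
  qed
  finally have eq: "(\<Sum>i\<le>2 * N. \<Sum>j\<le>2 * N - i. face_weight i * face_weight j * face_weight (2 * N
      - i - j)) =
      6 * (if N < 2 then 0 else D ^ 9 $ (2 * (N - 2))) + 8 * (if N < 3 then 0 else D ^ 9 $ (2 * (N
          - 3)))"
    using odd by (simp add: fps_numeral_mult_nth fps_X_power_mult_nth right_diff_distrib')
  \<comment> \<open>For small \<open>N\<close> the coefficient is absent, and the polynomial on the
    right vanishes as well; the same holds in \<open>n3\<close>.\<close>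
  have n2: "1680 * (if N < 2 then 0 else D ^ 9 $ (2 * (N - 2))) = (real N - 1) * real N * (real N
      + 1) * ((real N + 2) * central_binom (N + 2))"
  proof (cases "N < 2")
    case False
    then obtain n where n: "N = n + 2" by (metis add.commute le_Suc_ex not_less)
    have c: "central_binom (N + 2) = central_binom (n + 4)"
        by (rule arg_cong[of _ _ central_binom]) (simp add: n)
    show ?thesis unfolding c using even[of n] unfolding n by (simp add: add_ac)
  qed (use assms in \<open>auto simp: less_2_cases_iff\<close>)
  have n3: "1680 * (if N < 3 then 0 else D ^ 9 $ (2 * (N - 3))) = (real N - 2) * (real N
      - 1) * real N * (real N + 1) * central_binom (N + 1)"
  proof (cases "N < 3")
    case True
    hence "N = 1 \<or> N = 2" using assms by linarith
    thus ?thesis by auto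
  next
    case False
    then obtain n where n: "N = n + 3" by (metis add.commute le_Suc_ex not_less)
    have c: "central_binom (N + 1) = central_binom (n + 4)"
        by (rule arg_cong[of _ _ central_binom]) (simp add: n)
    show ?thesis unfolding c using even[of n] unfolding n by (simp add: add_ac)
  qed
  have c2: "(real N + 2) * central_binom (N + 2) = (4 * real N + 6) * central_binom (N + 1)"
    using central_binom_Suc[of "N + 1"] by (simp add: add_ac)
  have bin: "central_binom (N + 1) = 2 * real ((2 * N + 1) choose N)"
  proof -
    have "((2 * N + 1) choose (N + 1)) = ((2 * N + 1) choose N)"
      using binomial_symmetric[of N "2 * N + 1"] by simp
    thus ?thesis by (simp add: central_binom_def)
  qed
  \<comment> \<open>Collecting gives 6 (4N + 6) + 8 (N - 2) = 4 (8N + 5). With the factor 2 from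
    \<open>bin\<close>, the final denominator is 1680 / 8 = 210.\<close>
  have "1680 * (\<Sum>i\<le>2 * N. \<Sum>j\<le>2 * N - i. face_weight i * face_weight j * face_weight (2 * N - i
      - j)) =
     6 * ((real N - 1) * real N * (real N + 1) * ((4 * real N + 6) * central_binom (N + 1)))
     + 8 * ((real N - 2) * (real N - 1) * real N * (real N + 1) * central_binom (N + 1))"
  proof -
    have "1680 * (6 * x + 8 * y) = 6 * u + 8 * v" if "1680 * x = u" "1680 * y = v"
        for x y u v :: real
      using that by simp
    from this[OF n2[unfolded c2] n3] show ?thesis unfolding eq .
  qed
  thus ?thesis unfolding bin by (simp add: field_simps)
qed

section \<open>Cutting and joining cycles\<close>

lemma orbit_subset_closed:
  assumes "p ` T \<subseteq> T" "x \<in> T"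
  shows "orbit p x \<subseteq> T"
proof
  fix z assume "z \<in> orbit p x"
  thus "z \<in> T" by induction (use assms in auto)
qed

lemma cyclic_on_closed_cases:
  assumes "cyclic_on p A" "p ` T \<subseteq> T"
  shows "A \<subseteq> T \<or> A \<inter> T = {}"
  using assms by (metis disjoint_iff orbit_cyclic_eq3 orbit_subset_closed)

lemma cyclic_on_closed: "cyclic_on p A \<Longrightarrow> p ` A \<subseteq> A"
  by (auto intro: cyclic_on_inI)

text \<open>An injective map of a finite set into itself is onto, so a closed set is its own image
  and its complement is closed too.\<close>

lemma image_closed_Diff:
  assumes "permutation p" "finite S" "p ` S \<subseteq> S" "p ` T \<subseteq> T" "T \<subseteq> S"
  shows "p ` (S - T) \<subseteq> S - T"
proof -
  have "inj p" using assms(1) by (simp add: permutation_bijective bij_is_inj)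
  moreover have "p ` T = T" using assms \<open>inj p\<close>
    by (meson endo_inj_surj finite_subset inj_on_subset subset_UNIV)
  ultimately show ?thesis using assms(3) by (metis image_set_diff Diff_mono subset_refl)
qed

lemma num_cycles_Un:
  assumes "finite A" "finite B" "A \<inter> B = {}" "p ` A \<subseteq> A" "p ` B \<subseteq> B"
  shows "num_cycles (A \<union> B) p = num_cycles A p + num_cycles B p"
proof -
  have "orbit p x \<noteq> orbit p y" if "x \<in> A" "y \<in> B" for x y
    using orbit_subset_closed[OF assms(4) that(1)] orbit_subset_closed[OF assms(5) that(2)]
      orbit_nonempty[of p x] assms(3) by blast
  hence "orbit p ` A \<inter> orbit p ` B = {}" by blast
  thus ?thesis unfolding num_cycles_def image_Un
    using assms(1,2) by (intro card_Un_disjoint) auto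
qed

lemma num_cycles_cong:
  assumes "p ` A \<subseteq> A" "\<And>x. x \<in> A \<Longrightarrow> p x = q x"
  shows "num_cycles A p = num_cycles A q"
proof -
  have "orbit p x = orbit q x" if "x \<in> A" for x
    using that by (rule orbit_cong0) (use assms in auto)
  thus ?thesis unfolding num_cycles_def by (metis (no_types, lifting) image_cong)
qed

lemma num_cycles_cyclic_on:
  assumes "cyclic_on p A"
  shows "num_cycles A p = 1"
proof -
  have "orbit p ` A = {A}" using assms by (auto simp: cyclic_on_alldef)
  thus ?thesis by (simp add: num_cycles_def)
qed

text \<open>A cycle written as a list starting at \<open>x\<close>, which \<open>p\<close> rotates
  by one place. In this form, cutting and joining cycles become operations on list
  concatenations.\<close>

definition cyc_list :: "('a \<Rightarrow> 'a) \<Rightarrow> 'a \<Rightarrow> 'a list \<Rightarrow> bool" where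
  "cyc_list p x P \<longleftrightarrow> distinct (x # P) \<and> map p (x # P) = P @ [x]"

lemma cyc_list_cyclic_on:
  assumes "cyc_list p x P"
  shows "cyclic_on p (set (x # P))"
proof -
  have m: "map p (x # P) = P @ [x]" using assms by (simp add: cyc_list_def)
  hence "p ` set (x # P) = set (x # P)" by (metis list.set_map rotate1.simps(2) set_rotate1)
  hence "orbit p x \<subseteq> set (x # P)" by (intro orbit_subset_closed) auto
  moreover have nth: "p ((x # P) ! i) = (P @ [x]) ! i" if "i \<le> length P" for i
    using m that by (metis length_Cons less_Suc_eq_le nth_map)
  have P: "P ! i \<in> orbit p x" if "i < length P" for i
    using that
  proof (induction i)
    case 0
    then show ?case using nth[of 0] by (auto simp: nth_append intro: orbit_eqI(1))
  next
    case (Suc i)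
    then show ?case using nth[of "Suc i"] by (auto simp: nth_append) (metis orbit.step)
  qed
  have "x \<in> orbit p x"
  proof (cases P)
    case Nil
    then show ?thesis using nth[of 0] by (auto intro: orbit_eqI(1))
  next
    case (Cons z zs)
    then show ?thesis using nth[of "length P"] P[of "length zs"]
      by (auto simp: nth_append intro: orbit_eqI(2))
  qed
  hence "set (x # P) \<subseteq> orbit p x" using P by (auto simp: in_set_conv_nth)
  ultimately show ?thesis unfolding cyclic_on_def by (metis list.set_intros(1) subset_antisym)
qed

lemma cyclic_on_cyc_list:
  assumes "cyclic_on p A" "x \<in> A"
  obtains P where "A = set (x # P)" "cyc_list p x P"
proof -
  have A: "A = orbit p x" "x \<in> orbit p x" using assms by (auto simp: cyclic_on_alldef)
  \<comment> \<open>\<open>n\<close> counts the steps from \<open>p x\<close> back to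
    \<open>x\<close>, so \<open>Suc n\<close> is the length of the cycle.\<close>
  define n where "n = funpow_dist p (p x) x"
  define P where "P = map (\<lambda>i. (p ^^ i) x) [1..<Suc n]"
  have xP: "x # P = map (\<lambda>i. (p ^^ i) x) [0..<Suc n]"
    unfolding P_def by (subst (2) upt_conv_Cons) auto
  have "(p ^^ Suc n) x = x" unfolding n_def using funpow_dist1_prop[OF A(2)] .
  moreover have "map p (x # P) = map (\<lambda>i. (p ^^ i) x) [1..<Suc (Suc n)]"
    unfolding xP by (rule nth_equalityI) (auto simp del: upt_Suc)
  ultimately have "map p (x # P) = P @ [x]" by (simp add: P_def)
  moreover have "distinct (x # P)"
    unfolding xP distinct_map using inj_on_funpow_dist1[OF A(2)] by (simp add: n_def del: upt_Suc)
  moreover have "A = set (x # P)"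
    unfolding xP A(1) set_map set_upt using orbit_conv_funpow_dist1[OF A(2)] by (simp only: n_def)
  ultimately show ?thesis using that by (auto simp: cyc_list_def)
qed

text \<open>Composition with the transposition exchanges the successors of \<open>x\<close> and
  \<open>y\<close>, so the list breaks at \<open>y\<close>.\<close>

lemma cyc_list_split:
  assumes "cyc_list p x (P @ y # Q)"
  shows "cyc_list (p \<circ> transpose x y) y P" "cyc_list (p \<circ> transpose x y) x Q"
proof -
  have d: "distinct (x # P @ y # Q)" and m: "map p (x # P @ y # Q) = P @ y # Q @ [x]"
    using assms by (auto simp: cyc_list_def)
  have "(p x # map p P) @ (p y # map p Q) = (P @ [y]) @ (Q @ [x])" using m by simp
  hence 1: "p x # map p P = P @ [y]" "p y # map p Q = Q @ [x]"
    by (subst (asm) append_eq_append_conv; simp)+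
  have m': "map (p \<circ> transpose x y) P = map p P" "map (p \<circ> transpose x y) Q = map p Q"
    using d by (auto simp: transpose_def)
  thus "cyc_list (p \<circ> transpose x y) y P" "cyc_list (p \<circ> transpose x y) x Q"
    unfolding cyc_list_def list.map m' using d 1 by auto
qed

lemma cyc_list_merge:
  assumes "cyc_list p x Q" "cyc_list p y P" "set (x # Q) \<inter> set (y # P) = {}"
  shows "cyc_list (p \<circ> transpose x y) x (P @ y # Q)"
proof -
  have m': "map (p \<circ> transpose x y) P = map p P" "map (p \<circ> transpose x y) Q = map p Q"
    using assms by (auto simp: transpose_def cyc_list_def)
  have "p x # map p Q = Q @ [x]" "p y # map p P = P @ [y]"
    using assms by (auto simp: cyc_list_def)
  thus ?thesis using assms unfolding cyc_list_def list.map map_append m' by auto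
qed

section \<open>Faces and cycle numbers under a transposition\<close>

lemma cyclic_on_comp_transpose:
  assumes "cyclic_on p A" "x \<notin> A" "y \<notin> A"
  shows "cyclic_on (p \<circ> transpose x y) A"
proof -
  have "p z = (p \<circ> transpose x y) z" if "z \<in> A" for z
    using that assms by (auto simp: transpose_def)
  thus ?thesis using assms(1) cyclic_cong by metis
qed

lemma cyclic_on_merge:
  assumes "cyclic_on p A" "cyclic_on p B" "A \<inter> B = {}" "x \<in> A" "y \<in> B"
  shows "cyclic_on (p \<circ> transpose x y) (A \<union> B)"
proof -
  obtain Q where Q: "A = set (x # Q)" "cyc_list p x Q" using cyclic_on_cyc_list assms(1,4) by metis
  obtain P where P: "B = set (y # P)" "cyc_list p y P" using cyclic_on_cyc_list assms(2,5) by metis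
  have "cyc_list (p \<circ> transpose x y) x (P @ y # Q)"
    using cyc_list_merge Q P assms(3) by metis
  from cyc_list_cyclic_on[OF this] show ?thesis by (simp add: Q P insert_commute Un_commute)
qed

text \<open>As \<open>y\<close> runs through the points of \<open>D\<close> on the list, the number
  of such points before \<open>y\<close> takes each value below their total exactly once. This turns
  a sum over partners of the root into a sum over degrees.\<close>

lemma sum_takeWhile_rank:
  fixes g :: "nat \<Rightarrow> 'b::comm_monoid_add"
  assumes "distinct L"
  shows "(\<Sum>y\<in>D \<inter> set L. g (card (D \<inter> set (takeWhile (\<lambda>z. z \<noteq> y) L)))) = (\<Sum>i<card (D \<inter> set L). g i)"
  using assms
proof (induction L rule: rev_induct)
  case (snoc z L)
  have *: "takeWhile (\<lambda>u. u \<noteq> y) (L @ [z]) = takeWhile (\<lambda>u. u \<noteq> y) L" if "y \<in> set L" for y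
    using that by (auto intro: takeWhile_append1)
  have z: "takeWhile (\<lambda>u. u \<noteq> z) (L @ [z]) = L"
    using snoc.prems by (auto simp: takeWhile_append)
  have "(\<Sum>y\<in>D \<inter> set L. g (card (D \<inter> set (takeWhile (\<lambda>u. u \<noteq> y) (L @ [z]))))) =
    (\<Sum>i<card (D \<inter> set L). g i)"
  proof -
    have "(\<Sum>y\<in>D \<inter> set L. g (card (D \<inter> set (takeWhile (\<lambda>u. u \<noteq> y) (L @ [z]))))) =
        (\<Sum>y\<in>D \<inter> set L. g (card (D \<inter> set (takeWhile (\<lambda>u. u \<noteq> y) L))))"
      by (intro sum.cong refl) (simp only: * IntD2)
    thus ?thesis using snoc by simp
  qed
  moreover have "z \<notin> set L" using snoc.prems by auto
  ultimately show ?case using z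
    by (cases "z \<in> D") (auto simp: add.commute)
qed simp

text \<open>\<open>r y\<close> counts the live points strictly between \<open>x\<close> and \<open>y\<close>.\<close>

lemma cyclic_on_split:
  assumes "cyclic_on p A" "x \<in> A" "x \<in> D"
  obtains r where
    "\<And>g :: nat \<Rightarrow> real. (\<Sum>y\<in>D \<inter> A - {x}. g (r y)) = (\<Sum>i<card (D \<inter> A) - 1. g i)"
    "\<And>y. y \<in> D \<inter> A - {x} \<Longrightarrow> \<exists>A1 A2. A = A1 \<union> A2 \<and> A1 \<inter> A2 = {} \<and> x \<in> A1 \<and> y \<in> A2 \<and>
       cyclic_on (p \<circ> transpose x y) A1 \<and> cyclic_on (p \<circ> transpose x y) A2 \<and>
       card ((D - {x, y}) \<inter> A1) = card (D \<inter> A) - 2 - r y \<and> card ((D - {x, y}) \<inter> A2) = r y"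
proof -
  obtain L where L: "A = set (x # L)" "cyc_list p x L" using cyclic_on_cyc_list assms by metis
  define r where "r = (\<lambda>y. card (D \<inter> set (takeWhile (\<lambda>z. z \<noteq> y) L)))"
  have d: "distinct L" "x \<notin> set L" using L(2) by (auto simp: cyc_list_def)
  have DA: "D \<inter> A - {x} = D \<inter> set L" using L d by auto
  have cDA: "card (D \<inter> A) = Suc (card (D \<inter> set L))"
    using d assms(3) by (simp add: L(1))
  show ?thesis
  proof (rule that)
    show "(\<Sum>y\<in>D \<inter> A - {x}. g (r y)) = (\<Sum>i<card (D \<inter> A) - 1. g i)" for g :: "nat \<Rightarrow> real"
      unfolding DA r_def cDA using sum_takeWhile_rank[OF d(1), of g D] by simp
  next
    fix y assume y: "y \<in> D \<inter> A - {x}"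
    \<comment> \<open>\<open>P\<close> lies strictly between \<open>x\<close> and \<open>y\<close>,
      and \<open>Q\<close> lies behind \<open>y\<close>. The cut closes the first stretch at
      \<open>y\<close> and the second one at \<open>x\<close>.\<close>
    define P Q where "P = takeWhile (\<lambda>z. z \<noteq> y) L" and "Q = tl (dropWhile (\<lambda>z. z \<noteq> y) L)"
    have "y \<in> set L" using y DA by auto
    hence "dropWhile (\<lambda>z. z \<noteq> y) L = y # Q"
      unfolding Q_def by (metis (mono_tags, lifting) dropWhile_eq_Nil_conv hd_dropWhile
          list.collapse)
    hence LPQ: "L = P @ y # Q" unfolding P_def by (metis takeWhile_dropWhile_id)
    have c: "cyclic_on (p \<circ> transpose x y) (set (y # P))" "cyclic_on (p \<circ> transpose x y) (set (x #
        Q))"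
      using cyc_list_split[of p x P y Q] L(2) LPQ by (metis cyc_list_cyclic_on)+
    have e: "(D - {x, y}) \<inter> set (y # P) = D \<inter> set P" "(D - {x, y}) \<inter> set (x # Q) = D \<inter> set Q"
      using d unfolding LPQ by auto
    have "card (D \<inter> set L) = Suc (card (D \<inter> set P) + card (D \<inter> set Q))"
    proof -
      have "D \<inter> set L = insert y ((D \<inter> set P) \<union> (D \<inter> set Q))" using y unfolding LPQ by auto
      moreover have "card (insert y ((D \<inter> set P) \<union> (D \<inter> set Q)))
          = Suc (card ((D \<inter> set P) \<union> (D \<inter> set Q)))"
        using d unfolding LPQ by (intro card_insert_disjoint) auto
      moreover have "card ((D \<inter> set P) \<union> (D \<inter> set Q)) = card (D \<inter> set P) + card (D \<inter> set Q)"
        using d unfolding LPQ by (intro card_Un_disjoint) auto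
      ultimately show ?thesis by simp
    qed
    hence "card ((D - {x, y}) \<inter> set (x # Q)) = card (D \<inter> A) - 2 - r y"
      "card ((D - {x, y}) \<inter> set (y # P)) = r y"
      unfolding cDA e by (auto simp: r_def P_def)
    moreover have "A = set (x # Q) \<union> set (y # P)" "set (x # Q) \<inter> set (y # P) = {}"
      using d unfolding L(1) LPQ by auto
    ultimately show "\<exists>A1 A2. A = A1 \<union> A2 \<and> A1 \<inter> A2 = {} \<and> x \<in> A1 \<and> y \<in> A2 \<and>
       cyclic_on (p \<circ> transpose x y) A1 \<and> cyclic_on (p \<circ> transpose x y) A2 \<and>
       card ((D - {x, y}) \<inter> A1) = card (D \<inter> A) - 2 - r y \<and> card ((D - {x, y}) \<inter> A2) = r y"
      using c by (intro exI[of _ "set (x # Q)"] exI[of _ "set (y # P)"] conjI list.set_intros(1))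
  qed
qed

text \<open>Only the cycle through \<open>x\<close> and \<open>y\<close> changes: the rest of
  \<open>S\<close> is closed, and the two permutations agree on it.\<close>

lemma num_cycles_split:
  assumes "permutation p" "finite S" "p ` S \<subseteq> S" "x \<in> S" "x \<noteq> y" "y \<in> orbit p x"
  shows "num_cycles S (p \<circ> transpose x y) = num_cycles S p + 1"
proof -
  define A where "A = orbit p x"
  have A: "cyclic_on p A" "x \<in> A" "y \<in> A" "A \<subseteq> S" "finite A"
    using assms orbit_subset_closed[OF assms(3,4)] unfolding A_def
    by (auto intro: cyclic_on_orbit' permutation_self_in_orbit finite_subset)
  obtain A1 A2 where s: "A = A1 \<union> A2" "A1 \<inter> A2 = {}" "x \<in> A1" "y \<in> A2"
    "cyclic_on (p \<circ> transpose x y) A1" "cyclic_on (p \<circ> transpose x y) A2"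
    using cyclic_on_split[OF A(1,2), of UNIV] A(3) assms(5)
        by (metis Diff_iff IntI UNIV_I singletonD)
  have pA: "p ` A \<subseteq> A" using A(1) by (rule cyclic_on_closed)
  have R: "p ` (S - A) \<subseteq> S - A"
    using assms A pA by (intro image_closed_Diff) auto
  have eq: "p z = (p \<circ> transpose x y) z" if "z \<in> S - A" for z
    using that A by (auto simp: transpose_def)
  have pA': "(p \<circ> transpose x y) ` A1 \<subseteq> A1" "(p \<circ> transpose x y) ` A2 \<subseteq> A2"
    using s cyclic_on_closed by metis+
  have "num_cycles S p = num_cycles A p + num_cycles (S - A) p"
    using num_cycles_Un[of A "S - A" p] A R pA assms(2) by (simp add: Un_absorb1)
  moreover have "num_cycles (S - A) (p \<circ> transpose x y) = num_cycles (S - A) p"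
    by (rule num_cycles_cong[OF R eq, symmetric])
  moreover have "num_cycles S (p \<circ> transpose x y) = num_cycles A (p \<circ> transpose x y)
      + num_cycles (S - A) (p \<circ> transpose x y)"
  proof -
    have "(p \<circ> transpose x y) ` A \<subseteq> A" using pA' s(1) by blast
    moreover have "(p \<circ> transpose x y) ` (S - A) \<subseteq> S - A"
      using R eq by (metis (no_types, lifting) image_cong)
    ultimately show ?thesis
      using num_cycles_Un[of A "S - A" "p \<circ> transpose x y"] A assms(2) by (simp add: Un_absorb1)
  qed
  moreover have "num_cycles A (p \<circ> transpose x y) = 2"
    using num_cycles_Un[of A1 A2 "p \<circ> transpose x y"] s A(5) pA' num_cycles_cyclic_on[OF s(5)]
      num_cycles_cyclic_on[OF s(6)] by simp
  ultimately show ?thesis using num_cycles_cyclic_on[OF A(1)] by simp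
qed

lemma orbit_comp_transpose:
  assumes "permutation p" "y \<notin> orbit p x"
  shows "y \<in> orbit (p \<circ> transpose x y) x"
proof -
  have "orbit p x \<inter> orbit p y = {}"
    using assms cyclic_on_orbit'[OF assms(1)] permutation_self_in_orbit[OF assms(1)]
    by (metis disjoint_iff orbit_cyclic_eq3)
  hence "cyclic_on (p \<circ> transpose x y) (orbit p x \<union> orbit p y)"
    using assms by (intro cyclic_on_merge cyclic_on_orbit' permutation_self_in_orbit)
  thus ?thesis
    using permutation_self_in_orbit[OF assms(1)] by (metis UnCI orbit_cyclic_eq3)
qed

lemma permutation_comp_transpose: "permutation p \<Longrightarrow> permutation (p \<circ> transpose x y)"
  by (simp add: permutation_compose permutation_swap_id)

lemma image_comp_transpose_subset:
  assumes "p ` S \<subseteq> S" "x \<in> S \<longleftrightarrow> y \<in> S"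
  shows "(p \<circ> transpose x y) ` S \<subseteq> S"
  using assms by (auto simp: transpose_def)

lemma num_cycles_merge:
  assumes "permutation p" "finite S" "p ` S \<subseteq> S" "x \<in> S" "y \<in> S" "y \<notin> orbit p x"
  shows "num_cycles S p = num_cycles S (p \<circ> transpose x y) + 1"
proof -
  have "x \<noteq> y" using assms permutation_self_in_orbit by metis
  \<comment> \<open>The points share a cycle after the composition, so the split applies there;
    composing with the transposition twice gives \<open>p\<close> back.\<close>
  have "num_cycles S (p \<circ> transpose x y \<circ> transpose x y) = num_cycles S (p \<circ> transpose x y) + 1"
    using assms \<open>x \<noteq> y\<close>
    by (intro num_cycles_split permutation_comp_transpose image_comp_transpose_subset
        orbit_comp_transpose) auto
  thus ?thesis by (simp add: comp_assoc)
qed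

section \<open>Connected pairings and Euler's inequality\<close>

lemma image_Int_closed: "p ` A \<subseteq> A \<Longrightarrow> p ` B \<subseteq> B \<Longrightarrow> p ` (A \<inter> B) \<subseteq> A \<inter> B"
  by blast

lemma image_comp_closed: "p ` A \<subseteq> A \<Longrightarrow> q ` A \<subseteq> A \<Longrightarrow> (p \<circ> q) ` A \<subseteq> A"
  by auto

text \<open>Dead points are fixed, so in \<open>\<tau> \<circ> \<iota>\<close> they simply pass on
  to the next corner of their face.\<close>

definition pairing :: "nat set \<Rightarrow> (nat \<Rightarrow> nat) \<Rightarrow> bool" where
  "pairing D \<iota> \<longleftrightarrow> \<iota> permutes D \<and> (\<forall>x\<in>D. \<iota> (\<iota> x) = x \<and> \<iota> x \<noteq> x)"

text \<open>Transitivity expressed through closed subsets, which for permutations of a finite set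
  are the unions of orbits. This form passes to components and to altered permutations without any
  group.\<close>

definition joined :: "(nat \<Rightarrow> nat) \<Rightarrow> (nat \<Rightarrow> nat) \<Rightarrow> nat set \<Rightarrow> bool" where
  "joined \<tau> \<iota> S \<longleftrightarrow> S \<noteq> {} \<and> (\<forall>T\<subseteq>S. T \<noteq> {} \<longrightarrow> \<tau> ` T \<subseteq> T \<longrightarrow> \<iota> ` T \<subseteq> T \<longrightarrow> T = S)"

text \<open>
  Euler's formula for genus 0, doubled to avoid halving: the cycles of \<open>\<tau>\<close> are the faces, those of
  \<open>\<tau> \<circ> \<iota>\<close> the vertices, and \<open>card D\<close> is twice the number of edges.
\<close>

definition planar :: "(nat \<Rightarrow> nat) \<Rightarrow> nat set \<Rightarrow> nat set \<Rightarrow> (nat \<Rightarrow> nat) set" where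
  "planar \<tau> S D = {\<iota>. pairing D \<iota> \<and> joined \<tau> \<iota> S \<and>
     2 * (num_cycles S (\<tau> \<circ> \<iota>) + num_cycles S \<tau>) = card D + 4}"

lemma pairing_outside: "pairing D \<iota> \<Longrightarrow> x \<notin> D \<Longrightarrow> \<iota> x = x"
  unfolding pairing_def by (blast intro: permutes_not_in)

lemma pairing_in: "pairing D \<iota> \<Longrightarrow> x \<in> D \<Longrightarrow> \<iota> x \<in> D"
  by (simp add: pairing_def permutes_in_image)

lemma pairing_image: "pairing D \<iota> \<Longrightarrow> D \<subseteq> S \<Longrightarrow> \<iota> ` S \<subseteq> S"
  using pairing_outside pairing_in by fastforce

lemma pairingI:
  assumes "\<And>x. x \<in> D \<Longrightarrow> \<iota> x \<in> D \<and> \<iota> (\<iota> x) = x \<and> \<iota> x \<noteq> x" "\<And>x. x \<notin> D \<Longrightarrow> \<iota> x = x"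
  shows "pairing D \<iota>"
proof -
  have "\<iota> (\<iota> x) = x" for x using assms by (cases "x \<in> D") auto
  hence "\<iota> permutes D" unfolding permutes_def using assms(2) by metis
  thus ?thesis using assms(1) by (simp add: pairing_def)
qed

lemma pairing_permutation:
  assumes "pairing D \<iota>" "finite D"
  shows "permutation \<iota>"
  using assms unfolding pairing_def permutation_permutes by blast

lemma pairing_remove:
  assumes "pairing D \<iota>" "x \<in> D" "\<iota> x = y"
  shows "pairing (D - {x, y}) (\<iota> \<circ> transpose x y)"
proof -
  have y: "\<iota> y = x" "y \<in> D" "x \<noteq> y" using assms by (auto simp: pairing_def permutes_in_image)
  have "\<iota> z \<in> D - {x, y} \<and> \<iota> (\<iota> z) = z \<and> \<iota> z \<noteq> z" if "z \<in> D - {x, y}" for z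
    using assms(1) that y(1) assms(3) pairing_in[OF assms(1)] by (auto simp: pairing_def)
  moreover have "\<iota> z = z" if "z \<notin> D" for z
    using pairing_outside[OF assms(1) that] .
  ultimately show ?thesis using y assms(3)
    by (intro pairingI) (auto simp: transpose_def)
qed

lemma pairing_insert:
  assumes "pairing (D - {x, y}) \<iota>" "x \<in> D" "y \<in> D" "x \<noteq> y"
  shows "pairing D (\<iota> \<circ> transpose x y)" "(\<iota> \<circ> transpose x y) x = y"
proof -
  have xy: "\<iota> x = x" "\<iota> y = y" using pairing_outside[OF assms(1)] by auto
  have "\<iota> z \<in> D - {x, y} \<and> \<iota> (\<iota> z) = z \<and> \<iota> z \<noteq> z" if "z \<in> D - {x, y}" for z
    using assms(1) that pairing_in[OF assms(1)] by (auto simp: pairing_def)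
  moreover have "\<iota> z = z" if "z \<notin> D" for z
    using pairing_outside[OF assms(1)] that by simp
  ultimately show "pairing D (\<iota> \<circ> transpose x y)" using xy assms(2-4)
    by (intro pairingI) (auto simp: transpose_def)
  show "(\<iota> \<circ> transpose x y) x = y" using xy by simp
qed

text \<open>As \<open>\<iota>\<close> fixes \<open>x\<close> and \<open>y\<close>, it commutes with
  their transposition; the edge may be charged to the faces instead of the involution.\<close>

lemma comp_transpose_pairing:
  assumes "pairing (D - {x, y}) \<iota>"
  shows "\<tau> \<circ> (\<iota> \<circ> transpose x y) = (\<tau> \<circ> transpose x y) \<circ> \<iota>"
proof
  have xy: "\<iota> x = x" "\<iota> y = y" using pairing_outside[OF assms] by auto
  have "inj \<iota>" using assms unfolding pairing_def by (blast intro: permutes_inj)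
  hence "\<iota> z \<noteq> x" "\<iota> z \<noteq> y" if "z \<noteq> x" "z \<noteq> y" for z
    using that xy by (metis injD)+
  thus "(\<tau> \<circ> (\<iota> \<circ> transpose x y)) z = ((\<tau> \<circ> transpose x y) \<circ> \<iota>) z" for z
    using xy by (auto simp: transpose_def)
qed

section \<open>Sizes and connectivity when an edge is deleted\<close>

lemma card_Diff_pair:
  assumes "finite D" "x \<in> D" "y \<in> D" "x \<noteq> y"
  shows "card D = card (D - {x, y}) + 2"
  using assms card_Diff_subset[of "{x, y}" D] card_mono[of D "{x, y}"] by auto

text \<open>A set closed under the full involution contains both ends of the edge or neither. Such a
  set is invariant under the transposition, which may then be absorbed into either
  permutation.\<close>

lemma joined_insert_iff:
  assumes "pairing (D - {x, y}) \<iota>" "x \<noteq> y"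
  shows "joined \<tau> (\<iota> \<circ> transpose x y) S \<longleftrightarrow> S \<noteq> {} \<and>
    (\<forall>T\<subseteq>S. T \<noteq> {} \<longrightarrow> (\<tau> \<circ> transpose x y) ` T \<subseteq> T \<longrightarrow> \<iota> ` T \<subseteq> T \<longrightarrow> (x \<in> T \<longleftrightarrow> y \<in> T) \<longrightarrow> T = S)"
proof -
  have xy: "\<iota> x = x" "\<iota> y = y" using pairing_outside[OF assms(1)] by auto
  have "\<tau> ` T \<subseteq> T \<and> (\<iota> \<circ> transpose x y) ` T \<subseteq> T \<longleftrightarrow>
    (\<tau> \<circ> transpose x y) ` T \<subseteq> T \<and> \<iota> ` T \<subseteq> T \<and> (x \<in> T \<longleftrightarrow> y \<in> T)" for T
  proof
    assume T: "\<tau> ` T \<subseteq> T \<and> (\<iota> \<circ> transpose x y) ` T \<subseteq> T"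
    hence "x \<in> T \<longleftrightarrow> y \<in> T"
      using xy by (metis (no_types, lifting) comp_apply image_subset_iff transpose_apply_first
          transpose_apply_second)
    moreover have "\<iota> ` T \<subseteq> T"
      using image_comp_transpose_subset[of "\<iota> \<circ> transpose x y" T x y] T calculation
          by (simp add: comp_assoc)
    ultimately show "(\<tau> \<circ> transpose x y) ` T \<subseteq> T \<and> \<iota> ` T \<subseteq> T \<and> (x \<in> T \<longleftrightarrow> y \<in> T)"
      using T image_comp_transpose_subset by metis
  next
    assume T: "(\<tau> \<circ> transpose x y) ` T \<subseteq> T \<and> \<iota> ` T \<subseteq> T \<and> (x \<in> T \<longleftrightarrow> y \<in> T)"
    thus "\<tau> ` T \<subseteq> T \<and> (\<iota> \<circ> transpose x y) ` T \<subseteq> T"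
      using image_comp_transpose_subset[of "\<tau> \<circ> transpose x y" T x y]
          image_comp_transpose_subset[of \<iota> T x y]
      by (simp add: comp_assoc)
  qed
  thus ?thesis unfolding joined_def by metis
qed

text \<open>On the merged face \<open>x\<close> and \<open>y\<close> lie on one cycle, so a closed
  set cannot separate them and the side condition is automatic.\<close>

lemma joined_merge_iff:
  assumes "pairing (D - {x, y}) \<iota>" "x \<noteq> y" "permutation \<tau>" "y \<notin> orbit \<tau> x"
  shows "joined \<tau> (\<iota> \<circ> transpose x y) S \<longleftrightarrow> joined (\<tau> \<circ> transpose x y) \<iota> S"
proof -
  have "x \<in> T \<longleftrightarrow> y \<in> T" if "(\<tau> \<circ> transpose x y) ` T \<subseteq> T" for T
  proof -
    have y: "y \<in> orbit (\<tau> \<circ> transpose x y) x" using assms by (intro orbit_comp_transpose)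
    hence x: "x \<in> orbit (\<tau> \<circ> transpose x y) y"
      using orbit_swap permutation_self_in_orbit permutation_comp_transpose assms(3) by metis
    show ?thesis using orbit_subset_closed[OF that] x y by blast
  qed
  thus ?thesis unfolding joined_insert_iff[OF assms(1,2)] unfolding joined_def by metis
qed

text \<open>If the deletion disconnects the gluing, every proper nonempty closed set contains
  exactly one end of the edge. Hence there are just two components, and \<open>T\<close> is the one
  that contains \<open>x\<close>.\<close>

lemma joined_split_iff:
  assumes "pairing (D - {x, y}) \<iota>" "x \<noteq> y" "permutation \<tau>" "finite S" "\<tau> ` S \<subseteq> S" "D \<subseteq> S"
    "x \<in> S" "y \<in> S"
  shows "joined \<tau> (\<iota> \<circ> transpose x y) S \<longleftrightarrow> joined (\<tau> \<circ> transpose x y) \<iota> S \<or>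
    (\<exists>T\<subseteq>S. x \<in> T \<and> y \<notin> T \<and> (\<tau> \<circ> transpose x y) ` T \<subseteq> T \<and> \<iota> ` T \<subseteq> T \<and>
       joined (\<tau> \<circ> transpose x y) \<iota> T \<and> joined (\<tau> \<circ> transpose x y) \<iota> (S - T))"
    (is "?L \<longleftrightarrow> ?J \<or> (\<exists>T\<subseteq>S. ?R T)")
proof -
  define \<tau>' where "\<tau>' = \<tau> \<circ> transpose x y"
  have \<tau>': "permutation \<tau>'" "\<tau>' ` S \<subseteq> S"
    unfolding \<tau>'_def using assms
    by (intro permutation_comp_transpose image_comp_transpose_subset; simp)+
  have \<iota>: "permutation \<iota>" "\<iota> ` S \<subseteq> S"
    using assms(4,6) pairing_image[OF assms(1), of S] finite_subset
    by (auto intro!: pairing_permutation[OF assms(1)])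
  note L = joined_insert_iff[OF assms(1,2), of \<tau> S, folded \<tau>'_def]
  have diff: "\<tau>' ` (V - U) \<subseteq> V - U" "\<iota> ` (V - U) \<subseteq> V - U"
    if "U \<subseteq> V" "V \<subseteq> S" "\<tau>' ` U \<subseteq> U" "\<iota> ` U \<subseteq> U" "\<tau>' ` V \<subseteq> V" "\<iota> ` V \<subseteq> V" for U V
    using that assms(4) finite_subset image_closed_Diff[OF \<tau>'(1)] image_closed_Diff[OF \<iota>(1)]
        by metis+
  have "?L \<longleftrightarrow> joined \<tau>' \<iota> S \<or> (\<exists>T\<subseteq>S. x \<in> T \<and> y \<notin> T \<and> \<tau>' ` T \<subseteq> T \<and> \<iota> ` T \<subseteq> T \<and>
       joined \<tau>' \<iota> T \<and> joined \<tau>' \<iota> (S - T))"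
  proof
    assume l: ?L
    show "joined \<tau>' \<iota> S \<or> (\<exists>T\<subseteq>S. x \<in> T \<and> y \<notin> T \<and> \<tau>' ` T \<subseteq> T \<and> \<iota> ` T \<subseteq> T \<and>
       joined \<tau>' \<iota> T \<and> joined \<tau>' \<iota> (S - T))"
    proof (cases "joined \<tau>' \<iota> S")
      case False
      then obtain T0 where T0: "T0 \<subseteq> S" "T0 \<noteq> {}" "\<tau>' ` T0 \<subseteq> T0" "\<iota> ` T0 \<subseteq> T0" "T0 \<noteq> S"
        using l assms(7) unfolding joined_def by blast
      define T where "T = (if x \<in> T0 then T0 else S - T0)"
      have n: "x \<in> U \<longleftrightarrow> y \<notin> U" if "U \<subseteq> S" "U \<noteq> {}" "\<tau>' ` U \<subseteq> U" "\<iota> ` U \<subseteq> U" "U \<noteq> S" for U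
        using l that unfolding L by blast
      have T: "T \<subseteq> S" "x \<in> T" "y \<notin> T" "\<tau>' ` T \<subseteq> T" "\<iota> ` T \<subseteq> T"
        using n[OF T0] T0 diff[of T0 S] \<tau>'(2) \<iota>(2) assms(7,8) unfolding T_def by auto
      have T': "\<tau>' ` (S - T) \<subseteq> S - T" "\<iota> ` (S - T) \<subseteq> S - T"
        by (rule diff[OF T(1) order_refl T(4,5) \<tau>'(2) \<iota>(2)])+
      \<comment> \<open>If \<open>U\<close> were a smaller closed part of \<open>V\<close>, both
        \<open>U\<close> and \<open>V - U\<close> would contain one end of the edge, whereas
        \<open>V\<close> contains only one.\<close>
      have j: "joined \<tau>' \<iota> V" if V: "V \<subseteq> S" "\<tau>' ` V \<subseteq> V" "\<iota> ` V \<subseteq> V" "V \<noteq> {}" "V \<noteq> S"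
        "x \<in> V \<longleftrightarrow> y \<notin> V" for V
        unfolding joined_def
      proof (intro conjI allI impI)
        fix U assume U: "U \<subseteq> V" "U \<noteq> {}" "\<tau>' ` U \<subseteq> U" "\<iota> ` U \<subseteq> U"
        have "x \<in> U \<longleftrightarrow> y \<notin> U" using n[of U] U V by blast
        moreover have "x \<in> V - U \<longleftrightarrow> y \<notin> V - U" if "V - U \<noteq> {}"
          using n[of "V - U"] diff[of U V] U V that by blast
        ultimately show "U = V" using U V by blast
      qed (use V in auto)
      have "joined \<tau>' \<iota> T" using T assms(7,8) by (intro j) auto
      moreover have "joined \<tau>' \<iota> (S - T)" using T T' assms(7,8) by (intro j) auto
      ultimately show ?thesis using T by blast
    qed simp
  next
    assume "joined \<tau>' \<iota> S \<or> (\<exists>T\<subseteq>S. x \<in> T \<and> y \<notin> T \<and> \<tau>' ` T \<subseteq> T \<and> \<iota> ` T \<subseteq> T \<and>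
       joined \<tau>' \<iota> T \<and> joined \<tau>' \<iota> (S - T))"
    thus ?L
    proof
      assume "joined \<tau>' \<iota> S"
      thus ?L unfolding L by (simp add: joined_def)
    next
      assume "\<exists>T\<subseteq>S. x \<in> T \<and> y \<notin> T \<and> \<tau>' ` T \<subseteq> T \<and> \<iota> ` T \<subseteq> T \<and> joined \<tau>' \<iota> T \<and> joined \<tau>' \<iota> (S - T)"
      then obtain T where T: "T \<subseteq> S" "x \<in> T" "y \<notin> T" "\<tau>' ` T \<subseteq> T" "\<iota> ` T \<subseteq> T"
        "joined \<tau>' \<iota> T" "joined \<tau>' \<iota> (S - T)" by blast
      have T': "\<tau>' ` (S - T) \<subseteq> S - T" "\<iota> ` (S - T) \<subseteq> S - T"
        by (rule diff[OF T(1) order_refl T(4,5) \<tau>'(2) \<iota>(2)])+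
      show ?L unfolding L
      proof (intro conjI allI impI)
        fix U assume U: "U \<subseteq> S" "U \<noteq> {}" "\<tau>' ` U \<subseteq> U" "\<iota> ` U \<subseteq> U" "x \<in> U \<longleftrightarrow> y \<in> U"
        have a: "U \<inter> T = {} \<or> U \<inter> T = T"
        proof -
          have "\<tau>' ` (U \<inter> T) \<subseteq> U \<inter> T" "\<iota> ` (U \<inter> T) \<subseteq> U \<inter> T"
            using U(3,4) T(4,5) by (simp_all only: image_Int_closed)
          thus ?thesis using T(6) unfolding joined_def by (metis Int_lower2)
        qed
        have b: "U \<inter> (S - T) = {} \<or> U \<inter> (S - T) = S - T"
        proof -
          have "\<tau>' ` (U \<inter> (S - T)) \<subseteq> U \<inter> (S - T)" "\<iota> ` (U \<inter> (S - T)) \<subseteq> U \<inter> (S - T)"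
            using U(3,4) T' by (simp_all only: image_Int_closed)
          thus ?thesis using T(7) unfolding joined_def by (metis Int_lower2)
        qed
        have U_eq: "U = (U \<inter> T) \<union> (U \<inter> (S - T))" using U(1) by blast
        show "U = S"
        proof (cases "x \<in> U")
          case True
          hence "U \<inter> T \<noteq> {}" "U \<inter> (S - T) \<noteq> {}" using T(2,3) U(5) assms(8) by blast+
          thus ?thesis using a b U_eq T(1) by (metis Un_Diff_cancel Un_absorb1)
        next
          case False
          hence "U \<inter> T \<noteq> T" "U \<inter> (S - T) \<noteq> S - T" using T(2,3) U(5) assms(8) by blast+
          thus ?thesis using a b U_eq U(2) by (metis Un_empty)
        qed
      qed (use assms(7) in auto)
    qed
  qed
  thus ?thesis unfolding \<tau>'_def .
qed

section \<open>Restriction to components and Euler's inequality\<close>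

lemma pairing_restrict:
  assumes "pairing D \<iota>" "\<iota> ` T \<subseteq> T"
  shows "pairing (D \<inter> T) (perm_restrict \<iota> T)"
  using assms pairing_in[OF assms(1)] pairing_outside[OF assms(1)]
  by (intro pairingI) (auto simp: perm_restrict_def pairing_def)

lemma joined_cong:
  assumes "\<And>x. x \<in> S \<Longrightarrow> \<iota> x = \<iota>' x"
  shows "joined \<tau> \<iota> S \<longleftrightarrow> joined \<tau> \<iota>' S"
proof -
  have "\<iota> ` T = \<iota>' ` T" if "T \<subseteq> S" for T using that assms by (intro image_cong) auto
  thus ?thesis unfolding joined_def by (metis (no_types, lifting))
qed

lemma num_cycles_comp_cong:
  assumes "\<tau> ` S \<subseteq> S" "\<iota> ` S \<subseteq> S" "\<And>x. x \<in> S \<Longrightarrow> \<iota> x = \<iota>' x"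
  shows "num_cycles S (\<tau> \<circ> \<iota>) = num_cycles S (\<tau> \<circ> \<iota>')"
  using assms by (intro num_cycles_cong) auto

text \<open>An edge is deleted and the vertices stay. A merge costs one face and two live points,
  which preserves the bound exactly. A split gains a face: if the gluing stays connected there is a
  slack of 4, and if it falls apart the bounds of the two parts add up to the claim. Without live
  points \<open>\<tau>\<close> is a single cycle, with equality.\<close>

lemma num_cycles_le:
  assumes "finite S" "permutation \<tau>" "\<tau> ` S \<subseteq> S" "D \<subseteq> S" "pairing D \<iota>" "joined \<tau> \<iota> S"
  shows "2 * (num_cycles S (\<tau> \<circ> \<iota>) + num_cycles S \<tau>) \<le> card D + 4"
  using assms
proof (induction "card D" arbitrary: D S \<tau> \<iota> rule: less_induct)
  case less
  show ?case
  proof (cases "D = {}")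
    case True
    have \<iota>: "\<iota> = id" using less.prems(5) True by (auto simp: pairing_def)
    obtain x where x: "x \<in> S" using less.prems(6) unfolding joined_def by blast
    have "orbit \<tau> x \<subseteq> S" "orbit \<tau> x \<noteq> {}" "\<tau> ` orbit \<tau> x \<subseteq> orbit \<tau> x" "\<iota> ` orbit \<tau> x \<subseteq> orbit \<tau> x"
      using orbit_subset_closed[OF less.prems(3) x] orbit_nonempty[of \<tau> x] \<iota>
        cyclic_on_closed[OF cyclic_on_orbit'[OF less.prems(2)]] by auto
    hence "orbit \<tau> x = S" using less.prems(6) unfolding joined_def by blast
    hence "num_cycles S \<tau> = 1"
      using num_cycles_cyclic_on[OF cyclic_on_orbit'[OF less.prems(2), of x]] by simp
    thus ?thesis by (simp add: \<iota> True)
  next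
    case False
    then obtain x where x: "x \<in> D" by blast
    define y where "y = \<iota> x"
    have y: "y \<in> D" "x \<noteq> y" using less.prems(5) x pairing_in by (auto simp: y_def pairing_def)
    define \<tau>' \<iota>' where "\<tau>' = \<tau> \<circ> transpose x y" and "\<iota>' = \<iota> \<circ> transpose x y"
    have \<iota>': "pairing (D - {x, y}) \<iota>'" unfolding \<iota>'_def using pairing_remove less.prems(5) x y_def
        by blast
    have \<iota>_eq: "\<iota> = \<iota>' \<circ> transpose x y" by (simp add: \<iota>'_def comp_assoc)
    have S: "x \<in> S" "y \<in> S" using x y less.prems(4) by auto
    have \<tau>': "permutation \<tau>'" "\<tau>' ` S \<subseteq> S"
      unfolding \<tau>'_def using less.prems S
      by (intro permutation_comp_transpose image_comp_transpose_subset; simp)+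
    have c: "\<tau> \<circ> \<iota> = \<tau>' \<circ> \<iota>'"
      unfolding \<iota>_eq \<tau>'_def by (rule comp_transpose_pairing[OF \<iota>'])
    have finD: "finite D" using less.prems finite_subset by blast
    note cD = card_Diff_pair[OF finD x y]
    \<comment> \<open>Stated for closed subsets and smaller live sets, because the gluing may fall
      apart.\<close>
    have IH: "2 * (num_cycles T (\<tau>' \<circ> \<iota>'') + num_cycles T \<tau>') \<le> card D0 + 4"
      if "T \<subseteq> S" "\<tau>' ` T \<subseteq> T" "D0 \<subseteq> T" "D0 \<subseteq> D - {x, y}" "pairing D0 \<iota>''" "joined \<tau>' \<iota>'' T"
          for T D0 \<iota>''
    proof (rule less.hyps)
      show "card D0 < card D" using card_mono[OF _ that(4)] finD cD by simp
      show "finite T" using that(1) less.prems(1) by (rule finite_subset)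
    qed (use that \<tau>' in auto)
    have DS: "D - {x, y} \<subseteq> S" using less.prems(4) by blast
    show ?thesis
    proof (cases "y \<in> orbit \<tau> x")
      case True
      have n: "num_cycles S \<tau>' = num_cycles S \<tau> + 1"
        unfolding \<tau>'_def using less.prems S y True by (intro num_cycles_split)
      have "joined \<tau>' \<iota>' S \<or> (\<exists>T\<subseteq>S. x \<in> T \<and> y \<notin> T \<and> \<tau>' ` T \<subseteq> T \<and> \<iota>' ` T \<subseteq> T \<and>
         joined \<tau>' \<iota>' T \<and> joined \<tau>' \<iota>' (S - T))"
        using less.prems(6) joined_split_iff[OF \<iota>' y(2) less.prems(2,1,3,4) S]
            unfolding \<iota>_eq \<tau>'_def by simp
      thus ?thesis
      proof
        assume "joined \<tau>' \<iota>' S"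
        from IH[OF order_refl \<tau>'(2) DS order_refl \<iota>' this] show ?thesis using cD n unfolding c
            by simp
      next
        assume "\<exists>T\<subseteq>S. x \<in> T \<and> y \<notin> T \<and> \<tau>' ` T \<subseteq> T \<and> \<iota>' ` T \<subseteq> T \<and>
         joined \<tau>' \<iota>' T \<and> joined \<tau>' \<iota>' (S - T)"
        then obtain T where T: "T \<subseteq> S" "\<tau>' ` T \<subseteq> T" "\<iota>' ` T \<subseteq> T" "joined \<tau>' \<iota>' T" "joined \<tau>' \<iota>' (S
            - T)"
          by blast
        have fT: "finite T" using T less.prems(1) finite_subset by blast
        have p\<iota>': "permutation \<iota>'" "\<iota>' ` S \<subseteq> S"
          using finD pairing_image[OF \<iota>', of S] less.prems(4)
              by (auto intro!: pairing_permutation[OF \<iota>'])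
        have T': "\<tau>' ` (S - T) \<subseteq> S - T" "\<iota>' ` (S - T) \<subseteq> S - T"
          using image_closed_Diff \<tau>' p\<iota>' T less.prems(1) by metis+
        have bound: "2 * (num_cycles U (\<tau>' \<circ> \<iota>') + num_cycles U \<tau>') \<le> card ((D - {x, y}) \<inter> U) + 4"
          if "U \<subseteq> S" "\<tau>' ` U \<subseteq> U" "\<iota>' ` U \<subseteq> U" "joined \<tau>' \<iota>' U" for U
        proof -
          have r: "perm_restrict \<iota>' U z = \<iota>' z" if "z \<in> U" for z using that
              by (simp add: perm_restrict_def)
          have "joined \<tau>' \<iota>' U \<longleftrightarrow> joined \<tau>' (perm_restrict \<iota>' U) U"
            by (rule joined_cong) (simp add: r)
          hence "joined \<tau>' (perm_restrict \<iota>' U) U" using that(4) by simp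
          from IH[OF that(1,2) Int_lower2 Int_lower1 pairing_restrict[OF \<iota>' that(3)] this]
          show ?thesis using num_cycles_comp_cong[OF that(2,3) r[symmetric]] by simp
        qed
        have "num_cycles S p = num_cycles T p + num_cycles (S - T) p"
          if "p ` T \<subseteq> T" "p ` (S - T) \<subseteq> S - T" for p
          using num_cycles_Un[of T "S - T" p] that fT less.prems(1) T(1) by (simp add: Un_absorb1)
        note n1 = this[OF T(2) T'(1)] and n2 = this[of "\<tau>' \<circ> \<iota>'"]
        have "(\<tau>' \<circ> \<iota>') ` T \<subseteq> T" "(\<tau>' \<circ> \<iota>') ` (S - T) \<subseteq> S - T"
          using T(2,3) T' by (simp_all only: image_comp_closed)
        note n2 = n2[OF this]
        have "card (D - {x, y}) = card ((D - {x, y}) \<inter> T) + card ((D - {x, y}) \<inter> (S - T))"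
        proof -
          have "(D - {x, y}) \<inter> (S - T) = D - {x, y} - T" using less.prems(4) by blast
          thus ?thesis using card_Int_Diff[of "D - {x, y}" T] finD by simp
        qed
        thus ?thesis using bound[OF T(1-4)] bound[OF Diff_subset T' T(5)] n n1 n2 cD unfolding c
            by simp
      qed
    next
      case False
      have n: "num_cycles S \<tau> = num_cycles S \<tau>' + 1"
        unfolding \<tau>'_def using less.prems S False by (intro num_cycles_merge)
      have "joined \<tau>' \<iota>' S"
        using less.prems(6) joined_merge_iff[OF \<iota>' y(2) less.prems(2) False] unfolding \<iota>_eq \<tau>'_def
            by simp
      from IH[OF order_refl \<tau>'(2) DS order_refl \<iota>' this] show ?thesis using cD n unfolding c by simp
    qed
  qed
qed

section \<open>Deleting an edge\<close>

lemma finite_planar: "finite D \<Longrightarrow> finite (planar \<tau> S D)"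
  by (rule finite_subset[OF _ finite_permutations[of D]]) (auto simp: planar_def pairing_def)

text \<open>A union of faces without live points is closed under both permutations, so nothing
  connects it to the rest.\<close>

lemma planar_empty:
  assumes "A \<subseteq> S" "A \<noteq> {}" "A \<noteq> S" "\<tau> ` A \<subseteq> A" "D \<inter> A = {}"
  shows "planar \<tau> S D = {}"
proof -
  have False if "pairing D \<iota>" "joined \<tau> \<iota> S" for \<iota>
  proof -
    have "\<iota> z = z" if "z \<in> A" for z
      using pairing_outside[OF \<open>pairing D \<iota>\<close>, of z] that assms(5) by blast
    hence "\<iota> ` A \<subseteq> A" by auto
    thus False using that(2) assms(1-4) unfolding joined_def by blast
  qed
  thus ?thesis by (auto simp: planar_def)
qed

lemma card_planar_fibers:
  assumes "finite D" "x \<in> D"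
  shows "card (planar \<tau> S D) = (\<Sum>y\<in>D - {x}. card {\<iota> \<in> planar \<tau> S D. \<iota> x = y})"
proof -
  have "planar \<tau> S D = (\<Union>y\<in>D - {x}. {\<iota> \<in> planar \<tau> S D. \<iota> x = y})"
    using assms(2) pairing_in by (auto simp: planar_def pairing_def permutes_in_image)
  also have "card \<dots> = (\<Sum>y\<in>D - {x}. card {\<iota> \<in> planar \<tau> S D. \<iota> x = y})"
    using assms finite_planar[OF assms(1)] by (intro card_UN_disjoint) auto
  finally show ?thesis .
qed

text \<open>The map is its own inverse. Connectivity stays expressed by the old involution, since
  its translation depends on whether the edge joins two faces or lies on one.\<close>

lemma bij_betw_fiber:
  assumes "x \<in> D" "y \<in> D" "x \<noteq> y"
  shows "bij_betw (\<lambda>\<iota>. \<iota> \<circ> transpose x y)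
    {\<iota>. pairing (D - {x, y}) \<iota> \<and> joined \<tau> (\<iota> \<circ> transpose x y) S \<and>
       2 * (num_cycles S ((\<tau> \<circ> transpose x y) \<circ> \<iota>) + num_cycles S \<tau>) = card D + 4}
    {\<iota> \<in> planar \<tau> S D. \<iota> x = y}"
proof (rule bij_betw_byWitness[where f' = "\<lambda>\<iota>. \<iota> \<circ> transpose x y"])
  have "\<iota> \<circ> transpose x y \<in> planar \<tau> S D \<and> (\<iota> \<circ> transpose x y) x = y"
    if "pairing (D - {x, y}) \<iota>" "joined \<tau> (\<iota> \<circ> transpose x y) S"
      "2 * (num_cycles S ((\<tau> \<circ> transpose x y) \<circ> \<iota>) + num_cycles S \<tau>) = card D + 4" for \<iota>
    using pairing_insert[OF that(1) assms] that(2,3) comp_transpose_pairing[OF that(1), of \<tau>]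
    by (simp add: planar_def)
  thus "(\<lambda>\<iota>. \<iota> \<circ> transpose x y) ` {\<iota>. pairing (D - {x, y}) \<iota> \<and> joined \<tau> (\<iota> \<circ> transpose x y) S \<and>
       2 * (num_cycles S ((\<tau> \<circ> transpose x y) \<circ> \<iota>) + num_cycles S \<tau>) = card D + 4}
     \<subseteq> {\<iota> \<in> planar \<tau> S D. \<iota> x = y}" by blast
  have "pairing (D - {x, y}) (\<iota> \<circ> transpose x y) \<and> joined \<tau> (\<iota> \<circ> transpose x y \<circ> transpose x y) S \<and>
      2 * (num_cycles S ((\<tau> \<circ> transpose x y) \<circ> (\<iota> \<circ> transpose x y)) + num_cycles S \<tau>) = card D + 4"
    if "\<iota> \<in> planar \<tau> S D" "\<iota> x = y" for \<iota>
  proof -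
    have \<iota>: "pairing D \<iota>" "joined \<tau> \<iota> S" "2 * (num_cycles S (\<tau> \<circ> \<iota>) + num_cycles S \<tau>) = card D + 4"
      using that(1) by (auto simp: planar_def)
    have p: "pairing (D - {x, y}) (\<iota> \<circ> transpose x y)" using pairing_remove \<iota>(1) assms(1) that(2) .
    show ?thesis
      using p \<iota> comp_transpose_pairing[OF p, of \<tau>] by (simp add: comp_assoc)
  qed
  thus "(\<lambda>\<iota>. \<iota> \<circ> transpose x y) ` {\<iota> \<in> planar \<tau> S D. \<iota> x = y} \<subseteq>
     {\<iota>. pairing (D - {x, y}) \<iota> \<and> joined \<tau> (\<iota> \<circ> transpose x y) S \<and>
       2 * (num_cycles S ((\<tau> \<circ> transpose x y) \<circ> \<iota>) + num_cycles S \<tau>) = card D + 4}" by blast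
qed (auto simp: comp_assoc)

text \<open>With one face and two live points fewer, both sides of Euler's equation drop by
  2.\<close>

lemma card_fiber_merge:
  assumes "permutation \<tau>" "finite S" "\<tau> ` S \<subseteq> S" "D \<subseteq> S" "x \<in> D" "y \<in> D" "y \<notin> orbit \<tau> x"
  shows "card {\<iota> \<in> planar \<tau> S D. \<iota> x = y} = card (planar (\<tau> \<circ> transpose x y) S (D - {x, y}))"
proof -
  have xy: "x \<noteq> y" using assms(1,7) permutation_self_in_orbit by metis
  have finD: "finite D" using assms finite_subset by blast
  have n: "num_cycles S \<tau> = num_cycles S (\<tau> \<circ> transpose x y) + 1"
    using assms by (intro num_cycles_merge) auto
  have "planar (\<tau> \<circ> transpose x y) S (D - {x, y}) =
    {\<iota>. pairing (D - {x, y}) \<iota> \<and> joined \<tau> (\<iota> \<circ> transpose x y) S \<and>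
       2 * (num_cycles S ((\<tau> \<circ> transpose x y) \<circ> \<iota>) + num_cycles S \<tau>) = card D + 4}"
    unfolding planar_def n card_Diff_pair[OF finD assms(5,6) xy]
    using joined_merge_iff[OF _ xy assms(1,7)] by auto
  thus ?thesis using bij_betw_same_card[OF bij_betw_fiber[OF assms(5,6) xy, of \<tau> S]] by simp
qed

text \<open>The constant 8 stands for two spheres with 4 each. \<open>num_cycles_le\<close> bounds
  each part by its share, so the total is reached only if both parts are planar.\<close>

lemma card_planar_product:
  assumes "permutation \<tau>" "finite S" "\<tau> ` S \<subseteq> S" "D \<subseteq> S" "T \<subseteq> S" "\<tau> ` T \<subseteq> T"
  shows "card {\<iota>. pairing D \<iota> \<and> \<iota> ` T \<subseteq> T \<and> joined \<tau> \<iota> T \<and> joined \<tau> \<iota> (S - T) \<and>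
      2 * (num_cycles S (\<tau> \<circ> \<iota>) + num_cycles S \<tau>) = card D + 8} =
    card (planar \<tau> T (D \<inter> T)) * card (planar \<tau> (S - T) (D \<inter> (S - T)))"
    (is "card ?N = _")
proof -
  have fin: "finite T" "finite D" "finite (S - T)" using assms finite_subset by blast+
  have \<tau>c: "\<tau> ` (S - T) \<subseteq> S - T" using image_closed_Diff assms by metis
  have cD: "card D = card (D \<inter> T) + card (D \<inter> (S - T))"
  proof -
    have "D \<inter> (S - T) = D - T" using assms(4) by blast
    thus ?thesis using card_Int_Diff[OF fin(2), of T] by simp
  qed
  have num: "num_cycles S p = num_cycles T p + num_cycles (S - T) p"
    if "p ` T \<subseteq> T" "p ` (S - T) \<subseteq> S - T" for p
    using num_cycles_Un[of T "S - T" p] that fin assms(5) by (simp add: Un_absorb1)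
  let ?f = "\<lambda>\<iota>. (perm_restrict \<iota> T, perm_restrict \<iota> (S - T))"
  \<comment> \<open>The two restrictions move disjoint sets of points, so their composition recovers
    the involution.\<close>
  let ?g = "\<lambda>(\<alpha>, \<beta>). \<alpha> \<circ> \<beta>"
  let ?P = "planar \<tau> T (D \<inter> T) \<times> planar \<tau> (S - T) (D \<inter> (S - T))"
  have f: "?f \<iota> \<in> ?P \<and> ?g (?f \<iota>) = \<iota>" if "\<iota> \<in> ?N" for \<iota>
  proof -
    have \<iota>: "pairing D \<iota>" "\<iota> ` T \<subseteq> T" "joined \<tau> \<iota> T" "joined \<tau> \<iota> (S - T)"
      "2 * (num_cycles S (\<tau> \<circ> \<iota>) + num_cycles S \<tau>) = card D + 8" using that by auto
    have \<iota>c: "\<iota> ` (S - T) \<subseteq> S - T"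
      using image_closed_Diff[OF pairing_permutation[OF \<iota>(1) fin(2)] assms(2) pairing_image[OF
          \<iota>(1) assms(4)] \<iota>(2) assms(5)] .
    have part: "pairing (D \<inter> V) (perm_restrict \<iota> V)" "joined \<tau> (perm_restrict \<iota> V) V"
      "num_cycles V (\<tau> \<circ> perm_restrict \<iota> V) = num_cycles V (\<tau> \<circ> \<iota>)"
      if "\<tau> ` V \<subseteq> V" "\<iota> ` V \<subseteq> V" "joined \<tau> \<iota> V" for V
    proof -
      show "pairing (D \<inter> V) (perm_restrict \<iota> V)" using pairing_restrict \<iota>(1) that(2) .
      have "joined \<tau> (perm_restrict \<iota> V) V \<longleftrightarrow> joined \<tau> \<iota> V"
        by (rule joined_cong) (simp add: perm_restrict_def)
      thus "joined \<tau> (perm_restrict \<iota> V) V" using that(3) by simp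
      have "num_cycles V (\<tau> \<circ> \<iota>) = num_cycles V (\<tau> \<circ> perm_restrict \<iota> V)"
        by (rule num_cycles_comp_cong[OF that(1,2)]) (simp add: perm_restrict_def)
      thus "num_cycles V (\<tau> \<circ> perm_restrict \<iota> V) = num_cycles V (\<tau> \<circ> \<iota>)" by simp
    qed
    note p1 = part[OF assms(6) \<iota>(2,3)] and p2 = part[OF \<tau>c \<iota>c \<iota>(4)]
    have "2 * (num_cycles T (\<tau> \<circ> \<iota>) + num_cycles T \<tau>) \<le> card (D \<inter> T) + 4"
      using num_cycles_le[OF fin(1) assms(1,6) Int_lower2 p1(1,2)] unfolding p1(3) .
    moreover have "2 * (num_cycles (S - T) (\<tau> \<circ> \<iota>) + num_cycles (S - T) \<tau>) \<le> card (D \<inter> (S - T)) + 4"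
      using num_cycles_le[OF fin(3) assms(1) \<tau>c Int_lower2 p2(1,2)] unfolding p2(3) .
    moreover have "num_cycles S (\<tau> \<circ> \<iota>) = num_cycles T (\<tau> \<circ> \<iota>) + num_cycles (S - T) (\<tau> \<circ> \<iota>)"
      using num image_comp_closed[OF assms(6) \<iota>(2)] image_comp_closed[OF \<tau>c \<iota>c] by blast
    ultimately have "2 * (num_cycles T (\<tau> \<circ> \<iota>) + num_cycles T \<tau>) = card (D \<inter> T) + 4"
      "2 * (num_cycles (S - T) (\<tau> \<circ> \<iota>) + num_cycles (S - T) \<tau>) = card (D \<inter> (S - T)) + 4"
      using \<iota>(5) cD num[OF assms(6) \<tau>c] by auto
    hence "?f \<iota> \<in> ?P" using p1 p2 unfolding planar_def by simp
    moreover have "perm_restrict \<iota> T (perm_restrict \<iota> (S - T) z) = \<iota> z" for z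
    proof -
      consider "z \<in> T" | "z \<in> S - T" | "z \<notin> S" using assms(5) by blast
      thus ?thesis
      proof cases
        case 3
        hence "\<iota> z = z" using pairing_outside[OF \<iota>(1)] assms(4) by blast
        thus ?thesis by (simp add: perm_restrict_def)
      next
        case 2
        hence "\<iota> z \<in> S - T" using \<iota>c by blast
        thus ?thesis using 2 by (simp add: perm_restrict_def)
      qed (simp add: perm_restrict_def)
    qed
    ultimately show ?thesis by auto
  qed
  have g: "?g u \<in> ?N \<and> ?f (?g u) = u" if u: "u \<in> ?P" for u
  proof -
    obtain \<alpha> \<beta> where u_eq: "u = (\<alpha>, \<beta>)" by (cases u)
    have \<alpha>: "pairing (D \<inter> T) \<alpha>" "joined \<tau> \<alpha> T" "2 * (num_cycles T (\<tau> \<circ> \<alpha>) + num_cycles T \<tau>)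
        = card (D \<inter> T) + 4"
      and \<beta>: "pairing (D \<inter> (S - T)) \<beta>" "joined \<tau> \<beta> (S - T)"
      "2 * (num_cycles (S - T) (\<tau> \<circ> \<beta>) + num_cycles (S - T) \<tau>) = card (D \<inter> (S - T)) + 4"
      using u by (auto simp: u_eq planar_def)
    have \<alpha>T: "\<alpha> ` T \<subseteq> T" using pairing_image[OF \<alpha>(1), of T] by simp
    have \<beta>T: "\<beta> ` (S - T) \<subseteq> S - T" using pairing_image[OF \<beta>(1), of "S - T"] by simp
    have on_T: "(\<alpha> \<circ> \<beta>) z = \<alpha> z" if "z \<in> T" for z
      using pairing_outside[OF \<beta>(1), of z] that by simp
    have on_ST: "(\<alpha> \<circ> \<beta>) z = \<beta> z" if "z \<in> S - T" for z
    proof -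
      have "\<beta> z \<notin> T" using \<beta>T that by blast
      thus ?thesis using pairing_outside[OF \<alpha>(1), of "\<beta> z"] by simp
    qed
    have out: "(\<alpha> \<circ> \<beta>) z = z" if "z \<notin> D" for z
      using pairing_outside[OF \<alpha>(1), of z] pairing_outside[OF \<beta>(1), of z] that by simp
    have c: "(\<alpha> \<circ> \<beta>) ` T \<subseteq> T" "(\<alpha> \<circ> \<beta>) ` (S - T) \<subseteq> S - T"
      using \<alpha>T \<beta>T on_T on_ST by auto
    have "pairing D (\<alpha> \<circ> \<beta>)"
    proof (rule pairingI)
      fix z assume z: "z \<in> D"
      show "(\<alpha> \<circ> \<beta>) z \<in> D \<and> (\<alpha> \<circ> \<beta>) ((\<alpha> \<circ> \<beta>) z) = z \<and> (\<alpha> \<circ> \<beta>) z \<noteq> z"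
      proof (cases "z \<in> T")
        case True
        hence "\<alpha> z \<in> D \<inter> T" "\<alpha> (\<alpha> z) = z" "\<alpha> z \<noteq> z"
          using \<alpha>(1) z pairing_in[OF \<alpha>(1)] by (auto simp: pairing_def)
        thus ?thesis using on_T True by auto
      next
        case False
        hence zST: "z \<in> S - T" using z assms(4) by blast
        hence b: "\<beta> z \<in> D \<inter> (S - T)" "\<beta> (\<beta> z) = z" "\<beta> z \<noteq> z"
          using \<beta>(1) z pairing_in[OF \<beta>(1)] by (auto simp: pairing_def)
        show ?thesis unfolding on_ST[OF zST] on_ST[OF IntD2[OF b(1)]] using b by blast
      qed
    qed (rule out)
    moreover have "joined \<tau> (\<alpha> \<circ> \<beta>) T" using joined_cong[of T "\<alpha> \<circ> \<beta>" \<alpha> \<tau>] on_T \<alpha>(2) by simp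
    moreover have "joined \<tau> (\<alpha> \<circ> \<beta>) (S - T)" using joined_cong[of "S - T" "\<alpha> \<circ> \<beta>" \<beta> \<tau>] on_ST \<beta>(2)
        by blast
    moreover have "num_cycles T (\<tau> \<circ> (\<alpha> \<circ> \<beta>)) = num_cycles T (\<tau> \<circ> \<alpha>)"
      by (rule num_cycles_comp_cong[OF assms(6) c(1)]) (rule on_T)
    moreover have "num_cycles (S - T) (\<tau> \<circ> (\<alpha> \<circ> \<beta>)) = num_cycles (S - T) (\<tau> \<circ> \<beta>)"
      by (rule num_cycles_comp_cong[OF \<tau>c c(2)]) (rule on_ST)
    moreover note num[OF assms(6) \<tau>c] num[OF image_comp_closed[OF assms(6) c(1)]
        image_comp_closed[OF \<tau>c c(2)]]
    ultimately have "\<alpha> \<circ> \<beta> \<in> ?N" using c(1) \<alpha>(3) \<beta>(3) cD by simp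
    moreover have "perm_restrict (\<alpha> \<circ> \<beta>) T = \<alpha>"
    proof
      fix z show "perm_restrict (\<alpha> \<circ> \<beta>) T z = \<alpha> z"
        using on_T[of z] pairing_outside[OF \<alpha>(1), of z] by (simp add: perm_restrict_def)
    qed
    moreover have "perm_restrict (\<alpha> \<circ> \<beta>) (S - T) = \<beta>"
    proof
      fix z show "perm_restrict (\<alpha> \<circ> \<beta>) (S - T) z = \<beta> z"
        using on_ST[of z] pairing_outside[OF \<beta>(1), of z] unfolding perm_restrict_def
            by (metis IntD2)
    qed
    ultimately show ?thesis by (simp add: u_eq)
  qed
  have "bij_betw ?f ?N ?P"
    by (rule bij_betw_byWitness[where f' = ?g]) (use f g in blast)+
  thus ?thesis by (simp add: bij_betw_same_card card_cartesian_product)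
qed

text \<open>One face more and two live points fewer turn Euler's equation into one with the constant
  8. This exceeds the bound for a connected gluing, so there are two components, and the sum runs
  over the possible components \<open>T\<close> of \<open>x\<close>.\<close>

lemma card_fiber_split:
  assumes "permutation \<tau>" "finite S" "\<tau> ` S \<subseteq> S" "D \<subseteq> S" "x \<in> D" "y \<in> D" "x \<noteq> y" "y \<in> orbit \<tau> x"
  defines "\<tau>' \<equiv> \<tau> \<circ> transpose x y" and "D' \<equiv> D - {x, y}"
  shows "card {\<iota> \<in> planar \<tau> S D. \<iota> x = y} =
    (\<Sum>T | T \<subseteq> S \<and> x \<in> T \<and> y \<notin> T \<and> \<tau>' ` T \<subseteq> T.
       card (planar \<tau>' T (D' \<inter> T)) * card (planar \<tau>' (S - T) (D' \<inter> (S - T))))"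
proof -
  have finD: "finite D" "finite D'" using assms finite_subset unfolding D'_def by blast+
  have S: "x \<in> S" "y \<in> S" using assms by auto
  have \<tau>': "permutation \<tau>'" "\<tau>' ` S \<subseteq> S" "D' \<subseteq> S"
    using permutation_comp_transpose[OF assms(1)] image_comp_transpose_subset[OF assms(3), of x y]
        S assms(4)
    unfolding \<tau>'_def D'_def by auto
  have n: "num_cycles S \<tau>' = num_cycles S \<tau> + 1"
    unfolding \<tau>'_def using assms(1-3) S(1) assms(7,8) by (rule num_cycles_split)
  have cD: "card D = card D' + 2"
    unfolding D'_def using card_Diff_pair[OF finD(1) assms(5-7)] .
  let ?I = "{T. T \<subseteq> S \<and> x \<in> T \<and> y \<notin> T \<and> \<tau>' ` T \<subseteq> T}"
  define N where "N = (\<lambda>T. {\<iota>. pairing D' \<iota> \<and> \<iota> ` T \<subseteq> T \<and> joined \<tau>' \<iota> T \<and> joined \<tau>' \<iota> (S - T) \<and>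
      2 * (num_cycles S (\<tau>' \<circ> \<iota>) + num_cycles S \<tau>') = card D' + 8})"
  let ?M = "{\<iota>. pairing D' \<iota> \<and> joined \<tau> (\<iota> \<circ> transpose x y) S \<and>
       2 * (num_cycles S (\<tau>' \<circ> \<iota>) + num_cycles S \<tau>) = card D + 4}"
  have M: "?M = (\<Union>T\<in>?I. N T)"
  proof -
    have "\<iota> \<in> ?M \<longleftrightarrow> \<iota> \<in> (\<Union>T\<in>?I. N T)" for \<iota>
    proof (cases "pairing D' \<iota> \<and> 2 * (num_cycles S (\<tau>' \<circ> \<iota>) + num_cycles S \<tau>') = card D' + 8")
      case True
      have "\<not> joined \<tau>' \<iota> S"
        using num_cycles_le[OF assms(2) \<tau>', of \<iota>] True by auto
      thus ?thesis using True n cD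
          joined_split_iff[OF True[THEN conjunct1, unfolded D'_def] assms(7,1,2,3,4) S, folded
              \<tau>'_def]
        by (auto simp: N_def)
    next
      case False
      thus ?thesis using n cD by (auto simp: N_def)
    qed
    thus ?thesis by blast
  qed
  have "card {\<iota> \<in> planar \<tau> S D. \<iota> x = y} = card ?M"
    using bij_betw_same_card[OF bij_betw_fiber[OF assms(5-7), of \<tau> S]] unfolding \<tau>'_def D'_def
        by simp
  also have "\<dots> = (\<Sum>T\<in>?I. card (N T))"
    unfolding M
  proof (rule card_UN_disjoint)
    show "finite ?I" using assms(2) by (auto intro: finite_subset[of _ "Pow S"])
    show "\<forall>T\<in>?I. finite (N T)"
      by (auto simp: N_def pairing_def intro: finite_subset[OF _ finite_permutations[OF finD(2)]])
    show "\<forall>T\<in>?I. \<forall>U\<in>?I. T \<noteq> U \<longrightarrow> N T \<inter> N U = {}"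
    proof (intro ballI impI)
      fix T U assume TU: "T \<in> ?I" "U \<in> ?I" "T \<noteq> U"
      have False if "\<iota> \<in> N T" "\<iota> \<in> N U" for \<iota>
      proof -
        have i: "\<iota> ` T \<subseteq> T" "\<iota> ` U \<subseteq> U" "joined \<tau>' \<iota> T" "joined \<tau>' \<iota> U"
          using that by (auto simp: N_def)
        have t: "\<tau>' ` T \<subseteq> T" "\<tau>' ` U \<subseteq> U" "T \<inter> U \<noteq> {}" using TU by auto
        \<comment> \<open>Both components contain \<open>x\<close>, so their intersection is a
          nonempty closed set, and minimality makes it equal to each of them.\<close>
        have "T \<inter> U = T" "T \<inter> U = U"
          using i(3,4) t(3) image_Int_closed[OF t(1,2)] image_Int_closed[OF i(1,2)]
          unfolding joined_def by (metis Int_lower1 Int_lower2)+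
        thus False using TU(3) by simp
      qed
      thus "N T \<inter> N U = {}" by blast
    qed
  qed
  also have "\<dots> = (\<Sum>T\<in>?I. card (planar \<tau>' T (D' \<inter> T)) * card (planar \<tau>' (S - T) (D' \<inter> (S - T))))"
    unfolding N_def using \<tau>' assms(2) by (intro sum.cong refl card_planar_product) auto
  finally show ?thesis .
qed

section \<open>Planar gluings of one, two and three faces\<close>

lemma closed_subsets_cyclic:
  assumes "cyclic_on \<tau> B"
  shows "{U. U \<subseteq> B \<and> \<tau> ` U \<subseteq> U} = {{}, B}"
proof -
  have "U \<in> {{}, B}" if "U \<subseteq> B" "\<tau> ` U \<subseteq> U" for U
    using cyclic_on_closed_cases[OF assms that(2)] that(1) by blast
  moreover have "\<tau> ` B \<subseteq> B" using assms by (rule cyclic_on_closed)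
  ultimately show ?thesis by auto
qed

lemma closed_subsets_cyclic2:
  assumes "cyclic_on \<tau> B" "cyclic_on \<tau> C"
  shows "{U. U \<subseteq> B \<union> C \<and> \<tau> ` U \<subseteq> U} = {{}, B, C, B \<union> C}"
proof -
  have "U \<in> {{}, B, C, B \<union> C}" if "U \<subseteq> B \<union> C" "\<tau> ` U \<subseteq> U" for U
    using cyclic_on_closed_cases[OF assms(1) that(2)] cyclic_on_closed_cases[OF assms(2) that(2)]
        that(1)
    by blast
  hence "{U. U \<subseteq> B \<union> C \<and> \<tau> ` U \<subseteq> U} \<subseteq> {{}, B, C, B \<union> C}" by (intro subsetI) simp
  moreover have c: "\<tau> ` B \<subseteq> B" "\<tau> ` C \<subseteq> C" using assms by (simp_all only: cyclic_on_closed)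
  moreover have "\<tau> ` (B \<union> C) \<subseteq> B \<union> C" unfolding image_Un by (intro Un_mono c)
  ultimately show ?thesis by (intro subset_antisym) simp_all
qed

text \<open>A closed set with \<open>x\<close> but without \<open>y\<close> consists of the new face
  \<open>A1\<close> and a union \<open>U\<close> of faces outside \<open>A\<close>. The sum thus
  runs over the ways to distribute those faces over the two spheres.\<close>

lemma card_fiber_split_face:
  fixes \<tau> :: "nat \<Rightarrow> nat"
  assumes "permutation \<tau>" "finite R" "cyclic_on \<tau> A" "A \<inter> R = {}" "\<tau> ` R \<subseteq> R" "D \<subseteq> A \<union> R"
    "x \<in> D" "y \<in> D" "A = A1 \<union> A2" "A1 \<inter> A2 = {}" "x \<in> A1" "y \<in> A2"
  defines "\<tau>' \<equiv> \<tau> \<circ> transpose x y" and "D' \<equiv> D - {x, y}"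
  assumes "cyclic_on \<tau>' A1" "cyclic_on \<tau>' A2"
  shows "card {\<iota> \<in> planar \<tau> (A \<union> R) D. \<iota> x = y} =
    (\<Sum>U | U \<subseteq> R \<and> \<tau> ` U \<subseteq> U.
       card (planar \<tau>' (A1 \<union> U) (D' \<inter> (A1 \<union> U))) * card (planar \<tau>' (A2 \<union> (R - U)) (D' \<inter> (A2 \<union> (R
           - U)))))"
proof -
  have xy: "x \<noteq> y" "y \<in> orbit \<tau> x" "finite A"
    using assms(3,9-12) finite_cyclic_on[OF assms(3)] by (auto simp: cyclic_on_alldef)
  have R: "\<tau>' z = \<tau> z" if "z \<in> R" for z
    using that assms(4,9,11,12) by (auto simp: \<tau>'_def transpose_def)
  let ?I = "{T. T \<subseteq> A \<union> R \<and> x \<in> T \<and> y \<notin> T \<and> \<tau>' ` T \<subseteq> T}"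
  let ?J = "{U. U \<subseteq> R \<and> \<tau> ` U \<subseteq> U}"
  have c: "\<tau>' ` A1 \<subseteq> A1" using cyclic_on_closed[OF assms(15)] .
  have I: "A1 \<union> (T \<inter> R) = T" "T \<inter> R \<in> ?J" if "T \<in> ?I" for T
  proof -
    have T: "T \<subseteq> A \<union> R" "x \<in> T" "y \<notin> T" "\<tau>' ` T \<subseteq> T" using that by auto
    have "A1 \<subseteq> T" "A2 \<inter> T = {}"
      using cyclic_on_closed_cases[OF assms(15) T(4)] cyclic_on_closed_cases[OF assms(16) T(4)]
          T(2,3) assms(11,12)
      by blast+
    thus "A1 \<union> (T \<inter> R) = T" using T(1) assms(9) by blast
    have "\<tau> z \<in> T \<inter> R" if "z \<in> T \<inter> R" for z
      using R[of z] T(4) assms(5) that by (metis IntD1 IntD2 IntI image_subset_iff)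
    thus "T \<inter> R \<in> ?J" by blast
  qed
  have J: "A1 \<union> U \<in> ?I" "(A1 \<union> U) \<inter> R = U" "A \<union> R - (A1 \<union> U) = A2 \<union> (R - U)" if "U \<in> ?J" for U
  proof -
    have U: "U \<subseteq> R" "\<tau> ` U \<subseteq> U" using that by auto
    have "\<tau>' z \<in> U" if "z \<in> U" for z using R[of z] U that by (metis image_subset_iff subsetD)
    hence "\<tau>' ` (A1 \<union> U) \<subseteq> A1 \<union> U" using c by blast
    thus "A1 \<union> U \<in> ?I" using U(1) assms(4,9-12) by blast
    show "(A1 \<union> U) \<inter> R = U" "A \<union> R - (A1 \<union> U) = A2 \<union> (R - U)"
      using U(1) assms(4,9,10) by blast+
  qed
  have "\<tau> ` (A \<union> R) \<subseteq> A \<union> R" using assms(5) cyclic_on_closed[OF assms(3)] by blast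
  from card_fiber_split[OF assms(1) _ this assms(6-8) xy(1,2)]
  have "card {\<iota> \<in> planar \<tau> (A \<union> R) D. \<iota> x = y} =
    (\<Sum>T\<in>?I. card (planar \<tau>' T (D' \<inter> T)) * card (planar \<tau>' (A \<union> R - T) (D' \<inter> (A \<union> R - T))))"
    using xy(3) assms(2) unfolding \<tau>'_def D'_def by simp
  also have "\<dots> = (\<Sum>U\<in>?J. card (planar \<tau>' (A1 \<union> U) (D' \<inter> (A1 \<union> U))) *
      card (planar \<tau>' (A2 \<union> (R - U)) (D' \<inter> (A2 \<union> (R - U)))))"
  proof (rule sum.reindex_bij_witness[where i = "\<lambda>U. A1 \<union> U" and j = "\<lambda>T. T \<inter> R"])
    fix T assume T: "T \<in> ?I"
    have e: "A2 \<union> (R - T \<inter> R) = A \<union> R - T" using J(3)[OF I(2)[OF T]] I(1)[OF T] by simp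
    show "card (planar \<tau>' (A1 \<union> T \<inter> R) (D' \<inter> (A1 \<union> T \<inter> R))) *
       card (planar \<tau>' (A2 \<union> (R - T \<inter> R)) (D' \<inter> (A2 \<union> (R - T \<inter> R)))) =
       card (planar \<tau>' T (D' \<inter> T)) * card (planar \<tau>' (A \<union> R - T) (D' \<inter> (A \<union> R - T)))"
      unfolding I(1)[OF T] e ..
    show "A1 \<union> T \<inter> R = T" "T \<inter> R \<in> ?J" using I[OF T] by this+
  next
    fix U assume U: "U \<in> ?J"
    show "(A1 \<union> U) \<inter> R = U" "A1 \<union> U \<in> ?I" using J(2,1)[OF U] by this+
  qed
  finally show ?thesis .
qed

lemma sum_rev: "(\<Sum>i<a - 1. f (a - 2 - i) i) = (\<Sum>i<a - 1. f i (a - 2 - i))"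
    for f :: "nat \<Rightarrow> nat \<Rightarrow> real"
proof -
  have "(\<Sum>i<a - 1. f i (a - 2 - i)) = (\<Sum>i<a - 1. f (a - 1 - Suc i) (a - 2 - (a - 1 - Suc i)))"
    by (rule sum.nat_diff_reindex[symmetric])
  also have "\<dots> = (\<Sum>i<a - 1. f (a - 2 - i) i)"
    by (intro sum.cong refl) (auto intro!: arg_cong2[where f = f])
  finally show ?thesis by simp
qed

lemma planar_no_edges:
  assumes "cyclic_on \<tau> A"
  shows "planar \<tau> A {} = {id}"
proof -
  have "joined \<tau> id A"
    using assms cyclic_on_closed_cases[OF assms] unfolding joined_def cyclic_on_alldef by blast
  thus ?thesis using num_cycles_cyclic_on[OF assms] by (auto simp: planar_def pairing_def)
qed

text \<open>The live set is written as \<open>D \<inter> A\<close> so that after a split one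
  remaining live set serves both halves of the face in the induction hypothesis.\<close>

lemma card_planar_disk:
  assumes "permutation \<tau>" "cyclic_on \<tau> A"
  shows "real (card (planar \<tau> A (D \<inter> A))) = disk_count (card (D \<inter> A))"
  using assms
proof (induction "card (D \<inter> A)" arbitrary: D A \<tau> rule: less_induct)
  case less
  have finA: "finite A" using less.prems(2) by (rule finite_cyclic_on)
  define E where "E = D \<inter> A"
  have finE: "finite E" using finA by (simp add: E_def)
  show ?case
  proof (cases "E = {}")
    case True
    then show ?thesis using planar_no_edges[OF less.prems(2)] disk_count_even[of 0]
        by (simp add: E_def)
  next
    case False
    then obtain x where x: "x \<in> E" by blast
    have EA: "E \<inter> A = E" "E \<subseteq> A" by (auto simp: E_def)
    obtain r where r: "\<And>g :: nat \<Rightarrow> real. (\<Sum>y\<in>E - {x}. g (r y)) = (\<Sum>i<card E - 1. g i)"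
      "\<And>y. y \<in> E - {x} \<Longrightarrow> \<exists>A1 A2. A = A1 \<union> A2 \<and> A1 \<inter> A2 = {} \<and> x \<in> A1 \<and> y \<in> A2 \<and>
       cyclic_on (\<tau> \<circ> transpose x y) A1 \<and> cyclic_on (\<tau> \<circ> transpose x y) A2 \<and>
       card ((E - {x, y}) \<inter> A1) = card E - 2 - r y \<and> card ((E - {x, y}) \<inter> A2) = r y"
      using cyclic_on_split[OF less.prems(2) subsetD[OF EA(2) x] x, unfolded EA(1)] by metis
    have fiber: "real (card {\<iota> \<in> planar \<tau> A E. \<iota> x = y}) = disk_count (card E - 2
        - r y) * disk_count (r y)"
      if y: "y \<in> E - {x}" for y
    proof -
      define \<tau>' where "\<tau>' = \<tau> \<circ> transpose x y"
      define E' where "E' = E - {x, y}"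
      obtain A1 A2 where s: "A = A1 \<union> A2" "A1 \<inter> A2 = {}" "x \<in> A1" "y \<in> A2"
        "cyclic_on \<tau>' A1" "cyclic_on \<tau>' A2"
        "card (E' \<inter> A1) = card E - 2 - r y" "card (E' \<inter> A2) = r y"
        using r(2)[OF y] unfolding \<tau>'_def E'_def by blast
      have "card (E' \<inter> V) < card (D \<inter> A)" for V
        unfolding E_def[symmetric] using x y finE by (intro psubset_card_mono) (auto simp: E'_def)
      note IH = less.hyps[OF this permutation_comp_transpose[OF less.prems(1)], of x y, folded
          \<tau>'_def]
      have "card {\<iota> \<in> planar \<tau> (A \<union> {}) E. \<iota> x = y} =
        (\<Sum>U | U \<subseteq> {} \<and> \<tau> ` U \<subseteq> U. card (planar \<tau>' (A1 \<union> U) (E' \<inter> (A1 \<union> U))) *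
           card (planar \<tau>' (A2 \<union> ({} - U)) (E' \<inter> (A2 \<union> ({} - U)))))"
        unfolding \<tau>'_def E'_def using less.prems x y EA s(1-4) s(5,6)[unfolded \<tau>'_def]
        by (intro card_fiber_split_face) auto
      also have "\<dots> = card (planar \<tau>' A1 (E' \<inter> A1)) * card (planar \<tau>' A2 (E' \<inter> A2))"
      proof -
        have "{U. U \<subseteq> {} \<and> \<tau> ` U \<subseteq> U} = {{}}" by auto
        thus ?thesis by simp
      qed
      finally show ?thesis using IH[OF s(5)] IH[OF s(6)] s(7,8) by simp
    qed
    have "real (card (planar \<tau> A E)) = (\<Sum>y\<in>E - {x}. disk_count (card E - 2
        - r y) * disk_count (r y))"
      unfolding card_planar_fibers[OF finE x] of_nat_sum by (intro sum.cong refl fiber)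
    also have "\<dots> = (\<Sum>i<card E - 1. disk_count (card E - 2 - i) * disk_count i)"
      using r(1)[of "\<lambda>i. disk_count (card E - 2 - i) * disk_count i"] .
    also have "\<dots> = (\<Sum>i<card E - 1. disk_count i * disk_count (card E - 2 - i))"
      by (simp only: mult.commute)
    also have "\<dots> = disk_count (card E)"
      using x finE by (intro disk_count_rec[symmetric]) (auto simp: card_gt_0_iff)
    finally show ?thesis by (simp add: E_def)
  qed
qed

text \<open>If the root edge at \<open>x\<close> returns to \<open>A\<close>, the face
  \<open>B\<close> goes to the side of \<open>x\<close> or to that of \<open>y\<close>, which gives
  two mirror-image products. If it leads to \<open>B\<close>, the faces merge into a disk, with the
  same count for each of the \<open>b\<close> partners.\<close>

lemma card_planar_annulus:
  assumes "permutation \<tau>" "cyclic_on \<tau> A" "cyclic_on \<tau> B" "A \<inter> B = {}"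
  shows "real (card (planar \<tau> (A \<union> B) (D \<inter> (A \<union> B)))) = annulus_count (card (D \<inter> A)) (card (D \<inter> B))"
  using assms
proof (induction "card (D \<inter> (A \<union> B))" arbitrary: D A B \<tau> rule: less_induct)
  case less
  have fin: "finite A" "finite B" using less.prems by (auto intro: finite_cyclic_on)
  have ne: "A \<noteq> {}" "B \<noteq> {}" using less.prems(2,3) by (auto simp: cyclic_on_alldef)
  define E where "E = D \<inter> (A \<union> B)"
  define a b where "a = card (E \<inter> A)" and "b = card (E \<inter> B)"
  have ab: "card (D \<inter> A) = a" "card (D \<inter> B) = b"
    unfolding a_def b_def E_def by (auto intro!: arg_cong[where f = card])
  have finE: "finite E" and EAB: "E \<subseteq> A \<union> B" using fin by (auto simp: E_def)
  show ?case
  proof (cases "E \<inter> A = {}")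
    case True
    have "planar \<tau> (A \<union> B) E = {}"
      using ne less.prems(4) True cyclic_on_closed[OF less.prems(2)]
          by (intro planar_empty[of A]) auto
    thus ?thesis using True ab by (simp add: E_def[symmetric] a_def annulus_count_def)
  next
    case False
    then obtain x where x: "x \<in> E" "x \<in> A" by blast
    obtain r where r: "\<And>g :: nat \<Rightarrow> real. (\<Sum>y\<in>E \<inter> A - {x}. g (r y)) = (\<Sum>i<a - 1. g i)"
      "\<And>y. y \<in> E \<inter> A - {x} \<Longrightarrow> \<exists>A1 A2. A = A1 \<union> A2 \<and> A1 \<inter> A2 = {} \<and> x \<in> A1 \<and> y \<in> A2 \<and>
       cyclic_on (\<tau> \<circ> transpose x y) A1 \<and> cyclic_on (\<tau> \<circ> transpose x y) A2 \<and>
       card ((E - {x, y}) \<inter> A1) = a - 2 - r y \<and> card ((E - {x, y}) \<inter> A2) = r y"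
      using cyclic_on_split[OF less.prems(2) x(2,1)] unfolding a_def by metis
    have fiber1: "real (card {\<iota> \<in> planar \<tau> (A \<union> B) E. \<iota> x = y}) =
        disk_count (a - 2 - r y) * annulus_count (r y) b + annulus_count (a - 2
            - r y) b * disk_count (r y)"
      if y: "y \<in> E \<inter> A - {x}" for y
    proof -
      define \<tau>' where "\<tau>' = \<tau> \<circ> transpose x y"
      define E' where "E' = E - {x, y}"
      have \<tau>': "permutation \<tau>'" unfolding \<tau>'_def using less.prems(1)
          by (rule permutation_comp_transpose)
      obtain A1 A2 where s: "A = A1 \<union> A2" "A1 \<inter> A2 = {}" "x \<in> A1" "y \<in> A2"
        "cyclic_on \<tau>' A1" "cyclic_on \<tau>' A2"
        "card (E' \<inter> A1) = a - 2 - r y" "card (E' \<inter> A2) = r y"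
        using r(2)[OF y] unfolding \<tau>'_def E'_def by blast
      have B: "cyclic_on \<tau>' B" "card (E' \<inter> B) = b" "A1 \<inter> B = {}" "A2 \<inter> B = {}"
        unfolding \<tau>'_def E'_def b_def using less.prems(3,4) x y s(1)
        by (auto intro!: cyclic_on_comp_transpose arg_cong[where f = card])
      have "card (E' \<inter> V) < card (D \<inter> (A \<union> B))" for V
        unfolding E_def[symmetric] using x y finE by (intro psubset_card_mono) (auto simp: E'_def)
      note IH = less.hyps[OF this \<tau>']
      have "card {\<iota> \<in> planar \<tau> (A \<union> B) E. \<iota> x = y} =
        (\<Sum>U | U \<subseteq> B \<and> \<tau> ` U \<subseteq> U. card (planar \<tau>' (A1 \<union> U) (E' \<inter> (A1 \<union> U))) *
           card (planar \<tau>' (A2 \<union> (B - U)) (E' \<inter> (A2 \<union> (B - U)))))"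
        unfolding \<tau>'_def E'_def using less.prems fin x y EAB s(1-4) s(5,6)[unfolded \<tau>'_def]
          cyclic_on_closed[OF less.prems(3)]
        by (intro card_fiber_split_face) auto
      also have "\<dots> = card (planar \<tau>' A1 (E' \<inter> A1)) * card (planar \<tau>' (A2 \<union> B) (E' \<inter> (A2 \<union> B))) +
        card (planar \<tau>' (A1 \<union> B) (E' \<inter> (A1 \<union> B))) * card (planar \<tau>' A2 (E' \<inter> A2))"
        unfolding closed_subsets_cyclic[OF less.prems(3)] using ne(2) by simp
      finally show ?thesis
        using card_planar_disk[OF \<tau>' s(5), of E'] card_planar_disk[OF \<tau>' s(6), of E']
          IH[OF s(5) B(1,3)] IH[OF s(6) B(1,4)] s(7,8) B(2) by simp
    qed
    have fiber2: "real (card {\<iota> \<in> planar \<tau> (A \<union> B) E. \<iota> x = y}) = disk_count (a + b - 2)"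
      if y: "y \<in> E \<inter> B" for y
    proof -
      have yx: "y \<notin> orbit \<tau> x" using x y less.prems(2,4) orbit_cyclic_eq3 by fastforce
      have cyc: "cyclic_on (\<tau> \<circ> transpose x y) (A \<union> B)"
        using less.prems(2-4) x y by (intro cyclic_on_merge) auto
      have "card E = a + b"
        unfolding a_def b_def using finE EAB less.prems(4)
        by (subst card_Un_disjoint[symmetric]) (auto intro!: arg_cong[where f = card])
      moreover have "x \<noteq> y" using x y less.prems(4) by blast
      ultimately have "card (E - {x, y}) = a + b - 2"
        using card_Diff_pair[OF finE x(1), of y] y by simp
      moreover have "card {\<iota> \<in> planar \<tau> (A \<union> B) E. \<iota> x = y}
          = card (planar (\<tau> \<circ> transpose x y) (A \<union> B) (E - {x, y}))"
        using less.prems(1) fin EAB x y yx cyclic_on_closed[OF less.prems(2)] cyclic_on_closed[OF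
            less.prems(3)]
        by (intro card_fiber_merge) auto
      moreover have "(E - {x, y}) \<inter> (A \<union> B) = E - {x, y}" using EAB by blast
      ultimately show ?thesis
        using card_planar_disk[OF permutation_comp_transpose[OF less.prems(1)] cyc, of "E
            - {x, y}"] by simp
    qed
    have "real (card (planar \<tau> (A \<union> B) E)) = (\<Sum>y\<in>E - {x}. real (card {\<iota> \<in> planar \<tau> (A \<union> B) E. \<iota> x
        = y}))"
      unfolding card_planar_fibers[OF finE x(1)] of_nat_sum ..
    also have "E - {x} = (E \<inter> A - {x}) \<union> (E \<inter> B)" using EAB x less.prems(4) by blast
    also have "(\<Sum>y\<in>(E \<inter> A - {x}) \<union> (E \<inter> B). real (card {\<iota> \<in> planar \<tau> (A \<union> B) E. \<iota> x = y})) =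
      (\<Sum>y\<in>E \<inter> A - {x}. disk_count (a - 2 - r y) * annulus_count (r y) b + annulus_count (a - 2
          - r y) b * disk_count (r y)) +
      (\<Sum>y\<in>E \<inter> B. disk_count (a + b - 2))"
      using less.prems(4) finE by (subst sum.union_disjoint) (auto simp: fiber1 fiber2)
    also have "\<dots> = (\<Sum>i<a - 1. disk_count (a - 2 - i) * annulus_count i b + annulus_count (a - 2
        - i) b * disk_count i) + real b * disk_count (a + b - 2)"
      unfolding r(1)[of "\<lambda>i. disk_count (a - 2 - i) * annulus_count i b + annulus_count (a - 2
          - i) b * disk_count i"] by (simp add: b_def)
    also have "\<dots> = 2 * (\<Sum>i<a - 1. disk_count i * annulus_count (a - 2 - i) b)
        + real b * disk_count (a + b - 2)"
      unfolding sum.distrib sum_rev[of "\<lambda>i j. disk_count i * annulus_count j b"]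
          by (simp add: mult.commute)
    also have "\<dots> = annulus_count a b"
      using x finE unfolding a_def by (intro annulus_count_rec[symmetric]) (auto simp:
          card_gt_0_iff)
    finally show ?thesis unfolding ab E_def[symmetric] .
  qed
qed

lemma card_planar_pants:
  assumes "permutation \<tau>" "cyclic_on \<tau> A" "cyclic_on \<tau> B" "cyclic_on \<tau> C"
    "A \<inter> B = {}" "A \<inter> C = {}" "B \<inter> C = {}"
  shows "real (card (planar \<tau> (A \<union> (B \<union> C)) (D \<inter> (A \<union> (B \<union> C))))) =
    pants_count (card (D \<inter> A)) (card (D \<inter> B)) (card (D \<inter> C))"
  using assms
proof (induction "card (D \<inter> (A \<union> (B \<union> C)))" arbitrary: D A B C \<tau> rule: less_induct)
  case less
  note cyc = less.prems(2-4) and disj = less.prems(5-7)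
  have fin: "finite A" "finite B" "finite C" using cyc by (auto intro: finite_cyclic_on)
  have ne: "A \<noteq> {}" "B \<noteq> {}" "C \<noteq> {}" using cyc by (auto simp: cyclic_on_alldef)
  define S where "S = A \<union> (B \<union> C)"
  define E where "E = D \<inter> S"
  define a b c where "a = card (E \<inter> A)" and "b = card (E \<inter> B)" and "c = card (E \<inter> C)"
  have abc: "card (D \<inter> A) = a" "card (D \<inter> B) = b" "card (D \<inter> C) = c"
    unfolding a_def b_def c_def E_def S_def by (auto intro!: arg_cong[where f = card])
  have finE: "finite E" and ES: "E \<subseteq> S" and finS: "finite S" using fin by (auto simp: E_def S_def)
  have closed: "\<tau> ` A \<subseteq> A" "\<tau> ` B \<subseteq> B" "\<tau> ` C \<subseteq> C" using cyclic_on_closed cyc by metis+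
  hence closedS: "\<tau> ` S \<subseteq> S" unfolding S_def by blast
  show ?case
  proof (cases "E \<inter> A = {}")
    case True
    have "planar \<tau> S E = {}"
      using ne disj True closed by (intro planar_empty[of A]) (auto simp: S_def)
    thus ?thesis using True abc by (simp add: E_def[symmetric] S_def[symmetric] a_def
        pants_count_def)
  next
    case False
    then obtain x where x: "x \<in> E" "x \<in> A" by blast
    obtain r where r: "\<And>g :: nat \<Rightarrow> real. (\<Sum>y\<in>E \<inter> A - {x}. g (r y)) = (\<Sum>i<a - 1. g i)"
      "\<And>y. y \<in> E \<inter> A - {x} \<Longrightarrow> \<exists>A1 A2. A = A1 \<union> A2 \<and> A1 \<inter> A2 = {} \<and> x \<in> A1 \<and> y \<in> A2 \<and>
       cyclic_on (\<tau> \<circ> transpose x y) A1 \<and> cyclic_on (\<tau> \<circ> transpose x y) A2 \<and>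
       card ((E - {x, y}) \<inter> A1) = a - 2 - r y \<and> card ((E - {x, y}) \<inter> A2) = r y"
      using cyclic_on_split[OF cyc(1) x(2,1)] unfolding a_def by metis
    \<comment> \<open>\<open>i\<close> and \<open>j\<close> are the live points left on the sides of
      \<open>x\<close> and \<open>y\<close>. The four products belong to the four ways to distribute
      \<open>B\<close> and \<open>C\<close> over these sides.\<close>
    define h where "h = (\<lambda>i j. disk_count i * pants_count j b c
        + annulus_count i b * annulus_count j c + (annulus_count i c * annulus_count j b
        + pants_count i b c * disk_count j))"
    have fiber1: "real (card {\<iota> \<in> planar \<tau> S E. \<iota> x = y}) = h (a - 2 - r y) (r y)"
      if y: "y \<in> E \<inter> A - {x}" for y
    proof -
      define \<tau>' where "\<tau>' = \<tau> \<circ> transpose x y"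
      define E' where "E' = E - {x, y}"
      have \<tau>': "permutation \<tau>'" unfolding \<tau>'_def using less.prems(1)
          by (rule permutation_comp_transpose)
      obtain A1 A2 where s: "A = A1 \<union> A2" "A1 \<inter> A2 = {}" "x \<in> A1" "y \<in> A2"
        "cyclic_on \<tau>' A1" "cyclic_on \<tau>' A2"
        "card (E' \<inter> A1) = a - 2 - r y" "card (E' \<inter> A2) = r y"
        using r(2)[OF y] unfolding \<tau>'_def E'_def by blast
      have xyBC: "x \<notin> B" "y \<notin> B" "x \<notin> C" "y \<notin> C" using x y disj by auto
      have BC: "cyclic_on \<tau>' B" "cyclic_on \<tau>' C"
        unfolding \<tau>'_def using cyc(2,3) xyBC by (auto intro: cyclic_on_comp_transpose)
      have d: "A1 \<inter> B = {}" "A2 \<inter> B = {}" "A1 \<inter> C = {}" "A2 \<inter> C = {}" using disj s(1) by auto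
      have cBC: "card (E' \<inter> B) = b" "card (E' \<inter> C) = c"
        unfolding E'_def b_def c_def using xyBC by (auto intro!: arg_cong[where f = card])
      have "card (E' \<inter> V) < card (D \<inter> (A \<union> (B \<union> C)))" for V
        unfolding S_def[symmetric] E_def[symmetric] using x y finE
        by (intro psubset_card_mono) (auto simp: E'_def)
      note IH = less.hyps[OF this \<tau>']
      have "card {\<iota> \<in> planar \<tau> (A \<union> (B \<union> C)) E. \<iota> x = y} =
        (\<Sum>U | U \<subseteq> B \<union> C \<and> \<tau> ` U \<subseteq> U. card (planar \<tau>' (A1 \<union> U) (E' \<inter> (A1 \<union> U))) *
           card (planar \<tau>' (A2 \<union> (B \<union> C - U)) (E' \<inter> (A2 \<union> (B \<union> C - U)))))"
        unfolding \<tau>'_def E'_def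
      proof (rule card_fiber_split_face)
        show "A \<inter> (B \<union> C) = {}" "\<tau> ` (B \<union> C) \<subseteq> B \<union> C" using disj closed by blast+
        show "E \<subseteq> A \<union> (B \<union> C)" using ES by (simp add: S_def)
      qed (use less.prems(1) cyc fin x y s(1-4) s(5,6)[unfolded \<tau>'_def] in auto)
      also have "\<dots> = card (planar \<tau>' A1 (E' \<inter> A1)) * card (planar \<tau>' (A2 \<union> (B \<union> C)) (E' \<inter> (A2 \<union> (B
          \<union> C)))) +
        card (planar \<tau>' (A1 \<union> B) (E' \<inter> (A1 \<union> B))) * card (planar \<tau>' (A2 \<union> C) (E' \<inter> (A2 \<union> C))) +
        (card (planar \<tau>' (A1 \<union> C) (E' \<inter> (A1 \<union> C))) * card (planar \<tau>' (A2 \<union> B) (E' \<inter> (A2 \<union> B))) +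
        card (planar \<tau>' (A1 \<union> (B \<union> C)) (E' \<inter> (A1 \<union> (B \<union> C)))) * card (planar \<tau>' A2 (E' \<inter> A2)))"
        (is "_ = ?rhs")
      proof -
        have n: "{} \<notin> {B, C, B \<union> C}" "B \<notin> {C, B \<union> C}" "C \<notin> {B \<union> C}" using ne disj by auto
        have e: "B \<union> C - B = C" "B \<union> C - C = B" using disj by auto
        show ?thesis unfolding closed_subsets_cyclic2[OF cyc(2,3)] using n by (simp add: e)
      qed
      finally have e: "card {\<iota> \<in> planar \<tau> S E. \<iota> x = y} = ?rhs" unfolding S_def .
      show ?thesis
        unfolding e h_def of_nat_add of_nat_mult
          card_planar_disk[OF \<tau>' s(5), of E'] card_planar_disk[OF \<tau>' s(6), of E']
          card_planar_annulus[OF \<tau>' s(5) BC(1) d(1), of E'] card_planar_annulus[OF \<tau>' s(6) BC(1)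
              d(2), of E']
          card_planar_annulus[OF \<tau>' s(5) BC(2) d(3), of E'] card_planar_annulus[OF \<tau>' s(6) BC(2)
              d(4), of E']
          IH[OF s(5) BC d(1,3) disj(3)] IH[OF s(6) BC d(2,4) disj(3)] s(7,8) cBC ..
    qed
    \<comment> \<open>\<open>V\<close> is the face that absorbs the edge and \<open>W\<close> the
      other one, so that the argument serves both orders of \<open>B\<close> and
      \<open>C\<close>.\<close>
    have fiber2: "real (card {\<iota> \<in> planar \<tau> S E. \<iota> x = y}) = annulus_count (a + card (E \<inter> V)
        - 2) (card (E \<inter> W))"
      if y: "y \<in> E \<inter> V" and VW: "A \<union> (V \<union> W) = S" "cyclic_on \<tau> V" "cyclic_on \<tau> W" "A \<inter> V
          = {}" "A \<inter> W = {}" "V \<inter> W = {}"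
      for y V W
    proof -
      have yx: "y \<notin> orbit \<tau> x" "x \<noteq> y" using x y cyc(1) VW(4) orbit_cyclic_eq3 by fastforce+
      have cyc': "cyclic_on (\<tau> \<circ> transpose x y) (A \<union> V)" "cyclic_on (\<tau> \<circ> transpose x y) W"
        using cyc(1) VW x y by (intro cyclic_on_merge cyclic_on_comp_transpose; auto)+
      have "card (E \<inter> (A \<union> V)) = a + card (E \<inter> V)"
        unfolding a_def Int_Un_distrib using finE VW(4) by (intro card_Un_disjoint) auto
      moreover have "(E - {x, y}) \<inter> (A \<union> V) = E \<inter> (A \<union> V) - {x, y}" by blast
      ultimately have cE: "card ((E - {x, y}) \<inter> (A \<union> V)) = a + card (E \<inter> V) - 2"
        using card_Diff_pair[of "E \<inter> (A \<union> V)" x y] finE x y yx(2) by simp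
      have cW: "(E - {x, y}) \<inter> W = E \<inter> W" using x y VW by blast
      have d: "(A \<union> V) \<inter> W = {}" "(A \<union> V) \<union> W = S" "(E - {x, y}) \<inter> S = E - {x, y}"
        using VW ES by blast+
      have "card {\<iota> \<in> planar \<tau> S E. \<iota> x = y} = card (planar (\<tau> \<circ> transpose x y) S (E - {x, y}))"
        using less.prems(1) finS closedS ES x y yx by (intro card_fiber_merge) auto
      thus ?thesis
        using card_planar_annulus[OF permutation_comp_transpose[OF less.prems(1)] cyc' d(1), of "E
            - {x, y}"]
        unfolding d(2,3) cE cW by simp
    qed
    have fB: "real (card {\<iota> \<in> planar \<tau> S E. \<iota> x = y}) = annulus_count (a + b - 2) c"
        if "y \<in> E \<inter> B" for y
      using fiber2[OF that, of C] cyc disj by (simp add: S_def b_def c_def)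
    have fC: "real (card {\<iota> \<in> planar \<tau> S E. \<iota> x = y}) = annulus_count (a + c - 2) b"
        if "y \<in> E \<inter> C" for y
      using fiber2[OF that, of B] cyc disj by (simp add: S_def b_def c_def Un_commute Int_commute)
    have "real (card (planar \<tau> S E)) = (\<Sum>y\<in>E - {x}. real (card {\<iota> \<in> planar \<tau> S E. \<iota> x = y}))"
      unfolding card_planar_fibers[OF finE x(1)] of_nat_sum ..
    also have "E - {x} = (E \<inter> A - {x}) \<union> ((E \<inter> B) \<union> (E \<inter> C))" using ES x disj unfolding S_def
        by blast
    also have "(\<Sum>y\<in>(E \<inter> A - {x}) \<union> ((E \<inter> B) \<union> (E \<inter> C)). real (card {\<iota> \<in> planar \<tau> S E. \<iota> x = y})) =
      (\<Sum>y\<in>E \<inter> A - {x}. h (a - 2 - r y) (r y)) + (real b * annulus_count (a + b - 2) c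
          + real c * annulus_count (a + c - 2) b)"
    proof -
      have "(E \<inter> A - {x}) \<inter> (E \<inter> B \<union> E \<inter> C) = {}" "(E \<inter> B) \<inter> (E \<inter> C) = {}" using disj by blast+
      thus ?thesis using finE by (simp add: sum.union_disjoint fiber1 fB fC b_def c_def)
    qed
    also have "(\<Sum>y\<in>E \<inter> A - {x}. h (a - 2 - r y) (r y)) = (\<Sum>i<a - 1. h i (a - 2 - i))"
      unfolding r(1)[of "\<lambda>i. h (a - 2 - i) i"] by (rule sum_rev)
    also have "\<dots> = 2 * (\<Sum>i<a - 1. disk_count i * pants_count (a - 2 - i) b c) + 2 * (\<Sum>i<a
        - 1. annulus_count i b * annulus_count (a - 2 - i) c)"
      using sum_rev[of "\<lambda>i j. annulus_count i c * annulus_count j b" a] sum_rev[of "\<lambda>i j.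
          pants_count i b c * disk_count j" a]
      unfolding h_def sum.distrib by (simp add: mult.commute)
    also have "\<dots> + (real b * annulus_count (a + b - 2) c + real c * annulus_count (a + c - 2) b)
        = pants_count a b c"
    proof -
      have "a > 0" using x finE by (auto simp: a_def card_gt_0_iff)
      from pants_count_rec[OF this, of b c] show ?thesis by linarith
    qed
    finally show ?thesis unfolding abc E_def[symmetric] S_def[symmetric] .
  qed
qed

section \<open>Gluing data\<close>

lemma cyclic_on_cycle_of_list:
  assumes "distinct cs" "cs \<noteq> []"
  shows "cyclic_on (cycle_of_list cs) (set cs)"
proof -
  obtain x P where cs: "cs = x # P" using assms(2) by (cases cs) auto
  have "map (cycle_of_list cs) cs = rotate1 cs"
    using cyclic_rotation[OF assms(1), of 1] by simp
  hence "cyc_list (cycle_of_list cs) x P"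
    using assms(1) unfolding cyc_list_def cs by simp
  thus ?thesis using cyc_list_cyclic_on cs by metis
qed

text \<open>A set closed under the generators is closed under the whole group; conversely, the orbit
  of a point is nonempty and closed under the generators.\<close>

lemma transitive_on_generate_iff_joined:
  assumes "\<iota> permutes {1..n}" "\<tau> permutes {1..n}" "n > 0"
  shows "transitive_on (generate (sym_group n) {\<iota>, \<tau>}) {1..n} \<longleftrightarrow> joined \<tau> \<iota> {1..n}"
proof
  let ?G = "generate (sym_group n) {\<iota>, \<tau>}"
  assume tr: "transitive_on ?G {1..n}"
  show "joined \<tau> \<iota> {1..n}"
    unfolding joined_def
  proof (intro conjI allI impI)
    fix T assume T: "T \<subseteq> {1..n}" "T \<noteq> {}" "\<tau> ` T \<subseteq> T" "\<iota> ` T \<subseteq> T"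
    have "finite T" using T(1) finite_subset by blast
    \<comment> \<open>Inverses preserve \<open>T\<close> because on a finite set an injective map of
      \<open>T\<close> into itself is onto.\<close>
    have inv_closed: "Hilbert_Choice.inv p ` T \<subseteq> T" if "p permutes {1..n}" "p ` T \<subseteq> T" for p
    proof -
      have "inj p" using that(1) by (rule permutes_inj)
      hence "p ` T = T" using that(2) \<open>finite T\<close> by (meson endo_inj_surj inj_on_subset subset_UNIV)
      thus ?thesis using \<open>inj p\<close> by (metis image_inv_f_f order_refl)
    qed
    have g: "g ` T \<subseteq> T" if "g \<in> ?G" for g
      using that
    proof (induction rule: generate.induct)
      case one
      then show ?case by (simp add: sym_group_one)
    next
      case (incl h)
      then show ?case using T by auto
    next
      case (inv h)
      hence h: "h permutes {1..n}" "h ` T \<subseteq> T" using assms T by auto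
      have "inv\<^bsub>sym_group n\<^esub> h = Hilbert_Choice.inv h"
        by (rule sym_group_inv_equality) (simp only: sym_group_carrier h(1))
      thus ?case using inv_closed[OF h] by (simp only:)
    next
      case (eng h1 h2)
      then show ?case unfolding sym_group_mult by (intro image_comp_closed)
    qed
    obtain t where t: "t \<in> T" using T(2) by blast
    have "z \<in> T" if "z \<in> {1..n}" for z
    proof -
      have "\<exists>g\<in>?G. g t = z"
        using tr subsetD[OF T(1) t] that unfolding transitive_on_def by (simp only:)
      thus ?thesis using g t by (metis image_subset_iff)
    qed
    thus "T = {1..n}" using T(1) by blast
  qed (use assms(3) in auto)
next
  let ?G = "generate (sym_group n) {\<iota>, \<tau>}"
  assume j: "joined \<tau> \<iota> {1..n}"
  have carr: "{\<iota>, \<tau>} \<subseteq> carrier (sym_group n)" using assms by (simp add: sym_group_carrier)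
  have perm: "g permutes {1..n}" if "g \<in> ?G" for g
    by (rule sym_group_carrier[THEN iffD1, OF group.generate_in_carrier[OF sym_group_is_group carr
        that]])
  show "transitive_on ?G {1..n}"
    unfolding transitive_on_def
  proof (intro ballI)
    fix x y assume xy: "x \<in> {1..n}" "y \<in> {1..n}"
    define T where "T = (\<lambda>g. g x) ` ?G"
    have step: "p ` T \<subseteq> T" if "p \<in> {\<iota>, \<tau>}" for p
    proof -
      have pg: "p \<circ> g \<in> ?G" if "g \<in> ?G" for g
        using generate.eng[OF generate.incl[OF \<open>p \<in> {\<iota>, \<tau>}\<close>] that, unfolded sym_group_mult] .
      have "p (g x) \<in> T" if "g \<in> ?G" for g
        unfolding T_def using pg[OF that] by (intro image_eqI[of _ _ "p \<circ> g"]) simp_all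
      thus ?thesis unfolding T_def by blast
    qed
    have "g x \<in> {1..n}" if "g \<in> ?G" for g using permutes_in_image[OF perm[OF that]] xy(1) by blast
    hence "T \<subseteq> {1..n}" unfolding T_def by blast
    moreover have "T \<noteq> {}" using generate.one[of "sym_group n" "{\<iota>, \<tau>}"] unfolding T_def by blast
    moreover have "\<tau> ` T \<subseteq> T" "\<iota> ` T \<subseteq> T" by (rule step; simp)+
    ultimately have "T = {1..n}" using j unfolding joined_def by blast
    hence "y \<in> T" using xy(2) by (simp only:)
    thus "\<exists>g\<in>?G. g x = y" unfolding T_def by blast
  qed
qed

lemma face_perm_faces:
  assumes "m1 > 0" "m2 > 0" "m3 > 0"
  defines "\<tau> \<equiv> face_perm (m1, m2, m3)"
  shows "cyclic_on \<tau> {1..m1}" "cyclic_on \<tau> {m1 + 1..m1 + m2}" "cyclic_on \<tau> {m1 + m2 + 1..m1 + m2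
      + m3}"
proof -
  define c1 c2 c3 where "c1 = cycle_of_list [1..<m1 + 1]" and "c2 = cycle_of_list [m1 + 1..<m1
      + m2 + 1]"
    and "c3 = cycle_of_list [m1 + m2 + 1..<m1 + m2 + m3 + 1]"
  have \<tau>: "\<tau> = c1 \<circ> c2 \<circ> c3" unfolding \<tau>_def face_perm_def c1_def c2_def c3_def by simp
  have s: "set [1..<m1 + 1] = {1..m1}" "set [m1 + 1..<m1 + m2 + 1] = {m1 + 1..m1 + m2}"
    "set [m1 + m2 + 1..<m1 + m2 + m3 + 1] = {m1 + m2 + 1..m1 + m2 + m3}" by auto
  have p: "c1 permutes {1..m1}" "c2 permutes {m1 + 1..m1 + m2}" "c3 permutes {m1 + m2 + 1..m1 + m2
      + m3}"
    unfolding c1_def c2_def c3_def s[symmetric] by (rule cycle_permutes)+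
  have c: "cyclic_on c1 {1..m1}" "cyclic_on c2 {m1 + 1..m1 + m2}" "cyclic_on c3 {m1 + m2 + 1..m1
      + m2 + m3}"
    unfolding c1_def c2_def c3_def s[symmetric] 
    by (intro cyclic_on_cycle_of_list distinct_upt; use assms(1-3) in \<open>simp del: upt_Suc\<close>)+
  have f1: "c1 z = z" if "z \<notin> {1..m1}" for z using p(1) that by (rule permutes_not_in)
  have f2: "c2 z = z" if "z \<notin> {m1 + 1..m1 + m2}" for z using p(2) that by (rule permutes_not_in)
  have f3: "c3 z = z" if "z \<notin> {m1 + m2 + 1..m1 + m2 + m3}" for z using p(3) that
      by (rule permutes_not_in)
  have i2: "c2 z \<in> {m1 + 1..m1 + m2}" if "z \<in> {m1 + 1..m1 + m2}" for z
    using permutes_in_image[OF p(2)] that by blast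
  have i3: "c3 z \<in> {m1 + m2 + 1..m1 + m2 + m3}" if "z \<in> {m1 + m2 + 1..m1 + m2 + m3}" for z
    using permutes_in_image[OF p(3)] that by blast
  \<comment> \<open>The cycles have disjoint supports, so on each block only one factor moves the
    point.\<close>
  have 1: "\<tau> z = c1 z" if "z \<in> {1..m1}" for z
    using f2[of z] f3[of z] that by (auto simp: \<tau>)
  have 2: "\<tau> z = c2 z" if "z \<in> {m1 + 1..m1 + m2}" for z
    using f3[of z] i2[of z] f1[of "c2 z"] that by (auto simp: \<tau>)
  have 3: "\<tau> z = c3 z" if "z \<in> {m1 + m2 + 1..m1 + m2 + m3}" for z
    using i3[of z] f1[of "c3 z"] f2[of "c3 z"] that by (auto simp: \<tau>)
  show "cyclic_on \<tau> {1..m1}" "cyclic_on \<tau> {m1 + 1..m1 + m2}" "cyclic_on \<tau> {m1 + m2 + 1..m1 + m2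
      + m3}"
    using c cyclic_cong[of "{1..m1}" \<tau> c1, OF 1] cyclic_cong[of "{m1 + 1..m1 + m2}" \<tau> c2, OF 2]
      cyclic_cong[of "{m1 + m2 + 1..m1 + m2 + m3}" \<tau> c3, OF 3] by auto
qed

lemma num_cycles_three:
  assumes "cyclic_on \<tau> A" "cyclic_on \<tau> B" "cyclic_on \<tau> C" "A \<inter> B = {}" "A \<inter> C = {}" "B \<inter> C = {}"
  shows "num_cycles (A \<union> (B \<union> C)) \<tau> = 3"
proof -
  note fin = assms(1-3)[THEN finite_cyclic_on] and closed = assms(1-3)[THEN cyclic_on_closed]
  have "num_cycles (B \<union> C) \<tau> = 2"
    using num_cycles_Un[OF fin(2,3) assms(6) closed(2,3)] assms(2,3)[THEN num_cycles_cyclic_on]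
        by simp
  moreover have "A \<inter> (B \<union> C) = {}" using assms(4,5) by blast
  moreover have "\<tau> ` (B \<union> C) \<subseteq> B \<union> C" unfolding image_Un by (intro Un_mono closed)
  ultimately show ?thesis
    using num_cycles_Un[of A "B \<union> C" \<tau>] fin closed(1) num_cycles_cyclic_on[OF assms(1)] by simp
qed

lemma gluing_data_planar:
  assumes "m1 > 0" "m2 > 0" "m3 > 0" "m1 + m2 + m3 = 2 * N"
  shows "{\<iota>. fixfree_involution (2 * N) \<iota> \<and> connected_datum3 N ((m1, m2, m3), \<iota>) \<and>
      genus0_datum3 N ((m1, m2, m3), \<iota>)} = planar (face_perm (m1, m2, m3)) {1..2 * N} {1..2 * N}"
    and "real (card (planar (face_perm (m1, m2, m3)) {1..2 * N} {1..2 * N}))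
        = face_weight m1 * face_weight m2 * face_weight m3"
proof -
  let ?\<tau> = "face_perm (m1, m2, m3)"
  let ?A = "{1..m1}" let ?B = "{m1 + 1..m1 + m2}" let ?C = "{m1 + m2 + 1..m1 + m2 + m3}"
  note cyc = face_perm_faces[OF assms(1-3)]
  have \<tau>: "?\<tau> permutes {1..2 * N}" using face_perm_permutes assms(4) .
  have S: "{1..2 * N} = ?A \<union> (?B \<union> ?C)" unfolding assms(4)[symmetric] by auto
  have disj: "?A \<inter> ?B = {}" "?A \<inter> ?C = {}" "?B \<inter> ?C = {}" by auto
  have n: "num_cycles {1..2 * N} ?\<tau> = 3"
    unfolding S using cyc disj by (rule num_cycles_three)
  show "{\<iota>. fixfree_involution (2 * N) \<iota> \<and> connected_datum3 N ((m1, m2, m3), \<iota>) \<and>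
      genus0_datum3 N ((m1, m2, m3), \<iota>)} = planar ?\<tau> {1..2 * N} {1..2 * N}"
  proof (rule Collect_cong[of _ "\<lambda>\<iota>. \<iota> \<in> planar ?\<tau> {1..2 * N} {1..2 * N}", unfolded Collect_mem_eq])
    fix \<iota>
    have f: "fixfree_involution (2 * N) \<iota> \<longleftrightarrow> pairing {1..2 * N} \<iota>"
      by (simp add: fixfree_involution_def pairing_def)
    have "connected_datum3 N ((m1, m2, m3), \<iota>) \<longleftrightarrow> joined ?\<tau> \<iota> {1..2 * N}" if "pairing {1..2 * N} \<iota>"
      using transitive_on_generate_iff_joined[OF _ \<tau>, of \<iota>] that assms
          by (simp add: connected_datum3_def pairing_def)
    \<comment> \<open>With three faces and 2N live points, Euler's equation is 2 (V + 3) = 2N + 4,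
      that is V = N - 1.\<close>
    moreover have "genus0_datum3 N ((m1, m2, m3), \<iota>) \<longleftrightarrow>
        2 * (num_cycles {1..2 * N} (?\<tau> \<circ> \<iota>) + num_cycles {1..2 * N} ?\<tau>) = card {1..2 * N} + 4"
      using assms unfolding n by (auto simp: genus0_datum3_def)
    ultimately show "fixfree_involution (2 * N) \<iota> \<and> connected_datum3 N ((m1, m2, m3), \<iota>) \<and>
      genus0_datum3 N ((m1, m2, m3), \<iota>) \<longleftrightarrow> \<iota> \<in> planar ?\<tau> {1..2 * N} {1..2 * N}"
      unfolding f by (auto simp: planar_def)
  qed
  have even: "even (m1 + m2 + m3)" using assms(4) by simp
  have "permutation ?\<tau>" using \<tau> by (auto simp: permutation_permutes)
  \<comment> \<open>At the outset every corner is live, hence the live set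
    \<open>UNIV\<close>.\<close>
  from card_planar_pants[OF this cyc disj, of UNIV]
  show "real (card (planar ?\<tau> {1..2 * N} {1..2 * N})) = face_weight m1 * face_weight m2 *
      face_weight m3"
    unfolding S using even by (simp add: pants_count_def)
qed

theorem theorem6:
  fixes N :: nat
  assumes "N \<ge> 1"
  shows "real (epsilon0_3 N) =
    (8 * real N + 5) * (real N - 1) * real N * (real N + 1) / 210 * real ((2 * N + 1) choose N)"
proof -
  define M where "M = {(m1, m2, m3). m1 > 0 \<and> m2 > 0 \<and> m3 > 0 \<and> m1 + m2 + m3 = 2 * N}"
  define I where "I = (\<lambda>m. {\<iota>. fixfree_involution (2 * N) \<iota> \<and> connected_datum3 N (m, \<iota>)
      \<and> genus0_datum3 N (m, \<iota>)})"
  have finM: "finite M"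
    by (rule finite_subset[of _ "{..2 * N} \<times> {..2 * N} \<times> {..2 * N}"]) (auto simp: M_def)
  have "{d. gluing_datum3 N d \<and> connected_datum3 N d \<and> genus0_datum3 N d} = Sigma M I"
    by (auto simp: gluing_datum3_def M_def I_def)
  moreover have "\<forall>m\<in>M. finite (I m)"
    by (auto simp: I_def fixfree_involution_def intro: finite_subset[OF _ finite_permutations[of
        "{1..2 * N}"]])
  ultimately have "real (epsilon0_3 N) = (\<Sum>m\<in>M. real (card (I m)))"
    using finM by (simp add: epsilon0_3_def)
  also have "\<dots> = (\<Sum>(m1, m2, m3)\<in>M. face_weight m1 * face_weight m2 * face_weight m3)"
  proof (intro sum.cong refl, clarify)
    fix m1 m2 m3 assume "(m1, m2, m3) \<in> M"
    hence m: "m1 > 0" "m2 > 0" "m3 > 0" "m1 + m2 + m3 = 2 * N" by (auto simp: M_def)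
    show "real (card (I (m1, m2, m3))) = face_weight m1 * face_weight m2 * face_weight m3"
      unfolding I_def gluing_data_planar(1)[OF m] by (rule gluing_data_planar(2)[OF m])
  qed
  also have "\<dots> = (\<Sum>(i, j)\<in>(SIGMA i:{..2 * N}. {..2 * N - i}). face_weight i * face_weight j *
      face_weight (2 * N - i - j))"
    \<comment> \<open>The third degree is determined by the other two. The added pairs in
      \<open>T'\<close> have a face of degree 0 and contribute nothing, as
      \<open>face_weight 0 = 0\<close>.\<close>
    by (rule sum.reindex_bij_witness_not_neutral[where S' = "{}" and
        T' = "{(i, j). i + j \<le> 2 * N \<and> (i = 0 \<or> j = 0 \<or> i + j = 2 * N)}" and
        i = "\<lambda>(i, j). (i, j, 2 * N - i - j)" and j = "\<lambda>(i, j, k). (i, j)"])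
      (auto simp: M_def intro: finite_subset[of _ "{..2 * N} \<times> {..2 * N}"],
        metis add_diff_cancel_left')
  also have "\<dots> = (\<Sum>i\<le>2 * N. \<Sum>j\<le>2 * N - i. face_weight i * face_weight j * face_weight (2 * N - i
      - j))"
    by (rule sum.Sigma[symmetric]) auto
  finally show ?thesis using sum_face_weight_triple[OF assms] by simp
qed

end
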